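(* Let $k$ be a nonnegative integer, let $M$ be a $3$-connected matroid, let $\mathcal{T}$ be a tangle of $M$, let $N$ be a minor of $M$ with no loops and no coloops, and let $t := \rank_{\mathcal{T}}(E(N))$. If the order of $\mathcal{T}$ is at least $20k + t - 13$, then there is a set $X \subseteq E(M)$ with $|X|=k$ such that $\rank_{\mathcal{T}}(E(N)\cup X) = t + k$, and such that one of $M\setminus X$ and $M/X$ is $3$-connected with $N$ as a minor.
   Context: The connectivity function of a matroid $M$ is $\lambda_M(X) = \rank_M(X) + \rank_M(E(M)\setminus X) - \rank(M)$ for $X\subseteq E(M)$. A tangle of order $\theta$ of $M$ is a collection $\mathcal{T}$ of subsets of $E(M)$ such that: (i) $\lambda_M(X)<\theta$ for all $X\in\mathcal{T}$; (ii) for every $X\subseteq E(M)$ with $\lambda_M(X)<\theta$, either $X\in\mathcal{T}$ or $E(M)\setminus X\in\mathcal{T}$; (iii) if $X,Y,Z\in\mathcal{T}$ then $X\cup Y\cup Z\neq E(M)$; (iv) $E(M)\setminus\{e\}\notin\mathcal{T}$ for every $e\in E(M)$. The tangle matroid $M(\mathcal{T})$ is the matroid on $E(M)$ whose rank function $\rank_{\mathcal{T}}$ is given by $\rank_{\mathcal{T}}(X) = \min\{\lambda_M(Y): X\subseteq Y\in\mathcal{T}\}$ if some member of $\mathcal{T}$ contains $X$, and $\rank_{\mathcal{T}}(X)=\theta$ otherwise (this is a matroid rank function). "$M'$ has $N$ as a minor" means $N$ itself (with labelled ground set) equals $M'/C\setminus D$ for some disjoint $C,D\subseteq E(M')$.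 *)

theory Defs
  imports Main
begin

text \<open>A matroid is given by its (finite) ground set and its rank function;
  only the values of the rank function on subsets of the ground set matter.\<close>
type_synonym 'a matroid = "'a set \<times> ('a set \<Rightarrow> nat)"

definition gset :: "'a matroid \<Rightarrow> 'a set" where "gset M = fst M"
definition rk :: "'a matroid \<Rightarrow> 'a set \<Rightarrow> nat" where "rk M = snd M"

definition matroid :: "'a matroid \<Rightarrow> bool" where
  "matroid M \<longleftrightarrow> finite (gset M)
     \<and> (\<forall>X. X \<subseteq> gset M \<longrightarrow> rk M X \<le> card X)
     \<and> (\<forall>X Y. X \<subseteq> Y \<and> Y \<subseteq> gset M \<longrightarrow> rk M X \<le> rk M Y)
     \<and> (\<forall>X Y. X \<subseteq> gset M \<and> Y \<subseteq> gset M \<longrightarrow>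
            rk M (X \<union> Y) + rk M (X \<inter> Y) \<le> rk M X + rk M Y)"

definition deletion :: "'a matroid \<Rightarrow> 'a set \<Rightarrow> 'a matroid" where
  "deletion M D = (gset M - D, rk M)"

definition contraction :: "'a matroid \<Rightarrow> 'a set \<Rightarrow> 'a matroid" where
  "contraction M C = (gset M - C, \<lambda>X. rk M (X \<union> C) - rk M C)"

definition is_minor :: "'a matroid \<Rightarrow> 'a matroid \<Rightarrow> bool" where
  "is_minor N M \<longleftrightarrow> (\<exists>C D. C \<subseteq> gset M \<and> D \<subseteq> gset M \<and> C \<inter> D = {}
      \<and> gset N = gset (deletion (contraction M C) D)
      \<and> (\<forall>X. X \<subseteq> gset N \<longrightarrow> rk N X = rk (deletion (contraction M C) D) X))"

definition loop :: "'a matroid \<Rightarrow> 'a \<Rightarrow> bool" where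
  "loop M e \<longleftrightarrow> e \<in> gset M \<and> rk M {e} = 0"

definition coloop :: "'a matroid \<Rightarrow> 'a \<Rightarrow> bool" where
  "coloop M e \<longleftrightarrow> e \<in> gset M \<and> rk M (gset M - {e}) < rk M (gset M)"

definition conn :: "'a matroid \<Rightarrow> 'a set \<Rightarrow> nat" where
  "conn M X = rk M X + rk M (gset M - X) - rk M (gset M)"

definition k_separation :: "'a matroid \<Rightarrow> nat \<Rightarrow> 'a set \<Rightarrow> bool" where
  "k_separation M k X \<longleftrightarrow> X \<subseteq> gset M \<and> card X \<ge> k \<and> card (gset M - X) \<ge> k
      \<and> conn M X < k"

definition n_connected :: "nat \<Rightarrow> 'a matroid \<Rightarrow> bool" where
  "n_connected n M \<longleftrightarrow> (\<forall>k X. 1 \<le> k \<and> k < n \<longrightarrow> \<not> k_separation M k X)"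

definition is_tangle :: "'a matroid \<Rightarrow> nat \<Rightarrow> 'a set set \<Rightarrow> bool" where
  "is_tangle M \<theta> T \<longleftrightarrow> T \<subseteq> Pow (gset M)
     \<and> (\<forall>X\<in>T. conn M X < \<theta>)
     \<and> (\<forall>X. X \<subseteq> gset M \<and> conn M X < \<theta> \<longrightarrow> X \<in> T \<or> gset M - X \<in> T)
     \<and> (\<forall>X\<in>T. \<forall>Y\<in>T. \<forall>Z\<in>T. X \<union> Y \<union> Z \<noteq> gset M)
     \<and> (\<forall>e\<in>gset M. gset M - {e} \<notin> T)"

definition tangle_rank :: "'a matroid \<Rightarrow> nat \<Rightarrow> 'a set set \<Rightarrow> 'a set \<Rightarrow> nat" where
  "tangle_rank M \<theta> T X =
     (if \<exists>Y\<in>T. X \<subseteq> Y then Min (conn M ` {Y \<in> T. X \<subseteq> Y}) else \<theta>)"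

end

theory Submission
  imports Defs
begin

text \<open>
  Let \<open>F\<close> be a set of the tangle containing \<open>E(N)\<close> and closed in the tangle matroid. If no element outside \<open>F\<close>
  can be deleted or contracted keeping both 3-connectivity and the minor \<open>N\<close>, then every such element \<open>x\<close>
  lies in the guts or coguts of a 3-separation \<open>(A, x, B)\<close> whose side \<open>A\<close> is in the tangle; such a side spans only a
  line of the tangle matroid, so it meets \<open>F\<close> in at most one element. Uncrossing minimal such sides
  produces a fan with four elements, and a fan can be extended at each end outside \<open>F\<close> forever,
  which is absurd. So one element can always be removed.

  Iterating this \<open>6k - 5\<close> times gives disjoint \<open>D\<close> and \<open>C\<close>, independent in the tangle matroid, such that
  \<open>M \<setminus> D / C\<close> is 3-connected with \<open>N\<close> as a minor; a step decreases the order of the tangle by one and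
  increases the rank of the set to be avoided by at most one. Since \<open>D \<union> C\<close> is independent, the
  deletion of \<open>X \<subseteq> D\<close> fails to be 3-connected only if \<open>X \<union> {a, c}\<close> contains a cocircuit for some \<open>c\<close> in \<open>C\<close> and
  some \<open>a\<close>, and dually. By orthogonality the cocircuits obstructing a greedily chosen \<open>X\<close> exclude
  circuits obstructing the set of the corresponding \<open>c\<close>, so \<open>k\<close> elements of one kind can be kept.
\<close>

section \<open>Connectivity\<close>

text \<open>A 3-connected \<open>M \<setminus> D / C\<close> does not make the deletion of part of
  \<open>D\<close> alone 3-connected: undoing the contractions may create 2-separations.
  Independence in the tangle matroid forces one side of each of these to be a pair
  \<open>{a, c}\<close>, which turns it into a cocircuit. Constants: of \<open>6k - 5\<close>
  removed elements at least \<open>3k - 2\<close> are of one kind, say deleted. If the greedy set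
  has at most \<open>k - 1\<close> of them, at least \<open>2k - 1\<close> are rejected, with
  distinct elements of \<open>C\<close> to blame, and all but at most \<open>k - 1\<close> of these
  can be contracted together. After \<open>s\<close> steps the order is \<open>\<theta> - s\<close>
  while the set to be avoided has connectivity \<open>t + s\<close>, so the next step needs
  \<open>t + 2s < \<theta>\<close>; the bound \<open>20k + t - 13\<close> covers this for all
  \<open>s < 6k - 5\<close>. Loops and coloops of \<open>N\<close> are excluded because an element
  of \<open>N\<close> in a triangle or in a 2-separating set could otherwise block the exchanges by
  which an element becomes deletable or contractible. Rank functions are taken with their duals
  throughout, so that each argument is given for one kind and transferred to the other.\<close>

definition lam :: "'a set \<Rightarrow> ('a set \<Rightarrow> int) \<Rightarrow> 'a set \<Rightarrow> int" where
  "lam E r X = r X + r (E - X) - r E"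

definition dual_rank :: "'a set \<Rightarrow> ('a set \<Rightarrow> int) \<Rightarrow> 'a set \<Rightarrow> int" where
  "dual_rank E r X = int (card X) + r (E - X) - r E"

definition contract_rank :: "('a set \<Rightarrow> int) \<Rightarrow> 'a set \<Rightarrow> 'a set \<Rightarrow> int" where
  "contract_rank r C X = r (X \<union> C) - r C"

text \<open>The absence of 1-separations and 2-separations in one inequality. It involves the
  connectivity function only, so it is visibly self-dual.\<close>

definition three_connected :: "'a set \<Rightarrow> ('a set \<Rightarrow> int) \<Rightarrow> bool" where
  "three_connected E r \<longleftrightarrow>
    (\<forall>X\<subseteq>E. min 2 (min (int (card X)) (int (card (E - X)))) \<le> lam E r X)"

lemma three_connectedD2:
  assumes "three_connected E r" "X \<subseteq> E" "2 \<le> card X" "2 \<le> card (E - X)"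
  shows "2 \<le> lam E r X"
proof -
  have "min 2 (min (int (card X)) (int (card (E - X)))) \<le> lam E r X"
    using assms unfolding three_connected_def by blast
  thus ?thesis using assms(3,4) by linarith
qed

lemma not_three_connectedE:
  assumes "\<not> three_connected E r" "\<And>X. X \<subseteq> E \<Longrightarrow> 0 \<le> lam E r X"
  obtains (one) X where "X \<subseteq> E" "1 \<le> card X" "1 \<le> card (E - X)" "lam E r X \<le> 0"
  | (two) X where "X \<subseteq> E" "2 \<le> card X" "2 \<le> card (E - X)" "lam E r X \<le> 1"
proof -
  obtain X where X: "X \<subseteq> E" "\<not> min 2 (min (int (card X)) (int (card (E - X)))) \<le> lam E r X"
    using assms(1) unfolding three_connected_def by blast
  have "0 \<le> lam E r X" using assms(2) X(1) by blast
  thus ?thesis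
  proof (cases "lam E r X \<le> 0")
    case True
    hence "1 \<le> card X" "1 \<le> card (E - X)" using X(2) \<open>0 \<le> lam E r X\<close> by linarith+
    thus ?thesis using one X(1) True by blast
  next
    case False
    hence "2 \<le> card X" "2 \<le> card (E - X)" "lam E r X \<le> 1" using X(2) by linarith+
    thus ?thesis using two X(1) by blast
  qed
qed

lemma three_connected_cong:
  assumes "\<And>X. X \<subseteq> E \<Longrightarrow> lam E r X = lam E r' X"
  shows "three_connected E r \<longleftrightarrow> three_connected E r'"
  using assms unfolding three_connected_def by auto

lemma two_elements:
  assumes "finite X" "2 \<le> card X"
  obtains x y where "x \<in> X" "y \<in> X" "x \<noteq> y"
  by (metis assms card_le_Suc0_iff_eq not_less_eq_eq numeral_2_eq_2)

section \<open>Integer-valued rank functions, their connectivity and their duals\<close>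

locale rank_matroid =
  fixes E :: "'a set" and r :: "'a set \<Rightarrow> int"
  assumes finite_ground: "finite E"
    and rank_nonneg: "\<And>X. X \<subseteq> E \<Longrightarrow> 0 \<le> r X"
    and rank_le_card: "\<And>X. X \<subseteq> E \<Longrightarrow> r X \<le> int (card X)"
    and rank_mono: "\<And>X Y. X \<subseteq> Y \<Longrightarrow> Y \<subseteq> E \<Longrightarrow> r X \<le> r Y"
    and rank_submod: "\<And>X Y. X \<subseteq> E \<Longrightarrow> Y \<subseteq> E \<Longrightarrow> r (X \<union> Y) + r (X \<inter> Y) \<le> r X + r Y"
begin

lemma finite_sub: "X \<subseteq> E \<Longrightarrow> finite X"
  using finite_ground finite_subset by blast

lemma card_diff_ground: "X \<subseteq> E \<Longrightarrow> int (card (E - X)) = int (card E) - int (card X)"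
  using finite_ground by (simp add: card_Diff_subset card_mono finite_subset of_nat_diff)

lemma rank_empty [simp]: "r {} = 0"
  using rank_nonneg[of "{}"] rank_le_card[of "{}"] by simp

lemma contract_rank_empty [simp]: "contract_rank r {} = r"
  by (rule ext) (simp add: contract_rank_def)

lemma rank_submod_eq:
  "X \<subseteq> E \<Longrightarrow> Y \<subseteq> E \<Longrightarrow> X \<union> Y = U \<Longrightarrow> X \<inter> Y = V \<Longrightarrow> r U + r V \<le> r X + r Y"
  using rank_submod by blast

lemma rank_marginal_antimono:
  assumes "X \<subseteq> Y" "Y \<subseteq> E" "Z \<subseteq> E"
  shows "r (Y \<union> Z) - r Y \<le> r (X \<union> Z) - r X"
proof -
  have "r ((X \<union> Z) \<union> Y) + r ((X \<union> Z) \<inter> Y) \<le> r (X \<union> Z) + r Y"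
    using assms by (intro rank_submod) auto
  moreover have "(X \<union> Z) \<union> Y = Y \<union> Z" using assms by blast
  moreover have "r X \<le> r ((X \<union> Z) \<inter> Y)" using assms by (intro rank_mono) auto
  ultimately show ?thesis by simp
qed

lemma rank_insert_antimono:
  assumes "X \<subseteq> Y" "Y \<subseteq> E" "e \<in> E"
  shows "r (insert e Y) - r Y \<le> r (insert e X) - r X"
  using rank_marginal_antimono[of X Y "{e}"] assms by simp

lemma rank_union_le: "X \<subseteq> E \<Longrightarrow> Y \<subseteq> E \<Longrightarrow> r (X \<union> Y) \<le> r X + r Y"
proof -
  assume X: "X \<subseteq> E" "Y \<subseteq> E"
  hence "0 \<le> r (X \<inter> Y)" by (intro rank_nonneg) auto
  thus ?thesis using rank_submod[OF X] by linarith
qed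

lemma rank_insert_le: "X \<subseteq> E \<Longrightarrow> e \<in> E \<Longrightarrow> r (insert e X) \<le> r X + 1"
  using rank_union_le[of X "{e}"] rank_le_card[of "{e}"] by simp

lemma rank_insert_ge: "X \<subseteq> E \<Longrightarrow> e \<in> E \<Longrightarrow> r X \<le> r (insert e X)"
  by (rule rank_mono) auto

lemma rank_insert_eq_mono:
  assumes "r (insert e X) = r X" "X \<subseteq> Y" "Y \<subseteq> E" "e \<in> E"
  shows "r (insert e Y) = r Y"
  using rank_insert_antimono[OF assms(2-4)] rank_insert_ge[OF assms(3,4)] assms(1) by simp

lemma lam_compl: "X \<subseteq> E \<Longrightarrow> lam E r (E - X) = lam E r X"
  unfolding lam_def by (simp add: double_diff)

lemma lam_nonneg: "X \<subseteq> E \<Longrightarrow> 0 \<le> lam E r X"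
proof -
  assume X: "X \<subseteq> E"
  hence "X \<union> (E - X) = E" by blast
  thus ?thesis using rank_union_le[of X "E - X"] X unfolding lam_def by simp
qed

lemma lam_submod_eq:
  assumes "X \<subseteq> E" "Y \<subseteq> E" "X \<union> Y = U" "X \<inter> Y = V"
  shows "lam E r U + lam E r V \<le> lam E r X + lam E r Y"
proof -
  have "r U + r V \<le> r X + r Y" using rank_submod_eq assms by blast
  moreover have "r (E - V) + r (E - U) \<le> r (E - X) + r (E - Y)"
    using assms by (intro rank_submod_eq) auto
  ultimately show ?thesis unfolding lam_def by simp
qed

lemma lam_le_rank: "X \<subseteq> E \<Longrightarrow> lam E r X \<le> r X"
  using rank_mono[of "E - X" E] unfolding lam_def by simp

lemma lam_le_card: "X \<subseteq> E \<Longrightarrow> lam E r X \<le> int (card X)"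
  using lam_le_rank rank_le_card order_trans by blast

lemma lam_empty [simp]: "lam E r {} = 0"
  unfolding lam_def by simp

lemma lam_insert_le:
  assumes "X \<subseteq> E" "x \<in> E" shows "lam E r (insert x X) \<le> lam E r X + 1"
proof -
  have "r (insert x X) \<le> r X + 1" using rank_insert_le assms by blast
  moreover have "r (E - insert x X) \<le> r (E - X)" by (rule rank_mono) auto
  ultimately show ?thesis unfolding lam_def by simp
qed

lemma rank_matroid_dual: "rank_matroid E (dual_rank E r)"
proof
  show "finite E" by (rule finite_ground)
  show "0 \<le> dual_rank E r X" if "X \<subseteq> E" for X
    using lam_nonneg[OF that] rank_le_card[OF that] unfolding lam_def dual_rank_def by simp
  show "dual_rank E r X \<le> int (card X)" if "X \<subseteq> E" for X
    using rank_mono[of "E - X" E] unfolding dual_rank_def by simp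
  show "dual_rank E r X \<le> dual_rank E r Y" if "X \<subseteq> Y" "Y \<subseteq> E" for X Y
  proof -
    have "r ((E - Y) \<union> (Y - X)) \<le> r (E - Y) + r (Y - X)" using that by (intro rank_union_le) auto
    moreover have "(E - Y) \<union> (Y - X) = E - X" using that by blast
    moreover have "r (Y - X) \<le> int (card (Y - X))" using that by (intro rank_le_card) auto
    moreover have "card X + card (Y - X) = card Y"
      using that finite_sub[of Y] by (simp add: card_Diff_subset card_mono finite_subset)
    ultimately show ?thesis unfolding dual_rank_def by simp
  qed
  show "dual_rank E r (X \<union> Y) + dual_rank E r (X \<inter> Y) \<le> dual_rank E r X + dual_rank E r Y"
    if "X \<subseteq> E" "Y \<subseteq> E" for X Y
  proof -
    have "r (E - (X \<inter> Y)) + r (E - (X \<union> Y)) \<le> r (E - X) + r (E - Y)"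
      using that by (intro rank_submod_eq) auto
    moreover have "card (X \<union> Y) + card (X \<inter> Y) = card X + card Y"
      using that card_Un_Int[of X Y] finite_sub by simp
    ultimately show ?thesis unfolding dual_rank_def by simp
  qed
qed

lemma dual_rank_ground: "dual_rank E r E = int (card E) - r E"
  unfolding dual_rank_def by simp

lemma dual_rank_compl: "X \<subseteq> E \<Longrightarrow> dual_rank E r (E - X) = int (card E) - int (card X) + r X - r E"
  unfolding dual_rank_def by (simp add: card_diff_ground double_diff)

lemma lam_dual [simp]: "X \<subseteq> E \<Longrightarrow> lam E (dual_rank E r) X = lam E r X"
  unfolding lam_def by (simp add: dual_rank_ground dual_rank_compl) (simp add: dual_rank_def)

lemma three_connected_dual [simp]: "three_connected E (dual_rank E r) \<longleftrightarrow> three_connected E r"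
  by (rule three_connected_cong) simp

section \<open>Connectivity of minors\<close>

lemma rank_matroid_minor:
  assumes "C \<subseteq> E" "D \<subseteq> E"
  shows "rank_matroid (E - (C \<union> D)) (contract_rank r C)"
proof
  show "finite (E - (C \<union> D))" using finite_ground by blast
  show "0 \<le> contract_rank r C X" if "X \<subseteq> E - (C \<union> D)" for X
    using rank_mono[of C "X \<union> C"] that assms unfolding contract_rank_def by auto
  show "contract_rank r C X \<le> int (card X)" if "X \<subseteq> E - (C \<union> D)" for X
  proof -
    have "r (X \<union> C) \<le> r X + r C" using that assms by (intro rank_union_le) auto
    moreover have "r X \<le> int (card X)" using that by (intro rank_le_card) auto
    ultimately show ?thesis unfolding contract_rank_def by simp
  qed
  show "contract_rank r C X \<le> contract_rank r C Y" if "X \<subseteq> Y" "Y \<subseteq> E - (C \<union> D)" for X Y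
    using rank_mono[of "X \<union> C" "Y \<union> C"] that assms unfolding contract_rank_def by auto
  show "contract_rank r C (X \<union> Y) + contract_rank r C (X \<inter> Y) \<le> contract_rank r C X + contract_rank r C Y"
    if "X \<subseteq> E - (C \<union> D)" "Y \<subseteq> E - (C \<union> D)" for X Y
  proof -
    have "r ((X \<union> Y) \<union> C) + r ((X \<inter> Y) \<union> C) \<le> r (X \<union> C) + r (Y \<union> C)"
      using that assms by (intro rank_submod_eq) auto
    thus ?thesis unfolding contract_rank_def by simp
  qed
qed

lemma rank_matroid_delete: "D \<subseteq> E \<Longrightarrow> rank_matroid (E - D) r"
  using rank_matroid_minor[of "{}" D] by simp

lemma rank_matroid_contract: "C \<subseteq> E \<Longrightarrow> rank_matroid (E - C) (contract_rank r C)"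
  using rank_matroid_minor[of C "{}"] by simp

lemma lam_minor:
  assumes "C \<subseteq> E" "D \<subseteq> E" "C \<inter> D = {}" "Y \<subseteq> E - (C \<union> D)"
  shows "lam (E - (C \<union> D)) (contract_rank r C) Y = r (Y \<union> C) + r (E - D - Y) - r C - r (E - D)"
proof -
  have "(E - (C \<union> D) - Y) \<union> C = E - D - Y" "(E - (C \<union> D)) \<union> C = E - D" using assms by auto
  thus ?thesis unfolding lam_def contract_rank_def by simp
qed

text \<open>Contracting \<open>C\<close> and deleting \<open>D\<close> is dual to contracting
  \<open>D\<close> and deleting \<open>C\<close>. This equality carries every later statement on
  deletions over to contractions.\<close>

lemma lam_minor_dual:
  assumes "C \<subseteq> E" "D \<subseteq> E" "C \<inter> D = {}" "Y \<subseteq> E - (C \<union> D)"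
  shows "lam (E - (D \<union> C)) (contract_rank (dual_rank E r) D) Y = lam (E - (C \<union> D)) (contract_rank r C) Y"
proof -
  interpret d: rank_matroid E "dual_rank E r" by (rule rank_matroid_dual)
  have e: "E - (E - C - Y) = C \<union> Y" "E - (E - C) = C" "E - (Y \<union> D) = E - D - Y" "C \<union> Y = Y \<union> C"
    using assms by auto
  have c: "int (card (Y \<union> D)) = int (card Y) + int (card D)"
    using assms finite_sub[of Y] finite_sub[of D] by (subst card_Un_disjoint) auto
  have "int (card (E - C - Y)) = int (card (E - C)) - int (card Y)"
    using assms rank_matroid.card_diff_ground[OF rank_matroid_contract[OF assms(1)], of Y] by blast
  moreover have "lam (E - (D \<union> C)) (contract_rank (dual_rank E r) D) Y =
      dual_rank E r (Y \<union> D) + dual_rank E r (E - C - Y) - dual_rank E r D - dual_rank E r (E - C)"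
    using assms by (intro d.lam_minor) auto
  moreover have "lam (E - (C \<union> D)) (contract_rank r C) Y = r (Y \<union> C) + r (E - D - Y) - r C - r (E - D)"
    using assms by (rule lam_minor)
  ultimately show ?thesis
    unfolding dual_rank_def by (simp add: e c)
qed

lemma three_connected_minor_dual:
  assumes "C \<subseteq> E" "D \<subseteq> E" "C \<inter> D = {}"
  shows "three_connected (E - (D \<union> C)) (contract_rank (dual_rank E r) D) \<longleftrightarrow>
    three_connected (E - (C \<union> D)) (contract_rank r C)"
  using lam_minor_dual[OF assms] unfolding three_connected_def by (simp add: Un_commute)

text \<open>Connectivity does not grow in minors, on whichever side the removed elements are put;
  \<open>Z\<close> is the part joined to \<open>Y\<close>. The five inequalities deal with the four
  pieces into which \<open>Z\<close> cuts \<open>C\<close> and \<open>D\<close>.\<close>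

lemma lam_minor_le:
  assumes "C \<subseteq> E" "D \<subseteq> E" "C \<inter> D = {}" "Y \<subseteq> E - (C \<union> D)" "Z \<subseteq> C \<union> D"
  shows "lam (E - (C \<union> D)) (contract_rank r C) Y \<le> lam E r (Y \<union> Z)"
proof -
  let ?C1 = "C \<inter> Z" let ?C2 = "C - Z" let ?D1 = "D \<inter> Z" let ?D2 = "D - Z"
  let ?W = "E - (C \<union> D) - Y"
  have 1: "r (Y \<union> C) + r ?C1 \<le> r (Y \<union> ?C1) + r C"
    using assms by (intro rank_submod_eq) auto
  have 2: "r (?W \<union> C) + r ?C2 \<le> r (?W \<union> ?C2) + r C"
    using assms by (intro rank_submod_eq) auto
  have 3: "r (?C1 \<union> ?C2) \<le> r ?C1 + r ?C2" using assms by (intro rank_union_le) auto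
  have 4: "r E + r (?W \<union> ?C2) \<le> r (E - ?D2) + r (?W \<union> ?C2 \<union> ?D2)"
    using assms by (intro rank_submod_eq) auto
  have 5: "r (E - ?D2) + r (Y \<union> ?C1) \<le> r (E - D) + r (Y \<union> ?C1 \<union> ?D1)"
    using assms by (intro rank_submod_eq) auto
  have "?W \<union> C = E - D - Y" "?C1 \<union> ?C2 = C" "?W \<union> ?C2 \<union> ?D2 = E - (Y \<union> Z)" "Y \<union> ?C1 \<union> ?D1 = Y \<union> Z"
    using assms by auto
  thus ?thesis
    using 1 2 3 4 5 by (subst lam_minor[OF assms(1-4)]) (simp add: lam_def)
qed

text \<open>Each removed element lowers connectivity by at most one, on either side. Both placements
  are recorded, since sometimes only one of the two sets is known to be well connected.\<close>

lemma lam_le_minor: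
  assumes "C \<subseteq> E" "D \<subseteq> E" "C \<inter> D = {}" "Y \<subseteq> E - (C \<union> D)"
  shows "lam E r (Y \<union> (C \<union> D)) \<le> lam (E - (C \<union> D)) (contract_rank r C) Y + int (card (C \<union> D))"
    and "lam E r Y \<le> lam (E - (C \<union> D)) (contract_rank r C) Y + int (card (C \<union> D))"
proof -
  have c: "int (card (C \<union> D)) = int (card C) + int (card D)"
    using assms finite_sub by (subst card_Un_disjoint) auto
  have "r (Y \<union> C \<union> D) \<le> r (Y \<union> C) + r D" using assms by (intro rank_union_le) auto
  moreover have "r (E - Y - (C \<union> D)) \<le> r (E - D - Y)" by (intro rank_mono) auto
  moreover have "r D \<le> int (card D)" "r C \<le> int (card C)" using assms rank_le_card by auto
  moreover have "r (E - D) \<le> r E" by (intro rank_mono) auto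
  moreover have "Y \<union> (C \<union> D) = Y \<union> C \<union> D" "E - (Y \<union> (C \<union> D)) = E - Y - (C \<union> D)" by auto
  ultimately show "lam E r (Y \<union> (C \<union> D)) \<le> lam (E - (C \<union> D)) (contract_rank r C) Y + int (card (C \<union> D))"
    by (subst lam_minor[OF assms(1-4)]) (simp add: lam_def c)
  have "r ((E - D - Y) \<union> D) \<le> r (E - D - Y) + r D" using assms by (intro rank_union_le) auto
  moreover have "(E - D - Y) \<union> D = E - Y" using assms by auto
  moreover have "r Y \<le> r (Y \<union> C)" using assms by (intro rank_mono) auto
  ultimately show "lam E r Y \<le> lam (E - (C \<union> D)) (contract_rank r C) Y + int (card (C \<union> D))"
    using \<open>r D \<le> int (card D)\<close> \<open>r C \<le> int (card C)\<close> \<open>r (E - D) \<le> r E\<close>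
    by (subst lam_minor[OF assms(1-4)]) (simp add: lam_def c)
qed

lemma lam_delete_1:
  assumes "e \<in> E" "Y \<subseteq> E - {e}"
  shows "lam (E - {e}) r Y = r Y + r (E - insert e Y) - r (E - {e})"
proof -
  have "E - {e} - Y = E - insert e Y" by auto
  thus ?thesis unfolding lam_def by simp
qed

lemma lam_contract_1:
  assumes "e \<in> E" "Y \<subseteq> E - {e}"
  shows "lam (E - {e}) (contract_rank r {e}) Y = r (insert e Y) + r (E - Y) - r {e} - r E"
  using lam_minor[of "{e}" "{}" Y] assms by simp

text \<open>Deletion and contraction of \<open>w\<close> cannot both lose connectivity. This is the
  inequality behind Tutte's linking theorem; in \<open>linking_single\<close> it decides what to do
  with \<open>w\<close>.\<close>

lemma lam_delete_contract:
  assumes "w \<in> E" "Z1 \<subseteq> E - {w}" "Z2 \<subseteq> E - {w}"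
  shows "lam E r (Z1 \<inter> Z2) + lam E r (insert w (Z1 \<union> Z2)) - 1 \<le>
    lam (E - {w}) r Z1 + lam (E - {w}) (contract_rank r {w}) Z2"
proof -
  have "r (insert w (Z1 \<union> Z2)) + r (Z1 \<inter> Z2) \<le> r Z1 + r (insert w Z2)"
    using assms by (intro rank_submod_eq) auto
  moreover have "r (E - (Z1 \<inter> Z2)) + r (E - insert w (Z1 \<union> Z2)) \<le> r (E - insert w Z1) + r (E - Z2)"
    using assms by (intro rank_submod_eq) auto
  moreover have "r {w} \<le> 1" using rank_le_card[of "{w}"] assms by simp
  moreover have "r (E - {w}) \<le> r E" by (intro rank_mono) auto
  ultimately show ?thesis
    using lam_delete_1[OF assms(1,2)] lam_contract_1[OF assms(1,3)] unfolding lam_def by linarith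
qed

end

text \<open>The case of Tutte's linking theorem in which one of the two sides is a single element.\<close>
lemma linking_single:
  assumes "rank_matroid E r" "W \<subseteq> E" "g \<in> E - W"
    and "\<And>Z. Z \<subseteq> W \<Longrightarrow> 1 \<le> lam E r (insert g Z)"
  shows "\<exists>C\<subseteq>W. r (insert g C) = r C + 1 \<and> r (E - (W - C)) = r (E - (W - C) - {g})"
  using assms
proof (induction "card W" arbitrary: W E r)
  case 0
  then interpret rank_matroid E r by simp
  have "W = {}" using 0 finite_sub by simp
  moreover have "1 \<le> r {g} + r (E - {g}) - r E" using 0(5)[of "{}"] unfolding lam_def by simp
  moreover have "r {g} \<le> 1" using rank_le_card[of "{g}"] 0 by simp
  moreover have "r (E - {g}) \<le> r E" by (intro rank_mono) auto
  ultimately show ?case by (intro exI[of _ "{}"]) auto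
next
  case (Suc n)
  interpret rank_matroid E r by (rule Suc.prems(1))
  have fW: "finite W" using Suc finite_sub by simp
  then obtain w where w: "w \<in> W" using Suc(2) by fastforce
  hence wE: "w \<in> E" and nw: "n = card (W - {w})" using Suc(2) fW Suc.prems by auto
  \<comment> \<open>If both removals of \<open>w\<close> fail, the witnesses \<open>Z1\<close> and
    \<open>Z2\<close> uncross to two sets whose connectivities add up to at most one, although each
    is at least one.\<close>
  consider (del) "\<forall>Z\<subseteq>W - {w}. 1 \<le> lam (E - {w}) r (insert g Z)"
    | (con) "\<forall>Z\<subseteq>W - {w}. 1 \<le> lam (E - {w}) (contract_rank r {w}) (insert g Z)"
    | (neither) Z1 Z2 where "Z1 \<subseteq> W - {w}" "\<not> 1 \<le> lam (E - {w}) r (insert g Z1)"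
       "Z2 \<subseteq> W - {w}" "\<not> 1 \<le> lam (E - {w}) (contract_rank r {w}) (insert g Z2)"
    by blast
  thus ?case
  proof cases
    case del
    have "\<exists>C\<subseteq>W - {w}. r (insert g C) = r C + 1 \<and>
        r (E - {w} - (W - {w} - C)) = r (E - {w} - (W - {w} - C) - {g})"
      using Suc.prems wE w del by (intro Suc.hyps(1)[OF nw]) (auto intro!: rank_matroid_delete)
    then obtain C where C: "C \<subseteq> W - {w}" "r (insert g C) = r C + 1"
        "r (E - {w} - (W - {w} - C)) = r (E - {w} - (W - {w} - C) - {g})" by blast
    moreover have "E - {w} - (W - {w} - C) = E - (W - C)" using C w by auto
    ultimately show ?thesis by (intro exI[of _ C]) auto
  next
    case con
    have "\<exists>C\<subseteq>W - {w}. contract_rank r {w} (insert g C) = contract_rank r {w} C + 1 \<and>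
        contract_rank r {w} (E - {w} - (W - {w} - C)) = contract_rank r {w} (E - {w} - (W - {w} - C) - {g})"
      using Suc.prems wE w con by (intro Suc.hyps(1)[OF nw]) (auto intro!: rank_matroid_contract)
    then obtain C where C: "C \<subseteq> W - {w}"
      "contract_rank r {w} (insert g C) = contract_rank r {w} C + 1"
      "contract_rank r {w} (E - {w} - (W - {w} - C)) = contract_rank r {w} (E - {w} - (W - {w} - C) - {g})"
      by blast
    have "insert g C \<union> {w} = insert g (insert w C)" "C \<union> {w} = insert w C"
      "E - {w} - (W - {w} - C) \<union> {w} = E - (W - insert w C)"
      "E - {w} - (W - {w} - C) - {g} \<union> {w} = E - (W - insert w C) - {g}"
      using C(1) w wE Suc.prems(3) by auto
    thus ?thesis using C w unfolding contract_rank_def by (intro exI[of _ "insert w C"]) auto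
  next
    case neither
    have "lam E r (insert g Z1 \<inter> insert g Z2) + lam E r (insert w (insert g Z1 \<union> insert g Z2)) - 1 \<le>
      lam (E - {w}) r (insert g Z1) + lam (E - {w}) (contract_rank r {w}) (insert g Z2)"
      using neither wE Suc.prems w by (intro lam_delete_contract) auto
    moreover have "1 \<le> lam E r (insert g (Z1 \<inter> Z2))"
      using neither by (intro Suc.prems(4)) auto
    moreover have "1 \<le> lam E r (insert g (insert w (Z1 \<union> Z2)))"
      using neither w by (intro Suc.prems(4)) auto
    moreover have "insert g Z1 \<inter> insert g Z2 = insert g (Z1 \<inter> Z2)"
      "insert w (insert g Z1 \<union> insert g Z2) = insert g (insert w (Z1 \<union> Z2))" by auto
    ultimately show ?thesis using neither by simp
  qed
qed

section \<open>Elements that can be removed keeping a minor\<close>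

text \<open>Only the contracted set is kept, since with \<open>EN\<close> fixed the deleted set is
  \<open>E - EN - C\<close>. The set \<open>C\<close> may be dependent, which leaves freedom for
  exchanges.\<close>

definition carries :: "'a set \<Rightarrow> ('a set \<Rightarrow> int) \<Rightarrow> 'a set \<Rightarrow> ('a set \<Rightarrow> int) \<Rightarrow> 'a set \<Rightarrow> bool" where
  "carries E r EN rN C \<longleftrightarrow> C \<subseteq> E - EN \<and> (\<forall>X\<subseteq>EN. rN X = r (X \<union> C) - r C)"

definition deletable :: "'a set \<Rightarrow> ('a set \<Rightarrow> int) \<Rightarrow> 'a set \<Rightarrow> ('a set \<Rightarrow> int) \<Rightarrow> 'a \<Rightarrow> bool" where
  "deletable E r EN rN x \<longleftrightarrow> x \<in> E - EN \<and> (\<exists>C. carries E r EN rN C \<and> x \<notin> C)"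

definition contractible :: "'a set \<Rightarrow> ('a set \<Rightarrow> int) \<Rightarrow> 'a set \<Rightarrow> ('a set \<Rightarrow> int) \<Rightarrow> 'a \<Rightarrow> bool" where
  "contractible E r EN rN x \<longleftrightarrow> x \<in> E - EN \<and> (\<exists>C. carries E r EN rN C \<and> x \<in> C)"

lemma carries_contract:
  assumes "x \<in> E - EN" "carries (E - {x}) (contract_rank r {x}) EN rN C"
  shows "carries E r EN rN (insert x C)"
  using assms unfolding carries_def contract_rank_def by auto

lemma contract_carries:
  assumes "x \<in> C" "carries E r EN rN C"
  shows "carries (E - {x}) (contract_rank r {x}) EN rN (C - {x})"
proof -
  have "X \<union> (C - {x}) \<union> {x} = X \<union> C" for X using assms(1) by auto
  moreover have "C - {x} \<union> {x} = C" using assms(1) by auto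
  ultimately show ?thesis using assms(2) unfolding carries_def contract_rank_def by auto
qed

locale matroid_with_minor = rank_matroid +
  fixes EN :: "'a set" and rN :: "'a set \<Rightarrow> int"
  assumes minor_ground: "EN \<subseteq> E"
    and minor_loopless: "\<And>g. g \<in> EN \<Longrightarrow> rN {g} \<noteq> 0"
    and minor_coloopless: "\<And>g. g \<in> EN \<Longrightarrow> rN (EN - {g}) = rN EN"
    and minor_carried: "\<exists>C. carries E r EN rN C"
begin

abbreviation "del x \<equiv> deletable E r EN rN x"
abbreviation "con x \<equiv> contractible E r EN rN x"

lemma minor_rank_empty: "rN {} = 0"
  using minor_carried unfolding carries_def by auto

lemma minor_loop_rank:
  assumes "g \<in> EN" shows "rN {g} = 1"
proof -
  obtain C where C: "C \<subseteq> E - EN" "rN {g} = r ({g} \<union> C) - r C"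
    using minor_carried assms unfolding carries_def by blast
  have "r (insert g C) \<le> r C + 1" "r C \<le> r (insert g C)"
    using C(1) assms minor_ground rank_insert_le[of C g] rank_insert_ge[of C g] by auto
  thus ?thesis using C(2) minor_loopless[OF assms] by simp
qed

lemma del_or_con: "x \<in> E - EN \<Longrightarrow> del x \<or> con x"
  using minor_carried unfolding deletable_def contractible_def by blast

text \<open>The dual of \<open>N\<close> arises by contracting what was deleted. The value of
  \<open>rN\<close> at \<open>{}\<close> recovers the constant lost when ranks of complements are
  compared.\<close>

lemma carries_dual_iff:
  assumes "C \<subseteq> E - EN"
  shows "carries E (dual_rank E r) EN (dual_rank EN rN) (E - EN - C) \<longleftrightarrow> carries E r EN rN C"
proof -
  let ?D = "E - EN - C"
  have fin: "finite EN" "finite E" using finite_sub[OF minor_ground] finite_ground by auto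
  have *: "dual_rank E r (X \<union> ?D) - dual_rank E r ?D = int (card X) + r ((EN - X) \<union> C) - r (EN \<union> C)"
    if "X \<subseteq> EN" for X
  proof -
    have "card (X \<union> ?D) = card X + card ?D"
      using that fin finite_subset[OF that] by (subst card_Un_disjoint) auto
    moreover have "E - (X \<union> ?D) = (EN - X) \<union> C" "E - ?D = EN \<union> C"
      using assms that minor_ground by auto
    ultimately show ?thesis unfolding dual_rank_def by simp
  qed
  have "(\<forall>X\<subseteq>EN. rN (EN - X) - rN EN = r ((EN - X) \<union> C) - r (EN \<union> C)) \<longleftrightarrow>
      (\<forall>X\<subseteq>EN. rN X = r (X \<union> C) - r C)" (is "?L \<longleftrightarrow> ?R")
  proof
    assume L: ?L
    have "rN {} - rN EN = r C - r (EN \<union> C)" using L[rule_format, of EN] by simp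
    hence e: "rN EN = r (EN \<union> C) - r C" using minor_rank_empty by simp
    show ?R
    proof (intro allI impI)
      fix X assume "X \<subseteq> EN"
      hence "EN - (EN - X) = X" by auto
      thus "rN X = r (X \<union> C) - r C" using L[rule_format, of "EN - X"] e by simp
    qed
  next
    assume R: ?R
    thus ?L using R[rule_format, of EN] by auto
  qed
  thus ?thesis
    using * assms unfolding carries_def by (auto simp: dual_rank_def)
qed

lemma carries_dual:
  "carries E (dual_rank E r) EN (dual_rank EN rN) D \<longleftrightarrow> D \<subseteq> E - EN \<and> carries E r EN rN (E - EN - D)"
proof (cases "D \<subseteq> E - EN")
  case True
  hence "E - EN - (E - EN - D) = D" by auto
  thus ?thesis using True carries_dual_iff[of "E - EN - D"] by auto
next
  case False
  thus ?thesis unfolding carries_def by auto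
qed

lemma deletable_dual: "deletable E (dual_rank E r) EN (dual_rank EN rN) x \<longleftrightarrow> con x"
proof
  assume "deletable E (dual_rank E r) EN (dual_rank EN rN) x"
  thus "con x" unfolding deletable_def contractible_def carries_dual by blast
next
  assume "con x"
  then obtain C where C: "x \<in> E - EN" "carries E r EN rN C" "x \<in> C"
    unfolding contractible_def by blast
  hence "C \<subseteq> E - EN" unfolding carries_def by blast
  hence "carries E (dual_rank E r) EN (dual_rank EN rN) (E - EN - C)"
    using C carries_dual_iff by blast
  thus "deletable E (dual_rank E r) EN (dual_rank EN rN) x"
    using C unfolding deletable_def by blast
qed

lemma contractible_dual: "contractible E (dual_rank E r) EN (dual_rank EN rN) x \<longleftrightarrow> del x"
proof
  assume "contractible E (dual_rank E r) EN (dual_rank EN rN) x"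
  thus "del x" unfolding deletable_def contractible_def carries_dual by blast
next
  assume "del x"
  then obtain C where C: "x \<in> E - EN" "carries E r EN rN C" "x \<notin> C"
    unfolding deletable_def by blast
  hence "C \<subseteq> E - EN" unfolding carries_def by blast
  hence "carries E (dual_rank E r) EN (dual_rank EN rN) (E - EN - C)"
    using C carries_dual_iff by blast
  thus "contractible E (dual_rank E r) EN (dual_rank EN rN) x"
    using C unfolding contractible_def by blast
qed

lemma matroid_with_minor_dual: "matroid_with_minor E (dual_rank E r) EN (dual_rank EN rN)"
proof -
  interpret d: rank_matroid E "dual_rank E r" by (rule rank_matroid_dual)
  show ?thesis
  proof
    show "EN \<subseteq> E" by (rule minor_ground)
    show "dual_rank EN rN {g} \<noteq> 0" if "g \<in> EN" for g
      using minor_coloopless[OF that] unfolding dual_rank_def by simp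
    show "dual_rank EN rN (EN - {g}) = dual_rank EN rN EN" if "g \<in> EN" for g
    proof -
      have "EN - (EN - {g}) = {g}" using that by auto
      moreover have "int (card (EN - {g})) = int (card EN) - 1"
        using that finite_sub[OF minor_ground] by (metis card_Suc_Diff1 add_diff_cancel_left' of_nat_Suc)
      ultimately show ?thesis
        using minor_loop_rank[OF that] minor_rank_empty unfolding dual_rank_def by simp
    qed
    show "\<exists>C. carries E (dual_rank E r) EN (dual_rank EN rN) C"
    proof -
      obtain C where C: "carries E r EN rN C" using minor_carried by blast
      hence "C \<subseteq> E - EN" unfolding carries_def by blast
      thus ?thesis using carries_dual_iff C by blast
    qed
  qed
qed

text \<open>Once \<open>x\<close> is contracted, \<open>y\<close> and \<open>z\<close> span each
  other. If a carrying set contains \<open>x\<close> and \<open>y\<close>, then \<open>z\<close> is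
  a loop after its contraction and so is not in \<open>N\<close>; replacing \<open>y\<close> by
  \<open>z\<close> keeps the span and frees \<open>y\<close> for deletion.\<close>

lemma con_triangle_del:
  assumes "con x" "y \<in> E - EN" "z \<in> E" "y \<noteq> z" "x \<noteq> y"
    and "r {x, y, z} = r {x, y}" "r {x, y, z} = r {x, z}"
  shows "del y"
proof -
  obtain C where C: "carries E r EN rN C" "x \<in> C" using assms(1) unfolding contractible_def by blast
  show ?thesis
  proof (cases "y \<in> C")
    case False
    thus ?thesis using C assms(2) unfolding deletable_def by blast
  next
    case True
    have sub: "C \<subseteq> E - EN" and N: "\<And>X. X \<subseteq> EN \<Longrightarrow> rN X = r (X \<union> C) - r C"
      using C unfolding carries_def by auto
    have clz: "r (insert z Y) = r Y" if "C \<subseteq> Y" "Y \<subseteq> E" for Y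
    proof (rule rank_insert_eq_mono[of z "{x, y}"])
      show "r (insert z {x, y}) = r {x, y}" using assms(6) by (simp add: insert_commute)
    qed (use that True C assms in auto)
    have cly: "r (insert y Y) = r Y" if "x \<in> Y" "z \<in> Y" "Y \<subseteq> E" for Y
    proof (rule rank_insert_eq_mono[of y "{x, z}"])
      show "r (insert y {x, z}) = r {x, z}" using assms(7) by (simp add: insert_commute)
    qed (use that assms in auto)
    have zN: "z \<notin> EN"
    proof
      assume z: "z \<in> EN"
      hence "rN {z} = r (insert z C) - r C" using N[of "{z}"] by simp
      thus False using clz[of C] sub minor_loopless[OF z] by auto
    qed
    let ?C = "insert z (C - {y})"
    have eq: "r (X \<union> ?C) = r (X \<union> C)" if "X \<subseteq> E" for X
    proof -
      have "r (insert y (X \<union> ?C)) = r (X \<union> ?C)"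
        using cly[of "X \<union> ?C"] C(2) that sub assms(3,5) by auto
      moreover have "insert y (X \<union> ?C) = insert z (X \<union> C)" using True by auto
      moreover have "r (insert z (X \<union> C)) = r (X \<union> C)" using that sub by (intro clz) auto
      ultimately show ?thesis by simp
    qed
    have "carries E r EN rN ?C"
      unfolding carries_def
    proof (intro conjI allI impI)
      show "?C \<subseteq> E - EN" using sub zN assms(3) by auto
      fix X assume "X \<subseteq> EN"
      thus "rN X = r (X \<union> ?C) - r ?C"
        using N eq[of X] eq[of "{}"] minor_ground by auto
    qed
    thus ?thesis using assms(2,4) unfolding deletable_def by blast
  qed
qed

text \<open>What is contracted inside \<open>A\<close> may be swapped for anything with the same
  effect on the outside of \<open>A\<close> and on the part of \<open>N\<close> inside.\<close>

lemma carries_exchange: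
  assumes "carries E r EN rN C" "A \<subseteq> E" "Z \<subseteq> A - EN"
    and "\<And>W. W \<subseteq> (E - A) \<union> (EN \<inter> A) \<Longrightarrow> r (W \<union> (C \<inter> A)) - r (C \<inter> A) = r (W \<union> Z) - r Z"
  shows "carries E r EN rN (Z \<union> (C - A))"
proof -
  have sub: "C \<subseteq> E - EN" and N: "\<And>X. X \<subseteq> EN \<Longrightarrow> rN X = r (X \<union> C) - r C"
    using assms(1) unfolding carries_def by auto
  show ?thesis unfolding carries_def
  proof (intro conjI allI impI)
    show "Z \<union> (C - A) \<subseteq> E - EN" using sub assms by auto
    fix X assume X: "X \<subseteq> EN"
    have "r ((X \<union> (C - A)) \<union> (C \<inter> A)) - r (C \<inter> A) = r ((X \<union> (C - A)) \<union> Z) - r Z"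
      using X sub minor_ground by (intro assms(4)) auto
    moreover have "r ((C - A) \<union> (C \<inter> A)) - r (C \<inter> A) = r ((C - A) \<union> Z) - r Z"
      using X sub minor_ground by (intro assms(4)) auto
    moreover have "(X \<union> (C - A)) \<union> (C \<inter> A) = X \<union> C" "(C - A) \<union> (C \<inter> A) = C"
      "(X \<union> (C - A)) \<union> Z = X \<union> (Z \<union> (C - A))" "(C - A) \<union> Z = Z \<union> (C - A)" by auto
    ultimately show "rN X = r (X \<union> (Z \<union> (C - A))) - r (Z \<union> (C - A))" using N[OF X] by simp
  qed
qed

end

context rank_matroid
begin

text \<open>If \<open>A\<close> has connectivity 1, then a subset \<open>Z\<close> of \<open>A\<close> interacts with the complement \<open>B\<close> of \<open>A\<close>
  only through whether it spans the base point of the 2-sum, that is, whether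
  \<open>r Z + r B - r (Z \<union> B)\<close> is 0 or 1.\<close>

lemma two_sum_local_0:
  assumes "A \<subseteq> E" "Z \<subseteq> A" "r (Z \<union> (E - A)) = r Z + r (E - A)" "W \<subseteq> E - A"
  shows "r (W \<union> Z) = r W + r Z"
proof -
  have "r ((E - A) \<union> Z) - r (E - A) \<le> r (W \<union> Z) - r W"
    using assms by (intro rank_marginal_antimono) auto
  moreover have "r (W \<union> Z) \<le> r W + r Z" using assms by (intro rank_union_le) auto
  ultimately show ?thesis using assms(3) by (simp add: Un_commute)
qed

lemma two_sum_local_1:
  assumes "A \<subseteq> E" "lam E r A = 1" "Z \<subseteq> A" "r (Z \<union> (E - A)) = r Z + r (E - A) - 1" "W \<subseteq> E - A"
  shows "r (W \<union> Z) - r Z = r (W \<union> A) - r A"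
proof -
  have "r (A \<union> W) - r A \<le> r (Z \<union> W) - r Z"
    using assms by (intro rank_marginal_antimono) auto
  moreover have "r E + r (W \<union> Z) \<le> r (W \<union> A) + r (Z \<union> (E - A))"
    using assms by (intro rank_submod_eq) auto
  ultimately show ?thesis using assms(2,4) unfolding lam_def by (simp add: Un_commute)
qed

lemma two_sum_local_cases:
  assumes "A \<subseteq> E" "lam E r A = 1" "Z \<subseteq> A"
  shows "r (Z \<union> (E - A)) = r Z + r (E - A) \<or> r (Z \<union> (E - A)) = r Z + r (E - A) - 1"
proof -
  have "r (A \<union> (E - A)) - r A \<le> r (Z \<union> (E - A)) - r Z"
    using assms by (intro rank_marginal_antimono) auto
  moreover have "A \<union> (E - A) = E" using assms by auto
  moreover have "r (Z \<union> (E - A)) \<le> r Z + r (E - A)" using assms by (intro rank_union_le) auto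
  ultimately show ?thesis using assms(2) unfolding lam_def by simp linarith
qed

end

context matroid_with_minor
begin

text \<open>The part of a carrying set in \<open>A\<close> acts on the rest only through the base
  point of the 2-sum, so any set of the same type may replace it. Minimality of \<open>A\<close>
  provides sets of that type both with and without \<open>y\<close>.\<close>

lemma minimal_two_separation_del_con:
  assumes A: "A \<subseteq> E" "lam E r A \<le> 1" "3 \<le> card A" "card (A \<inter> EN) \<le> 1"
    and min: "\<And>Z. Z \<subset> A \<Longrightarrow> 2 \<le> card Z \<Longrightarrow> 2 \<le> lam E r Z"
    and y: "y \<in> A - EN"
  shows "del y \<and> con y"
proof -
  have fA: "finite A" using A finite_sub by blast
  have yE: "y \<in> E" using y A by auto
  let ?B = "E - A"
  obtain C where C: "carries E r EN rN C" using minor_carried by blast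
  have sub: "C \<subseteq> E - EN" and N: "\<And>X. X \<subseteq> EN \<Longrightarrow> rN X = r (X \<union> C) - r C"
    using C unfolding carries_def by auto
  have cy: "card (A - {y}) = card A - 1" using y fA by simp
  have ly: "2 \<le> lam E r (A - {y})" using y cy A(3) by (intro min) auto
  have insy: "insert y (A - {y}) = A" using y by auto
  have "lam E r (A - {y}) \<le> lam E r A + 1"
  proof -
    have "lam E r (A - {y}) = lam E r (insert y ?B)"
    proof -
      have "E - (A - {y}) = insert y ?B" using A y by auto
      moreover have "A - {y} \<subseteq> E" using A by auto
      ultimately show ?thesis using lam_compl[of "A - {y}"] by simp
    qed
    also have "\<dots> \<le> lam E r ?B + 1" using yE by (intro lam_insert_le) auto
    finally show ?thesis using lam_compl A(1) by simp
  qed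
  hence lA: "lam E r A = 1" using A ly by simp
  have pair: "2 \<le> lam E r {y, u}" if "u \<in> A" "u \<noteq> y" for u
    using that y A(3) by (intro min) (auto simp: psubset_eq)
  obtain u where u: "u \<in> A" "u \<noteq> y"
    using A(3) fA y by (metis Diff_iff card_le_Suc0_iff_eq not_less_eq_eq numeral_3_eq_3 Suc_leD)
  have ly1: "1 \<le> lam E r {y}"
    using pair[OF u] lam_insert_le[of "{y}" u] u A yE by (auto simp: insert_commute)
  have "r {y} \<le> 1" using rank_le_card[of "{y}"] yE by simp
  have "r (E - {y}) \<le> r E" by (intro rank_mono) auto
  hence ry: "r {y} = 1" "r (E - {y}) = r E"
    using ly1 \<open>r {y} \<le> 1\<close> unfolding lam_def by auto
  have exch: "carries E r EN rN (Z \<union> (C - A))"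
    if "Z \<subseteq> A - EN" "\<And>W. W \<subseteq> ?B \<union> (EN \<inter> A) \<Longrightarrow> r (W \<union> (C \<inter> A)) - r (C \<inter> A) = r (W \<union> Z) - r Z" for Z
    using carries_exchange[OF C A(1) that] .
  have goal: "del y \<and> con y" if "carries E r EN rN (Z1 \<union> (C - A))" "y \<notin> Z1"
    "carries E r EN rN (Z2 \<union> (C - A))" "y \<in> Z2" for Z1 Z2
    using that y yE unfolding deletable_def contractible_def by blast
  show ?thesis
  proof (cases "EN \<inter> A = {}")
    case True
    have CA: "C \<inter> A \<subseteq> A" by auto
    from two_sum_local_cases[OF A(1) lA CA] show ?thesis
    proof
      \<comment> \<open>The base point is not spanned: \<open>{}\<close> and \<open>{y}\<close> are
        both of this type, since minimality keeps \<open>y\<close> out of the span of the complement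
        of \<open>A\<close>.\<close>
      assume 0: "r ((C \<inter> A) \<union> ?B) = r (C \<inter> A) + r ?B"
      have *: "r ({y} \<union> ?B) = r {y} + r ?B"
      proof -
        have "r (A - {y}) + r (insert y ?B) - r E \<ge> 2"
        proof -
          have "E - (A - {y}) = insert y ?B" using y A by auto
          thus ?thesis using ly unfolding lam_def by simp
        qed
        moreover have "r (A - {y}) \<le> r A" using A by (intro rank_mono) auto
        moreover have "r (insert y ?B) \<le> r ?B + 1" using yE by (intro rank_insert_le) auto
        ultimately show ?thesis using lA ry unfolding lam_def by simp
      qed
      have "carries E r EN rN ({} \<union> (C - A))"
      proof (rule exch)
        fix W assume "W \<subseteq> ?B \<union> (EN \<inter> A)"
        hence "W \<subseteq> ?B" using True by auto
        thus "r (W \<union> (C \<inter> A)) - r (C \<inter> A) = r (W \<union> {}) - r {}"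
          using two_sum_local_0[OF A(1) CA 0] by simp
      qed auto
      moreover have "carries E r EN rN ({y} \<union> (C - A))"
      proof (rule exch)
        fix W assume "W \<subseteq> ?B \<union> (EN \<inter> A)"
        hence "W \<subseteq> ?B" using True by auto
        have "{y} \<subseteq> A" using y by auto
        hence "r (W \<union> {y}) = r W + r {y}" using * \<open>W \<subseteq> ?B\<close> by (rule two_sum_local_0[OF A(1)])
        thus "r (W \<union> (C \<inter> A)) - r (C \<inter> A) = r (W \<union> {y}) - r {y}"
          using two_sum_local_0[OF A(1) CA 0 \<open>W \<subseteq> ?B\<close>] by linarith
      qed (use y in auto)
      ultimately show ?thesis using goal by blast
    next
      \<comment> \<open>The base point is spanned: \<open>A\<close> and \<open>A - {y}\<close> are
        both of this type.\<close>
      assume 1: "r ((C \<inter> A) \<union> ?B) = r (C \<inter> A) + r ?B - 1"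
      have a: "r (A \<union> ?B) = r A + r ?B - 1"
        using lA A(1) unfolding lam_def by (simp add: Un_absorb1)
      have s: "A - {y} \<subseteq> A" by auto
      have b: "r ((A - {y}) \<union> ?B) = r (A - {y}) + r ?B - 1"
      proof -
        have "E - (A - {y}) = insert y ?B" using y A by auto
        hence "r (A - {y}) + r (insert y ?B) - r E \<ge> 2" using ly unfolding lam_def by simp
        moreover have "r (insert y ?B) \<le> r ?B + 1" using yE by (intro rank_insert_le) auto
        moreover have "(A - {y}) \<union> ?B = E - {y}" using y A by auto
        moreover have "r (A - {y}) \<le> r A" using A by (intro rank_mono) auto
        ultimately show ?thesis using lA ry two_sum_local_cases[OF A(1) lA s] unfolding lam_def by simp
      qed
      have W: "W \<subseteq> ?B" if "W \<subseteq> ?B \<union> (EN \<inter> A)" for W using that True by auto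
      have "carries E r EN rN ((A - {y}) \<union> (C - A))"
      proof (rule exch)
        fix W assume "W \<subseteq> ?B \<union> (EN \<inter> A)"
        thus "r (W \<union> (C \<inter> A)) - r (C \<inter> A) = r (W \<union> (A - {y})) - r (A - {y})"
          using two_sum_local_1[OF A(1) lA CA 1] two_sum_local_1[OF A(1) lA s b] W by presburger
      qed (use True in auto)
      moreover have "carries E r EN rN (A \<union> (C - A))"
      proof (rule exch)
        fix W assume "W \<subseteq> ?B \<union> (EN \<inter> A)"
        thus "r (W \<union> (C \<inter> A)) - r (C \<inter> A) = r (W \<union> A) - r A"
          using two_sum_local_1[OF A(1) lA CA 1] W by presburger
      qed (use True in auto)
      ultimately show ?thesis using goal y by blast
    qed
  next
    case False
    then obtain g where g: "EN \<inter> A = {g}"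
      using A(4) fA by (metis Int_commute card_le_Suc0_iff_eq finite_Int One_nat_def is_singletonE is_singletonI')
    hence gE: "g \<in> EN" "g \<in> A" "g \<noteq> y" "g \<in> E" using y A by auto
    \<comment> \<open>The element \<open>g\<close> is the only one of \<open>N\<close> in
      \<open>A\<close>. If it is no loop after contracting \<open>Z\<close> and no coloop once the
      rest of \<open>A\<close> is deleted, it is parallel to the base point, and this determines the
      effect of \<open>Z\<close> completely.\<close>
    have det: "r (W \<union> Z) - r Z = (if g \<in> W then r ((W - {g}) \<union> A) - r A + 1 else r W)"
      if Z: "Z \<subseteq> A - {g}" "r (insert g Z) = r Z + 1" "r (insert g (Z \<union> ?B)) = r (Z \<union> ?B)"
        and W: "W \<subseteq> ?B \<union> (EN \<inter> A)" for Z W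
    proof -
      have s: "Z \<subseteq> A" "insert g Z \<subseteq> A" using Z gE by auto
      have e: "insert g Z \<union> ?B = insert g (Z \<union> ?B)" by auto
      have z: "r (Z \<union> ?B) = r Z + r ?B" "r (insert g Z \<union> ?B) = r (insert g Z) + r ?B - 1"
        using two_sum_local_cases[OF A(1) lA s(1)] two_sum_local_cases[OF A(1) lA s(2)] Z e by auto
      show ?thesis
      proof (cases "g \<in> W")
        case True
        have "W - {g} \<subseteq> ?B" using W g by auto
        hence "r ((W - {g}) \<union> insert g Z) - r (insert g Z) = r ((W - {g}) \<union> A) - r A"
          by (rule two_sum_local_1[OF A(1) lA s(2) z(2)])
        moreover have "(W - {g}) \<union> insert g Z = W \<union> Z" using True by auto
        ultimately show ?thesis using True Z by simp
      next
        case False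
        hence "W \<subseteq> ?B" using W g by auto
        thus ?thesis using two_sum_local_0[OF A(1) s(1) z(1)] False by simp
      qed
    qed
    have CA: "C \<inter> A \<subseteq> A - {g}" using sub gE by auto
    have CA1: "r (insert g (C \<inter> A)) = r (C \<inter> A) + 1"
    proof (rule ccontr)
      assume "r (insert g (C \<inter> A)) \<noteq> r (C \<inter> A) + 1"
      moreover have "r (insert g (C \<inter> A)) \<le> r (C \<inter> A) + 1" "r (C \<inter> A) \<le> r (insert g (C \<inter> A))"
        using A gE by (auto intro!: rank_insert_le rank_insert_ge)
      ultimately have "r (insert g (C \<inter> A)) = r (C \<inter> A)" by simp
      hence "r (insert g C) = r C"
        by (rule rank_insert_eq_mono) (use sub gE in auto)
      thus False using N[of "{g}"] gE minor_loopless by simp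
    qed
    have CA2: "r (insert g ((C \<inter> A) \<union> ?B)) = r ((C \<inter> A) \<union> ?B)"
    proof -
      have "r (insert g ((C \<inter> A) \<union> ?B)) - r ((C \<inter> A) \<union> ?B) \<le> r (insert g ((EN - {g}) \<union> C)) - r ((EN - {g}) \<union> C)"
        using sub g gE minor_ground A by (intro rank_insert_antimono) auto
      moreover have "insert g ((EN - {g}) \<union> C) = EN \<union> C" using gE by auto
      moreover have "r (EN \<union> C) = r ((EN - {g}) \<union> C)"
        using N[of EN] N[of "EN - {g}"] minor_coloopless[OF gE(1)] by auto
      moreover have "r ((C \<inter> A) \<union> ?B) \<le> r (insert g ((C \<inter> A) \<union> ?B))"
        using A gE by (intro rank_insert_ge) auto
      ultimately show ?thesis by simp
    qed
    have car: "carries E r EN rN (Z \<union> (C - A))"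
      if Z: "Z \<subseteq> A - {g}" "r (insert g Z) = r Z + 1" "r (insert g (Z \<union> ?B)) = r (Z \<union> ?B)" for Z
    proof (rule exch)
      show "Z \<subseteq> A - EN" using Z(1) g by auto
      fix W assume "W \<subseteq> ?B \<union> (EN \<inter> A)"
      thus "r (W \<union> (C \<inter> A)) - r (C \<inter> A) = r (W \<union> Z) - r Z"
        using det[OF Z] det[OF CA CA1 CA2] by simp
    qed
    let ?W = "A - {g, y}"
    \<comment> \<open>Removing \<open>y\<close> costs at most one, so connectivity two with
      \<open>y\<close> on one of the sides leaves the one that \<open>linking_single\<close> asks
      for, in the deletion and in the contraction of \<open>y\<close>.\<close>
    have big: "2 \<le> lam E r (insert g Z) \<or> 2 \<le> lam E r (insert y (insert g Z))" if "Z \<subseteq> ?W" for Z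
    proof (cases "Z = {}")
      case True
      thus ?thesis using pair[of g] gE by simp
    next
      case False
      have fZ: "finite Z" using that fA finite_subset by auto
      have "g \<notin> Z" using that by auto
      hence "card (insert g Z) = Suc (card Z)" using fZ by simp
      moreover have "card Z \<noteq> 0" using False fZ by simp
      ultimately have "2 \<le> card (insert g Z)" by simp
      moreover have "insert g Z \<subset> A" using that gE y by auto
      ultimately show ?thesis using min by blast
    qed
    have WE: "?W \<subseteq> E - {y}" "g \<in> E - {y} - ?W" using A gE by auto
    have ground: "E - {y} - (?W - Z) = insert g (Z \<union> ?B)" if "Z \<subseteq> ?W" for Z
      using that A gE y by auto
    have ground': "E - {y} - (?W - Z) - {g} = Z \<union> ?B" if "Z \<subseteq> ?W" for Z
      using that A gE y by auto
    have "\<exists>Z\<subseteq>?W. r (insert g Z) = r Z + 1 \<and> r (E - {y} - (?W - Z)) = r (E - {y} - (?W - Z) - {g})"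
    proof (rule linking_single[OF rank_matroid_delete WE])
      fix Z assume Z: "Z \<subseteq> ?W"
      have "lam E r (insert g Z \<union> ({} \<union> {y})) \<le> lam (E - ({} \<union> {y})) (contract_rank r {}) (insert g Z) + int (card ({} \<union> {y}))"
        "lam E r (insert g Z) \<le> lam (E - ({} \<union> {y})) (contract_rank r {}) (insert g Z) + int (card ({} \<union> {y}))"
        by (rule lam_le_minor; use Z A gE yE in auto)+
      thus "1 \<le> lam (E - {y}) r (insert g Z)" using big[OF Z] by auto
    qed (use yE in auto)
    then obtain Z1 where Z1: "Z1 \<subseteq> ?W" "r (insert g Z1) = r Z1 + 1"
      "r (E - {y} - (?W - Z1)) = r (E - {y} - (?W - Z1) - {g})" by blast
    have c1: "carries E r EN rN (Z1 \<union> (C - A))"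
    proof (rule car)
      show "r (insert g (Z1 \<union> ?B)) = r (Z1 \<union> ?B)"
        using Z1(3) ground[OF Z1(1)] ground'[OF Z1(1)] by simp
    qed (use Z1 in auto)
    have "\<exists>Z\<subseteq>?W. contract_rank r {y} (insert g Z) = contract_rank r {y} Z + 1 \<and>
        contract_rank r {y} (E - {y} - (?W - Z)) = contract_rank r {y} (E - {y} - (?W - Z) - {g})"
    proof (rule linking_single[OF rank_matroid_contract WE])
      fix Z assume Z: "Z \<subseteq> ?W"
      have "lam E r (insert g Z \<union> ({y} \<union> {})) \<le> lam (E - ({y} \<union> {})) (contract_rank r {y}) (insert g Z) + int (card ({y} \<union> {}))"
        "lam E r (insert g Z) \<le> lam (E - ({y} \<union> {})) (contract_rank r {y}) (insert g Z) + int (card ({y} \<union> {}))"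
        by (rule lam_le_minor; use Z A gE yE in auto)+
      thus "1 \<le> lam (E - {y}) (contract_rank r {y}) (insert g Z)" using big[OF Z] by auto
    qed (use yE in auto)
    then obtain Z2 where Z2: "Z2 \<subseteq> ?W" "contract_rank r {y} (insert g Z2) = contract_rank r {y} Z2 + 1"
      "contract_rank r {y} (E - {y} - (?W - Z2)) = contract_rank r {y} (E - {y} - (?W - Z2) - {g})" by blast
    have c2: "carries E r EN rN (insert y Z2 \<union> (C - A))"
    proof (rule car)
      show "r (insert g (insert y Z2)) = r (insert y Z2) + 1"
        using Z2(2) unfolding contract_rank_def by (simp add: insert_commute)
      show "r (insert g (insert y Z2 \<union> ?B)) = r (insert y Z2 \<union> ?B)"
        using Z2(3)[unfolded ground'[OF Z2(1)]] unfolding ground[OF Z2(1)] contract_rank_def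
        by (simp add: insert_commute)
      show "insert y Z2 \<subseteq> A - {g}" using Z2(1) y gE by auto
    qed
    show ?thesis using goal[OF c1 _ c2] Z1 by auto
  qed
qed

end

section \<open>Separations around an element\<close>

definition triangle :: "'a set \<Rightarrow> ('a set \<Rightarrow> int) \<Rightarrow> 'a set \<Rightarrow> bool" where
  "triangle E r S \<longleftrightarrow> S \<subseteq> E \<and> card S = 3 \<and> r S = 2"

definition triad :: "'a set \<Rightarrow> ('a set \<Rightarrow> int) \<Rightarrow> 'a set \<Rightarrow> bool" where
  "triad E r S \<longleftrightarrow> S \<subseteq> E \<and> card S = 3 \<and> r (E - S) = r E - 1"

text \<open>The side \<open>B\<close> is the rest of \<open>E\<close>. Requiring
  \<open>insert x A\<close> and not just \<open>A\<close> in the tangle gives \<open>B\<close> two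
  elements by \<open>tangle_card_compl\<close> and makes subsets containing \<open>x\<close>
  accessible to \<open>tangle_down\<close>.\<close>

definition three_sep :: "'a set \<Rightarrow> ('a set \<Rightarrow> int) \<Rightarrow> 'a set set \<Rightarrow> 'a \<Rightarrow> 'a set \<Rightarrow> bool" where
  "three_sep E r T x A \<longleftrightarrow> x \<in> E - A \<and> A \<subseteq> E \<and> 2 \<le> card A \<and> insert x A \<in> T
     \<and> lam E r A \<le> 2 \<and> lam E r (insert x A) \<le> 2"

text \<open>For a 3-connected matroid, \<open>guts_sep x A\<close> says that \<open>A\<close> is the side of a 2-separation of the
  contraction of \<open>x\<close> lying in the tangle; \<open>coguts_sep\<close> is the same for the deletion of \<open>x\<close>.\<close>

definition guts_sep :: "'a set \<Rightarrow> ('a set \<Rightarrow> int) \<Rightarrow> 'a set set \<Rightarrow> 'a \<Rightarrow> 'a set \<Rightarrow> bool" where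
  "guts_sep E r T x A \<longleftrightarrow> three_sep E r T x A \<and> r (insert x A) = r A"

definition coguts_sep :: "'a set \<Rightarrow> ('a set \<Rightarrow> int) \<Rightarrow> 'a set set \<Rightarrow> 'a \<Rightarrow> 'a set \<Rightarrow> bool" where
  "coguts_sep E r T x A \<longleftrightarrow> three_sep E r T x A \<and> r (insert x A) = r A + 1"

lemma card_3_distinct: "card {x, y, z} = 3 \<longleftrightarrow> x \<noteq> y \<and> x \<noteq> z \<and> y \<noteq> z"
  by (auto simp: card_insert_if)

lemma card_3_obtain:
  assumes "card S = 3" "x \<in> S"
  obtains y z where "S = {x, y, z}" "x \<noteq> y" "x \<noteq> z" "y \<noteq> z"
proof -
  obtain a b c where "S = {a, b, c}" "a \<noteq> b" "b \<noteq> c" "a \<noteq> c" using assms(1) card_3_iff by metis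
  thus ?thesis using assms(2) that[of b c] that[of a c] that[of a b] by auto
qed

context rank_matroid
begin

lemma triangle_dual: "triangle E (dual_rank E r) S \<longleftrightarrow> triad E r S"
  unfolding triangle_def triad_def dual_rank_def by auto

lemma triad_dual: "triad E (dual_rank E r) S \<longleftrightarrow> triangle E r S"
  unfolding triangle_def triad_def by (auto simp: dual_rank_compl dual_rank_ground)

text \<open>With \<open>x\<close> and \<open>z\<close> in \<open>X\<close>, the element
  \<open>y\<close> is in the coclosure of \<open>X\<close>: its departure costs the complement a
  full unit of rank, which pays for what it may add to the rank of \<open>X\<close>.\<close>

lemma triad_lam_insert:
  assumes "triad E r {x, y, z}" "x \<in> X" "z \<in> X" "y \<notin> X" "X \<subseteq> E" "r (E - {x, z}) = r E"
  shows "lam E r (insert y X) \<le> lam E r X"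
proof -
  have E: "x \<in> E" "y \<in> E" "z \<in> E" "x \<noteq> y" "z \<noteq> y" "r (E - {x, y, z}) = r E - 1"
    using assms(1) unfolding triad_def card_3_distinct by auto
  have "r (insert y (E - {x, y, z})) - r (E - {x, y, z}) \<le> r (insert y (E - insert y X)) - r (E - insert y X)"
    using assms E by (intro rank_insert_antimono) auto
  moreover have "insert y (E - {x, y, z}) = E - {x, z}" using E by auto
  moreover have "insert y (E - insert y X) = E - X" using E assms by auto
  moreover have "r (insert y X) \<le> r X + 1" using assms E by (intro rank_insert_le) auto
  ultimately show ?thesis using E assms(6) unfolding lam_def by simp
qed

end

section \<open>Tangles over integer rank functions\<close>

locale tangle_matroid = rank_matroid +
  fixes T :: "'a set set" and \<theta> :: int
  assumes tangle_subset: "\<And>X. X \<in> T \<Longrightarrow> X \<subseteq> E"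
    and tangle_lam: "\<And>X. X \<in> T \<Longrightarrow> lam E r X < \<theta>"
    and tangle_cover: "\<And>X. X \<subseteq> E \<Longrightarrow> lam E r X < \<theta> \<Longrightarrow> X \<in> T \<or> E - X \<in> T"
    and tangle_three: "\<And>X Y Z. X \<in> T \<Longrightarrow> Y \<in> T \<Longrightarrow> Z \<in> T \<Longrightarrow> X \<union> Y \<union> Z \<noteq> E"
    and tangle_co_single: "\<And>e. e \<in> E \<Longrightarrow> E - {e} \<notin> T"
begin

lemma tangle_down: "X \<in> T \<Longrightarrow> Y \<subseteq> X \<Longrightarrow> lam E r Y < \<theta> \<Longrightarrow> Y \<in> T"
  using tangle_cover[of Y] tangle_three[of X X "E - Y"] tangle_subset[of X] by blast

lemma tangle_union:
  assumes "X \<in> T" "Y \<in> T" "lam E r (X \<union> Y) < \<theta>"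
  shows "X \<union> Y \<in> T"
  using tangle_cover[of "X \<union> Y"] tangle_three[of X Y "E - (X \<union> Y)"] tangle_subset[of X]
    tangle_subset[of Y] assms by blast

lemma tangle_not_ground: "E \<notin> T"
  using tangle_three[of E E E] by blast

text \<open>Singletons are forced in by the axiom on \<open>E - {e}\<close>; a larger set is the
  union of a smaller one and a singleton, and its size bounds its connectivity.\<close>

lemma tangle_small: "X \<subseteq> E \<Longrightarrow> int (card X) < \<theta> \<Longrightarrow> X \<in> T"
proof (induction "card X" arbitrary: X)
  case 0
  hence "X = {}" using finite_sub by simp
  thus ?case using tangle_cover[of "{}"] tangle_not_ground 0 by simp
next
  case (Suc n)
  then obtain x where x: "x \<in> X" by fastforce
  have fin: "finite X" using Suc finite_sub by blast
  have n: "n = card (X - {x})" using Suc(2) x fin by simp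
  have sub: "X - {x} \<subseteq> E" using Suc.prems by blast
  have 1: "X - {x} \<in> T" using Suc.prems Suc(2) n by (intro Suc(1)[OF n sub]) simp
  have "lam E r {x} \<le> 1" using lam_le_card[of "{x}"] x Suc by auto
  \<comment> \<open>This leaves room for the singleton: either \<open>X\<close> has two elements and
    the order exceeds two, or \<open>X\<close> is itself the singleton.\<close>
  moreover have "1 < \<theta> \<or> X = {x}"
  proof (cases "n = 0")
    case True
    hence "X - {x} = {}" using n fin by simp
    thus ?thesis using x by auto
  next
    case False
    thus ?thesis using Suc by simp
  qed
  moreover have "lam E r X < \<theta>" using lam_le_card[of X] Suc by simp
  ultimately have "lam E r {x} < \<theta>" by auto
  hence 2: "{x} \<in> T" using tangle_cover[of "{x}"] tangle_co_single[of x] x Suc by auto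
  have "(X - {x}) \<union> {x} = X" using x by auto
  thus ?case using tangle_union[OF 1 2] \<open>lam E r X < \<theta>\<close> by simp
qed

lemma tangle_card_compl:
  assumes "X \<in> T" shows "2 \<le> card (E - X)"
proof (rule ccontr)
  assume "\<not> 2 \<le> card (E - X)"
  hence "card (E - X) \<le> Suc 0" by simp
  moreover have "finite (E - X)" using finite_ground by simp
  ultimately have *: "\<forall>a\<in>E - X. \<forall>b\<in>E - X. a = b" using card_le_Suc0_iff_eq by blast
  show False
  proof (cases "E - X = {}")
    case True
    hence "X = E" using tangle_subset[OF assms] by auto
    thus False using assms tangle_not_ground by simp
  next
    case False
    then obtain e where "e \<in> E - X" by auto
    hence "X = E - {e}" using * tangle_subset[OF assms] by auto
    thus False using assms tangle_co_single[of e] \<open>e \<in> E - X\<close> by auto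
  qed
qed

lemma tangle_matroid_dual: "tangle_matroid E (dual_rank E r) T \<theta>"
proof -
  interpret d: rank_matroid E "dual_rank E r" by (rule rank_matroid_dual)
  show ?thesis
    by unfold_locales (use tangle_subset tangle_lam tangle_cover tangle_three tangle_co_single in auto)
qed

lemma three_sep_dual: "three_sep E (dual_rank E r) T x A \<longleftrightarrow> three_sep E r T x A"
  unfolding three_sep_def by auto

end

locale three_connected_tangle = tangle_matroid +
  assumes conn3: "three_connected E r" and order3: "3 \<le> \<theta>"
begin

abbreviation "tri S \<equiv> triangle E r S"
abbreviation "cotri S \<equiv> triad E r S"
abbreviation "sep x A \<equiv> three_sep E r T x A"
abbreviation "gsep x A \<equiv> guts_sep E r T x A"
abbreviation "csep x A \<equiv> coguts_sep E r T x A"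

lemma three_connected_tangle_dual: "three_connected_tangle E (dual_rank E r) T \<theta>"
proof -
  interpret d: tangle_matroid E "dual_rank E r" T \<theta> by (rule tangle_matroid_dual)
  show ?thesis by unfold_locales (use conn3 order3 in auto)
qed

text \<open>Lying inside a tangle set supplies the size condition on the complement that
  3-connectivity asks for.\<close>

lemma lam_ge_2:
  assumes "X \<in> T" "2 \<le> card Y" "Y \<subseteq> X" shows "2 \<le> lam E r Y"
proof (rule three_connectedD2[OF conn3])
  show "Y \<subseteq> E" using assms tangle_subset by blast
  have "card (E - X) \<le> card (E - Y)" using assms finite_ground by (intro card_mono) auto
  thus "2 \<le> card (E - Y)" using tangle_card_compl[OF assms(1)] by simp
qed (use assms in auto)

lemma singleton_tangle: "x \<in> E \<Longrightarrow> {x} \<in> T"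
  using tangle_small[of "{x}"] order3 by simp

lemma pair_tangle: "x \<in> E \<Longrightarrow> y \<in> E \<Longrightarrow> {x, y} \<in> T"
  using tangle_small[of "{x, y}"] order3 by (cases "x = y") auto

lemma pair_rank:
  assumes "x \<in> E" "y \<in> E" "x \<noteq> y"
  shows "r {x, y} = 2" "r (E - {x, y}) = r E"
proof -
  have "2 \<le> lam E r {x, y}" using assms by (intro lam_ge_2[OF pair_tangle[of x y]]) auto
  moreover have "r {x, y} \<le> 2" using rank_le_card[of "{x, y}"] assms by simp
  moreover have "r (E - {x, y}) \<le> r E" by (intro rank_mono) auto
  ultimately show "r {x, y} = 2" "r (E - {x, y}) = r E" unfolding lam_def by auto
qed

lemma ground_card: "4 \<le> card E"
proof -
  have "{} \<in> T" using tangle_small[of "{}"] order3 by simp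
  then obtain x y where "x \<in> E" "y \<in> E" "x \<noteq> y"
    using tangle_card_compl[of "{}"] finite_ground by (auto elim: two_elements)
  hence "2 \<le> card (E - {x, y})" using pair_tangle[of x y] tangle_card_compl by blast
  moreover have "card {x, y} = 2" "{x, y} \<subseteq> E" using \<open>x \<in> E\<close> \<open>y \<in> E\<close> \<open>x \<noteq> y\<close> by auto
  ultimately show ?thesis using card_Diff_subset[of "{x, y}" E] by simp
qed

lemma singleton_rank: "x \<in> E \<Longrightarrow> r {x} = 1"
proof -
  assume x: "x \<in> E"
  have "\<exists>y\<in>E. y \<noteq> x"
  proof (rule ccontr)
    assume "\<not> ?thesis"
    hence "E \<subseteq> {x}" by auto
    hence "card E \<le> card {x}" by (intro card_mono) auto
    thus False using ground_card by simp
  qed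
  then obtain y where "y \<in> E" "y \<noteq> x" by blast
  thus ?thesis
    using pair_rank(1)[of y x] rank_insert_le[of "{x}" y] rank_le_card[of "{x}"] x by simp
qed

lemma triad_lam:
  assumes "cotri S" shows "lam E r S \<le> 2" "S \<in> T"
proof -
  have S: "S \<subseteq> E" "card S = 3" "r (E - S) = r E - 1" using assms unfolding triad_def by auto
  thus l: "lam E r S \<le> 2" using rank_le_card[of S] unfolding lam_def by simp
  \<comment> \<open>The order may be exactly three, so three elements are not few enough for
    \<open>tangle_small\<close>; a pair and a singleton are.\<close>
  obtain a b c where abc: "S = {a, b, c}" using S card_3_iff by metis
  hence "S = {a, b} \<union> {c}" by auto
  moreover have "{a, b} \<in> T" "{c} \<in> T" using abc S pair_tangle singleton_tangle by auto
  moreover have "lam E r S < \<theta>" using l order3 by simp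
  ultimately show "S \<in> T" using tangle_union by metis
qed

lemma triangle_lam:
  assumes "tri S" shows "lam E r S \<le> 2" "S \<in> T"
proof -
  interpret d: three_connected_tangle E "dual_rank E r" T \<theta> by (rule three_connected_tangle_dual)
  have "S \<subseteq> E" using assms unfolding triangle_def by simp
  thus "lam E r S \<le> 2" "S \<in> T" using d.triad_lam[of S] assms by (auto simp: triad_dual)
qed

lemma not_triangle_triad: "tri S \<Longrightarrow> cotri S \<Longrightarrow> False"
proof -
  assume S: "tri S" "cotri S"
  hence "lam E r S = 1" unfolding lam_def triangle_def triad_def by simp
  moreover have "2 \<le> lam E r S" using S triangle_lam(2)[of S] unfolding triangle_def by (intro lam_ge_2[of S]) auto
  ultimately show False by simp
qed

lemma triad_pair_rank: "cotri {x, y, z} \<Longrightarrow> r (E - {x, y}) = r E"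
  using pair_rank(2)[of x y] unfolding triad_def card_3_distinct by auto

lemma triangle_triad_orthogonal:
  assumes "tri {x, y, z}" "cotri S" "x \<in> S"
  shows "y \<in> S \<or> z \<in> S"
proof (rule ccontr)
  assume n: "\<not> ?thesis"
  have E: "{x, y, z} \<subseteq> E" "x \<noteq> y" "x \<noteq> z" "y \<noteq> z" "r {x, y, z} = 2"
    using assms(1) unfolding triangle_def card_3_distinct by auto
  have S: "S \<subseteq> E" "card S = 3" "r (E - S) = r E - 1" using assms(2) unfolding triad_def by auto
  obtain u v where uv: "S = {x, u, v}" "x \<noteq> u" "x \<noteq> v" "u \<noteq> v" using card_3_obtain[OF S(2) assms(3)] by metis
  have "r (insert x {y, z}) = r {y, z}" using E pair_rank(1)[of y z] by simp
  hence "r (insert x (E - S)) = r (E - S)"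
    by (rule rank_insert_eq_mono) (use n E in auto)
  moreover have "insert x (E - S) = E - {u, v}" using uv S by auto
  moreover have "r (E - {u, v}) = r E" using uv S by (intro pair_rank) auto
  ultimately show False using S by simp
qed

text \<open>Orthogonality gives a second common element \<open>p\<close>; the remaining elements
  \<open>q\<close> and \<open>w\<close> differ because no set is both a triangle and a triad. Thus
  \<open>q, x, p, w\<close> is a fan of four elements.\<close>

lemma triangle_meets_triad:
  assumes "tri {x, y, z}" "cotri {x, u, v}"
  obtains p q w where "{p, q} = {y, z}" "cotri {x, p, w}" "w \<noteq> x" "w \<noteq> p" "w \<noteq> q"
proof -
  have d: "x \<noteq> u" "x \<noteq> v" "u \<noteq> v" using assms(2) unfolding triad_def card_3_distinct by auto
  have d': "x \<noteq> y" "x \<noteq> z" "y \<noteq> z" using assms(1) unfolding triangle_def card_3_distinct by auto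
  have "y \<in> {x, u, v} \<or> z \<in> {x, u, v}" using triangle_triad_orthogonal[OF assms] by simp
  hence "\<exists>p q w. {p, q} = {y, z} \<and> {x, u, v} = {x, p, w} \<and> w \<noteq> x \<and> w \<noteq> p"
    using d d' by (metis insert_commute insertE singletonD)
  then obtain p q w where pqw: "{p, q} = {y, z}" "{x, u, v} = {x, p, w}" "w \<noteq> x" "w \<noteq> p" by blast
  have "w \<noteq> q"
  proof
    assume "w = q"
    hence "{x, u, v} = {x, y, z}" using pqw by auto
    thus False using not_triangle_triad assms by simp
  qed
  thus ?thesis using that pqw assms(2) by metis
qed

lemma sep_lam:
  assumes "sep x A" shows "lam E r A = 2" "lam E r (insert x A) = 2" "A \<in> T"
proof -
  have A: "insert x A \<in> T" "2 \<le> card A" "lam E r A \<le> 2" "lam E r (insert x A) \<le> 2" "x \<notin> A" "A \<subseteq> E"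
    using assms unfolding three_sep_def by auto
  have "card (insert x A) = Suc (card A)" using A finite_sub by simp
  thus "lam E r A = 2" "lam E r (insert x A) = 2"
    using A lam_ge_2[OF A(1), of A] lam_ge_2[OF A(1), of "insert x A"] by auto
  show "A \<in> T" by (rule tangle_down[OF A(1)]) (use A order3 in auto)
qed

lemma gsep_compl: "gsep x A \<Longrightarrow> r (E - A) = r (E - insert x A)"
  using sep_lam[of x A] unfolding guts_sep_def lam_def by simp

lemma csep_compl: "csep x A \<Longrightarrow> r (E - A) = r (E - insert x A) + 1"
  using sep_lam[of x A] unfolding coguts_sep_def lam_def by simp

lemma gsep_or_csep: "sep x A \<Longrightarrow> gsep x A \<or> csep x A"
  using rank_insert_le[of A x] rank_insert_ge[of A x]
  unfolding guts_sep_def coguts_sep_def three_sep_def by fastforce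

lemma gsep_csep_False: "gsep x A \<Longrightarrow> csep x A \<Longrightarrow> False"
  unfolding guts_sep_def coguts_sep_def by simp

lemma gsep_dual: "guts_sep E (dual_rank E r) T x A \<longleftrightarrow> csep x A"
proof -
  have "dual_rank E r (insert x A) = dual_rank E r A \<longleftrightarrow> csep x A" if s: "sep x A"
  proof -
    have "x \<notin> A" "finite A" using s finite_sub unfolding three_sep_def by auto
    hence "dual_rank E r (insert x A) = dual_rank E r A \<longleftrightarrow> r (E - A) = r (E - insert x A) + 1"
      unfolding dual_rank_def by auto
    thus ?thesis using gsep_or_csep[OF s] gsep_compl[of x A] csep_compl[of x A] gsep_csep_False by auto
  qed
  thus ?thesis
    unfolding guts_sep_def[of E "dual_rank E r"] three_sep_dual by (auto simp: coguts_sep_def)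
qed

lemma csep_dual: "coguts_sep E (dual_rank E r) T x A \<longleftrightarrow> gsep x A"
proof -
  interpret d: three_connected_tangle E "dual_rank E r" T \<theta> by (rule three_connected_tangle_dual)
  show ?thesis
  proof (cases "sep x A")
    case True
    hence "three_sep E (dual_rank E r) T x A" by (simp add: three_sep_dual)
    thus ?thesis
      using gsep_dual[of x A] gsep_or_csep[OF True] d.gsep_or_csep[of x A] gsep_csep_False[of x A]
        d.gsep_csep_False[of x A] by argo
  next
    case False
    thus ?thesis unfolding guts_sep_def coguts_sep_def three_sep_dual by simp
  qed
qed

lemmas dual_iffs = triangle_dual triad_dual three_sep_dual gsep_dual csep_dual

text \<open>The inequality \<open>le\<close> bounds the connectivity of \<open>Y\<close> in the
  contraction of \<open>x\<close> by one. As 3-connectivity forces \<open>lam E r Y = 2\<close>,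
  there is no slack, and \<open>Y\<close> spans \<open>x\<close>.\<close>

lemma gsepI:
  assumes x: "x \<in> E" and Y: "Y \<subseteq> E - {x}" "2 \<le> card Y"
    and le: "r (insert x Y) + r (E - Y) \<le> r E + 2" and T: "insert x Y \<in> T"
  shows "gsep x Y"
proof -
  have YE: "Y \<subseteq> E" using Y by auto
  have "r Y \<le> r (insert x Y)" using YE x by (intro rank_insert_ge)
  hence l: "lam E r Y \<le> 2" using le unfolding lam_def by simp
  have "r (E - insert x Y) \<le> r (E - Y)" by (intro rank_mono) auto
  hence "lam E r (insert x Y) \<le> 2" using le unfolding lam_def by simp
  hence "sep x Y" using l x Y T unfolding three_sep_def by auto
  moreover have "r (insert x Y) = r Y"
    using sep_lam(1)[OF \<open>sep x Y\<close>] le \<open>r Y \<le> r (insert x Y)\<close> unfolding lam_def by simp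
  ultimately show ?thesis unfolding guts_sep_def by simp
qed

text \<open>A 1-separation of the contraction would leave at most three elements in
  \<open>E\<close>. A 2-separation has a side that, together with \<open>x\<close>, lies in the
  tangle.\<close>

lemma not_contract_three_connected:
  assumes x: "x \<in> E" and n: "\<not> three_connected (E - {x}) (contract_rank r {x})"
  obtains A where "gsep x A"
proof -
  interpret c: rank_matroid "E - {x}" "contract_rank r {x}" using x by (intro rank_matroid_contract) auto
  have lx: "lam (E - {x}) (contract_rank r {x}) Y = r (insert x Y) + r (E - Y) - 1 - r E" if "Y \<subseteq> E - {x}" for Y
    using lam_contract_1[OF x that] singleton_rank[OF x] by simp
  show ?thesis
  proof (rule not_three_connectedE[OF n c.lam_nonneg])
    fix Y assume one: "Y \<subseteq> E - {x}" "1 \<le> card Y" "1 \<le> card (E - {x} - Y)"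
      "lam (E - {x}) (contract_rank r {x}) Y \<le> 0"
    have le: "r (insert x Y) + r (E - Y) \<le> r E + 1" using lx[OF one(1)] one(4) by simp
    have YE: "Y \<subseteq> E" "x \<notin> Y" "finite Y" using one finite_sub[of Y] by auto
    have "r Y \<le> r (insert x Y)" using YE x by (intro rank_insert_ge)
    hence 1: "lam E r Y \<le> 1" using le unfolding lam_def by simp
    have "r (E - insert x Y) \<le> r (E - Y)" by (intro rank_mono) auto
    hence 2: "lam E r (insert x Y) \<le> 1" using le unfolding lam_def by simp
    have e: "E - insert x Y = E - {x} - Y" "E - Y = insert x (E - {x} - Y)" using x YE by auto
    have f: "finite (E - {x} - Y)" using finite_ground by simp
    have "card (insert x Y) = card Y + 1" "card (E - Y) = card (E - {x} - Y) + 1"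
      using YE f by (auto simp: e(2))
    hence c: "2 \<le> card (insert x Y)" "2 \<le> card (E - Y)" using one by auto
    have "\<not> 2 \<le> card (E - insert x Y)"
      using three_connectedD2[OF conn3, of "insert x Y"] 2 c x YE by auto
    moreover have "\<not> 2 \<le> card Y" using three_connectedD2[OF conn3, of Y] 1 c YE by auto
    moreover have "card E = card Y + card (E - Y)"
      using YE finite_ground by (metis card_Diff_subset card_mono le_add_diff_inverse)
    ultimately have "card E \<le> 3" using \<open>card (E - Y) = card (E - {x} - Y) + 1\<close> e by simp
    thus ?thesis using ground_card by simp
  next
    fix Y assume two: "Y \<subseteq> E - {x}" "2 \<le> card Y" "2 \<le> card (E - {x} - Y)"
      "lam (E - {x}) (contract_rank r {x}) Y \<le> 1"
    have le: "r (insert x Y) + r (E - Y) \<le> r E + 2" using lx[OF two(1)] two(4) by simp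
    have YE: "Y \<subseteq> E" "x \<notin> Y" using two by auto
    have "r Y \<le> r (insert x Y)" using YE x by (intro rank_insert_ge)
    hence 1: "lam E r Y \<le> 2" using le unfolding lam_def by simp
    have "r (E - insert x Y) \<le> r (E - Y)" by (intro rank_mono) auto
    hence 2: "lam E r (insert x Y) < \<theta>" using le order3 unfolding lam_def by simp
    have e: "E - insert x Y = E - {x} - Y" "insert x (E - {x} - Y) = E - Y" "E - (E - {x} - Y) = insert x Y"
      using x YE by auto
    have "insert x Y \<in> T \<or> E - {x} - Y \<in> T" using tangle_cover[OF _ 2] x YE e by auto
    thus ?thesis
    proof
      assume "insert x Y \<in> T"
      thus ?thesis using gsepI[OF x two(1,2) le] that by blast
    next
      assume t: "E - {x} - Y \<in> T"
      have "lam E r (E - Y) < \<theta>" using 1 lam_compl[OF YE(1)] order3 by simp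
      moreover have u: "(E - {x} - Y) \<union> {x} = E - Y" using x YE by auto
      ultimately have "E - Y \<in> T" using tangle_union[OF t singleton_tangle[OF x]] by simp
      hence "gsep x (E - {x} - Y)"
        using two le e by (intro gsepI[OF x]) auto
      thus ?thesis using that by blast
    qed
  qed
qed

lemma not_delete_three_connected:
  assumes x: "x \<in> E" and n: "\<not> three_connected (E - {x}) r"
  obtains A where "csep x A"
proof -
  interpret d: three_connected_tangle E "dual_rank E r" T \<theta> by (rule three_connected_tangle_dual)
  have "\<not> three_connected (E - {x}) (contract_rank (dual_rank E r) {x})"
    using three_connected_minor_dual[of "{}" "{x}"] x n by simp
  thus ?thesis using d.not_contract_three_connected[OF x] that gsep_dual by blast
qed

text \<open>Two tangle sets and a singleton cannot cover \<open>E\<close>, so two elements lie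
  outside the union and its connectivity is at least two. Submodularity then leaves at most two for
  the intersection, with or without \<open>a\<close>.\<close>

lemma uncross_inter:
  assumes "sep x A" "a \<in> A" "sep a A'" "2 \<le> card (A \<inter> A')"
  shows "sep a (A \<inter> A')"
proof -
  have A: "A \<subseteq> E" "A \<in> T" "lam E r A = 2" using assms(1) sep_lam[of x A] unfolding three_sep_def by auto
  have A': "A' \<subseteq> E" "A' \<in> T" "lam E r A' = 2" "lam E r (insert a A') = 2" "a \<notin> A'" "a \<in> E"
    using assms(3) sep_lam[of a A'] unfolding three_sep_def by auto
  have "2 \<le> card (E - (A \<union> A'))"
  proof (rule ccontr)
    assume "\<not> ?thesis"
    hence c: "card (E - (A \<union> A')) \<le> Suc 0" by simp
    have "finite (E - (A \<union> A'))" using finite_ground by simp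
    with c have all_eq: "\<forall>u\<in>E - (A \<union> A'). \<forall>v\<in>E - (A \<union> A'). u = v"
      using card_le_Suc0_iff_eq by blast
    show False
    proof (cases "E - (A \<union> A') = {}")
      case True
      hence "A \<union> A' \<union> A' = E" using A A' by auto
      thus False using tangle_three A A' by blast
    next
      case False
      then obtain u where u: "u \<in> E - (A \<union> A')" by auto
      hence "A \<union> A' \<union> {u} = E" using all_eq A A' by auto
      thus False using tangle_three[OF A(2) A'(2) singleton_tangle] u by blast
    qed
  qed
  moreover have "2 \<le> card (A \<union> A')"
  proof -
    have "card (A \<inter> A') \<le> card (A \<union> A')" using finite_sub[OF A(1)] finite_sub[OF A'(1)] by (intro card_mono) auto
    thus ?thesis using assms(4) by simp
  qed
  ultimately have u: "2 \<le> lam E r (A \<union> A')" using A A' by (intro three_connectedD2[OF conn3]) auto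
  have "lam E r (A \<union> A') + lam E r (A \<inter> A') \<le> lam E r A + lam E r A'"
    using A A' by (intro lam_submod_eq) auto
  hence 1: "lam E r (A \<inter> A') \<le> 2" using u A A' by simp
  have "lam E r (A \<union> A') + lam E r (insert a (A \<inter> A')) \<le> lam E r A + lam E r (insert a A')"
    using A A' assms(2) by (intro lam_submod_eq) auto
  hence 2: "lam E r (insert a (A \<inter> A')) \<le> 2" using u A A' by simp
  have "insert a (A \<inter> A') \<in> T"
    by (rule tangle_down[OF A(2)]) (use assms(2) 2 order3 in auto)
  thus ?thesis using 1 2 A A' assms unfolding three_sep_def by auto
qed

text \<open>The same uncrossing against the complement of \<open>A'\<close>. Now the union is the
  complement of \<open>A' - A\<close>, which has connectivity at least two as a subset of a tangle
  set.\<close>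

lemma uncross_diff:
  assumes "sep x A" "a \<in> A" "sep a A'" "2 \<le> card (A' - A)" "2 \<le> card (A - insert a A')"
  shows "sep a (A - insert a A')"
proof -
  have A: "A \<subseteq> E" "A \<in> T" "lam E r A = 2" "2 \<le> card A" using assms(1) sep_lam[of x A] unfolding three_sep_def by auto
  have A': "A' \<subseteq> E" "A' \<in> T" "lam E r A' = 2" "lam E r (insert a A') = 2" "a \<notin> A'" "a \<in> E"
    using assms(3) sep_lam[of a A'] unfolding three_sep_def by auto
  have u: "2 \<le> lam E r (A' - A)" by (rule lam_ge_2[OF A'(2) assms(4)]) auto
  have c: "lam E r (E - (A' - A)) = lam E r (A' - A)" using A' by (intro lam_compl) auto
  have c1: "lam E r (E - A') = 2" "lam E r (E - insert a A') = 2"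
    using lam_compl[of A'] lam_compl[of "insert a A'"] A' by auto
  have "lam E r (E - (A' - A)) + lam E r (A - insert a A') \<le> lam E r A + lam E r (E - insert a A')"
    using A A' assms(2) by (intro lam_submod_eq) auto
  hence 1: "lam E r (A - insert a A') \<le> 2" using u c c1 A by simp
  have "lam E r (E - (A' - A)) + lam E r (insert a (A - insert a A')) \<le> lam E r A + lam E r (E - A')"
    using A A' assms(2) by (intro lam_submod_eq) auto
  hence 2: "lam E r (insert a (A - insert a A')) \<le> 2" using u c c1 A by simp
  have "insert a (A - insert a A') \<in> T"
    by (rule tangle_down[OF A(2)]) (use assms(2) 2 order3 in auto)
  thus ?thesis using 1 2 A A' assms unfolding three_sep_def by auto
qed

text \<open>An element of the guts is spanned from both sides. A set \<open>P\<close> inside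
  \<open>A'\<close> or disjoint from \<open>insert a A'\<close> leaves one of these sides in its
  complement, which then spans \<open>a\<close> and excludes the coguts.\<close>

lemma gsep_transfer:
  assumes "gsep a A'" "sep a P" "P \<subseteq> A' \<or> P \<inter> insert a A' = {}"
  shows "gsep a P"
proof (rule ccontr)
  assume "\<not> gsep a P"
  hence c: "csep a P" using gsep_or_csep[OF assms(2)] by blast
  have P: "a \<in> E" "P \<subseteq> E" "a \<notin> P" using assms(2) unfolding three_sep_def by auto
  have A': "A' \<subseteq> E" "a \<notin> A'" "r (insert a A') = r A'" using assms(1) unfolding guts_sep_def three_sep_def by auto
  have e: "insert a (E - insert a P) = E - P" "insert a (E - insert a A') = E - A'" using P A' by auto
  have cl: "r (insert a (E - insert a A')) = r (E - insert a A')" using gsep_compl[OF assms(1)] e by simp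
  have "r (insert a (E - insert a P)) = r (E - insert a P)"
    using assms(3)
  proof
    assume "P \<subseteq> A'"
    thus ?thesis
      by (intro rank_insert_eq_mono[OF cl]) (use P A' in auto)
  next
    assume "P \<inter> insert a A' = {}"
    thus ?thesis
      by (intro rank_insert_eq_mono[OF A'(3)]) (use P A' in auto)
  qed
  thus False using csep_compl[OF c] e by simp
qed

text \<open>\<open>A'\<close> cuts \<open>A - {a}\<close> into two parts. A part with two elements
  would be a smaller guts separation of \<open>a\<close>, so each part has at most one.\<close>

lemma guts_uncross_small:
  assumes s: "sep x A" "a \<in> A" "gsep a A'" "3 \<le> card A'" and no: "\<And>P. P \<subset> A \<Longrightarrow> \<not> gsep a P"
  shows "card A \<le> 3"
proof -
  have s': "sep a A'" using s(3) unfolding guts_sep_def by simp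
  have A: "A \<subseteq> E" "A' \<subseteq> E" "a \<notin> A'" "finite A" "finite A'"
    using s(1) s' finite_sub unfolding three_sep_def by auto
  have p: "card (A \<inter> A') \<le> 1"
  proof (rule ccontr)
    assume "\<not> ?thesis"
    hence "sep a (A \<inter> A')" using uncross_inter[OF s(1,2) s'] by simp
    hence "gsep a (A \<inter> A')" using gsep_transfer[OF s(3)] by simp
    moreover have "A \<inter> A' \<subset> A" using s(2) A by auto
    ultimately show False using no by blast
  qed
  have "card A' = card (A \<inter> A') + card (A' - A)"
    using A by (metis Int_commute card_Int_Diff)
  hence p': "2 \<le> card (A' - A)" using p s(4) by simp
  have q: "card (A - insert a A') \<le> 1"
  proof (rule ccontr)
    assume "\<not> ?thesis"
    hence "sep a (A - insert a A')" using uncross_diff[OF s(1,2) s' p'] by simp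
    hence "gsep a (A - insert a A')" using gsep_transfer[OF s(3)] by blast
    moreover have "A - insert a A' \<subset> A" using s(2) A by auto
    ultimately show False using no by blast
  qed
  have "A = (A \<inter> A') \<union> {a} \<union> (A - insert a A')" using s(2) by auto
  hence "card A \<le> card (A \<inter> A') + card {a} + card (A - insert a A')"
    by (metis (no_types, lifting) add_le_mono1 card_Un_le order_trans)
  thus ?thesis using p q by simp
qed

lemma coguts_uncross_small:
  assumes "sep x A" "a \<in> A" "csep a A'" "3 \<le> card A'" "\<And>P. P \<subset> A \<Longrightarrow> \<not> csep a P"
  shows "card A \<le> 3"
proof -
  interpret d: three_connected_tangle E "dual_rank E r" T \<theta> by (rule three_connected_tangle_dual)
  show ?thesis using d.guts_uncross_small[of x A a A'] assms by (auto simp: dual_iffs)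
qed

lemma triad_csep:
  assumes "cotri {y, p, q}" shows "csep y {p, q}"
proof -
  have E: "{y, p, q} \<subseteq> E" "y \<noteq> p" "y \<noteq> q" "p \<noteq> q" "r (E - {y, p, q}) = r E - 1"
    using assms unfolding triad_def card_3_distinct by auto
  have t: "{y, p, q} \<in> T" "lam E r {y, p, q} \<le> 2" using triad_lam[OF assms] by auto
  have "lam E r {p, q} \<le> 2" using lam_le_card[of "{p, q}"] E by simp
  hence s: "sep y {p, q}" using E t unfolding three_sep_def by auto
  have "r (E - {p, q}) = r E" using E by (intro pair_rank) auto
  thus ?thesis using gsep_or_csep[OF s] gsep_compl[of y "{p, q}"] E by auto
qed

lemma triangle_gsep: "tri {y, p, q} \<Longrightarrow> gsep y {p, q}"
proof -
  interpret d: three_connected_tangle E "dual_rank E r" T \<theta> by (rule three_connected_tangle_dual)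
  show "tri {y, p, q} \<Longrightarrow> gsep y {p, q}" using d.triad_csep[of y p q] by (simp add: dual_iffs)
qed

lemma gsep_pair_triangle:
  assumes "gsep x A" "card A = 2"
  obtains p q where "A = {p, q}" "tri {x, p, q}"
proof -
  obtain p q where pq: "A = {p, q}" "p \<noteq> q" using assms(2) card_2_iff by metis
  have "x \<in> E" "p \<in> E" "q \<in> E" "x \<noteq> p" "x \<noteq> q" "r {x, p, q} = r {p, q}"
    using assms(1) pq unfolding guts_sep_def three_sep_def by auto
  hence "tri {x, p, q}" using pair_rank(1)[of p q] pq unfolding triangle_def card_3_distinct by simp
  thus ?thesis using that pq by blast
qed

lemma gsep_no_pair:
  assumes "gsep x A" "\<And>u v. \<not> tri {x, u, v}"
  shows "3 \<le> card A"
  using assms gsep_pair_triangle[OF assms(1)] unfolding guts_sep_def three_sep_def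
  by (metis eval_nat_numeral(3) le_antisym not_less_eq_eq)

text \<open>Rank two would put \<open>x\<close> on a line with two elements of \<open>A\<close>, and
  that triangle yields a smaller separation. Rank three and connectivity two leave rank
  \<open>r E - 1\<close> for the complement.\<close>

lemma minimal_gsep_triad:
  assumes g: "gsep x A" "card A = 3" and no: "\<And>Z. Z \<subset> A \<Longrightarrow> \<not> gsep x Z"
  shows "cotri A" "r A = 3"
proof -
  have s: "sep x A" "r (insert x A) = r A" using g unfolding guts_sep_def by auto
  have A: "A \<subseteq> E" "x \<in> E" "x \<notin> A" "lam E r A = 2" using s(1) sep_lam[OF s(1)] unfolding three_sep_def by auto
  have "r A \<le> 3" using rank_le_card[of A] A g by simp
  moreover have "r A \<noteq> 2"
  proof
    assume 2: "r A = 2"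
    obtain a p q where apq: "A = {a, p, q}" "a \<noteq> p" "p \<noteq> q" "a \<noteq> q" using g(2) card_3_iff by metis
    have "r {x, p, q} \<le> r (insert x A)" using apq A by (intro rank_mono) auto
    moreover have "r {p, q} \<le> r {x, p, q}" using apq A by (intro rank_mono) auto
    moreover have "r {p, q} = 2" using apq A by (intro pair_rank) auto
    ultimately have "tri {x, p, q}" using 2 s(2) A apq unfolding triangle_def card_3_distinct by auto
    hence "gsep x {p, q}" by (rule triangle_gsep)
    thus False using no[of "{p, q}"] apq by auto
  qed
  moreover have "2 \<le> r A"
  proof -
    have "lam E r A \<le> r A" using A by (intro lam_le_rank)
    thus ?thesis using A by simp
  qed
  ultimately show "r A = 3" by simp
  thus "cotri A" using A g(2) unfolding triad_def lam_def by simp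
qed

text \<open>\<open>(P, Q)\<close> is a 2-separation of the deletion of \<open>x\<close>. Since
  \<open>{x, y, z, w}\<close> is codependent and \<open>{x, y, w}\<close> is not, moving
  \<open>z\<close> to \<open>P\<close> lowers the rank of \<open>Q\<close>, and then
  \<open>y\<close> and \<open>z\<close> span \<open>x\<close>. The resulting set has connectivity at
  most one in a 3-connected matroid, so only one element \<open>q\<close> is left on the other
  side.\<close>

lemma fan_end_aux:
  assumes "P \<union> Q = E - {x}" "P \<inter> Q = {}" "2 \<le> card Q" "r P + r Q \<le> r E + 1"
    and "y \<in> P" "w \<in> P" "z \<in> Q" "x \<in> E" "tri {x, y, z}"
    and cod: "r (E - {x, y, z, w}) < r E" and ncod: "r (E - {x, y, w}) = r E"
  shows "\<exists>q. cotri {x, z, q}"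
proof -
  have sub: "P \<subseteq> E" "Q \<subseteq> E" "x \<notin> P" "x \<notin> Q" "y \<in> E" "z \<in> E" "w \<in> E" using assms(1,5,6,7) by auto
  have xyz: "x \<noteq> y" "x \<noteq> z" "y \<noteq> z" "r {x, y, z} = 2"
    using assms(9) unfolding triangle_def card_3_distinct by auto
  have zP: "z \<notin> P" using assms(2,7) by auto
  have "r (insert z (E - {x, y, z, w})) - r (E - {x, y, z, w}) \<le> r (insert z (Q - {z})) - r (Q - {z})"
    using assms(2,5,6) sub xyz by (intro rank_insert_antimono) auto
  moreover have "insert z (E - {x, y, z, w}) = E - {x, y, w}" using sub xyz zP assms(6) by auto
  moreover have "insert z (Q - {z}) = Q" using assms(7) by auto
  ultimately have 1: "r (Q - {z}) \<le> r Q - 1" using cod ncod by simp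
  have "r (insert z P) \<le> r P + 1" using sub by (intro rank_insert_le)
  moreover have "r (insert x (insert z P)) = r (insert z P)"
  proof (rule rank_insert_eq_mono[of x "{y, z}"])
    show "r (insert x {y, z}) = r {y, z}" using xyz pair_rank(1)[of y z] sub by simp
  qed (use sub assms in auto)
  moreover have e: "E - insert x (insert z P) = Q - {z}" using assms(1,2) sub zP by auto
  ultimately have "lam E r (insert x (insert z P)) \<le> 1" using 1 assms(4) unfolding lam_def e by simp
  moreover have "2 \<le> card (insert x (insert z P))"
  proof -
    have "card {x, z} \<le> card (insert x (insert z P))" using sub finite_sub by (intro card_mono) auto
    thus ?thesis using xyz by simp
  qed
  ultimately have "\<not> 2 \<le> card (Q - {z})"
    using three_connectedD2[OF conn3, of "insert x (insert z P)"] e sub assms(8) by auto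
  moreover have fQ: "finite Q" using sub finite_sub by simp
  moreover have "card Q = Suc (card (Q - {z}))" using assms(7) fQ by (metis card_Suc_Diff1)
  ultimately have c: "card (Q - {z}) = 1" using assms(3) by simp
  then obtain q where q: "Q - {z} = {q}" using card_1_singletonE by blast
  hence Q: "Q = {z, q}" "q \<noteq> z" using assms(7) by auto
  have qE: "q \<in> E" "q \<noteq> x" using Q sub by auto
  have P: "P = E - {x, z, q}" using assms(1,2) Q by auto
  have "r Q = 2" using Q pair_rank(1)[of z q] sub qE by auto
  hence "r P \<le> r E - 1" using assms(4) by simp
  moreover have "r E \<le> r P + 1"
  proof -
    have "insert x P = E - {z, q}" using P xyz qE assms(8) by auto
    moreover have "r (E - {z, q}) = r E" using pair_rank(2)[of z q] sub qE Q by auto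
    ultimately show ?thesis using rank_insert_le[of P x] sub assms(8) by simp
  qed
  ultimately have "cotri {x, z, q}" using P sub qE Q xyz assms(8) unfolding triad_def card_3_distinct by auto
  thus ?thesis by blast
qed

text \<open>A relative of Tutte's triangle lemma. Neither side of the 2-separation of the deletion
  of \<open>x\<close> spans \<open>x\<close>, so \<open>y\<close> and \<open>z\<close> are on
  different sides. The element \<open>w\<close> is with one of them, and \<open>fan_end_aux\<close>
  moves the other across.\<close>

lemma fan_end:
  assumes "tri {x, y, z}" "w \<in> E - {x, y, z}" "r (E - {x, y, z, w}) < r E" "csep x A"
  shows "\<exists>u v. cotri {x, u, v}"
proof (rule ccontr)
  assume no: "\<nexists>u v. cotri {x, u, v}"
  have s: "sep x A" "r (insert x A) = r A + 1" using assms(4) unfolding coguts_sep_def by auto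
  have A: "A \<subseteq> E" "x \<in> E" "x \<notin> A" "2 \<le> card A" "insert x A \<in> T" using s(1) unfolding three_sep_def by auto
  have xyz: "x \<noteq> y" "x \<noteq> z" "y \<noteq> z" "r {x, y, z} = 2" "y \<in> E" "z \<in> E"
    using assms(1) unfolding triangle_def card_3_distinct by auto
  have w: "w \<in> E" "w \<noteq> x" "w \<noteq> y" "w \<noteq> z" using assms(2) by auto
  let ?B = "E - insert x A"
  have cB: "2 \<le> card ?B" using tangle_card_compl[OF A(5)] .
  have part: "A \<union> ?B = E - {x}" "A \<inter> ?B = {}" "?B \<union> A = E - {x}" "?B \<inter> A = {}" using A by auto
  have le: "r A + r ?B \<le> r E + 1" using sep_lam(2)[OF s(1)] s(2) unfolding lam_def by simp
  hence le': "r ?B + r A \<le> r E + 1" by simp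
  have nc: "r (E - {x, a, w}) = r E" if "a \<in> E" "a \<noteq> x" "a \<noteq> w" for a
  proof (rule ccontr)
    assume "r (E - {x, a, w}) \<noteq> r E"
    moreover have "r (E - {x, a, w}) \<le> r E" by (intro rank_mono) auto
    moreover have "insert x (E - {x, a, w}) = E - {a, w}" using that A w by auto
    moreover have "r (E - {a, w}) = r E" using that w by (intro pair_rank) auto
    moreover have "r (insert x (E - {x, a, w})) \<le> r (E - {x, a, w}) + 1" using A by (intro rank_insert_le) auto
    ultimately have "cotri {x, a, w}" using that w A unfolding triad_def card_3_distinct by auto
    thus False using no by blast
  qed
  have tri': "tri {x, z, y}" using assms(1) by (simp add: insert_commute)
  have cod': "r (E - {x, z, y, w}) < r E" using assms(3) by (simp add: insert_commute)
  have cl: "r (insert x {y, z}) = r {y, z}" using xyz pair_rank(1)[of y z] by simp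
  have "\<not> (y \<in> A \<and> z \<in> A)"
  proof
    assume "y \<in> A \<and> z \<in> A"
    hence "r (insert x A) = r A" using A by (intro rank_insert_eq_mono[OF cl]) auto
    thus False using s by simp
  qed
  moreover have "\<not> (y \<in> ?B \<and> z \<in> ?B)"
  proof
    assume "y \<in> ?B \<and> z \<in> ?B"
    hence "r (insert x ?B) = r ?B" using A by (intro rank_insert_eq_mono[OF cl]) auto
    moreover have "insert x ?B = E - A" using A by auto
    ultimately show False using csep_compl[OF assms(4)] by simp
  qed
  moreover have "y \<in> A \<or> y \<in> ?B" "z \<in> A \<or> z \<in> ?B" "w \<in> A \<or> w \<in> ?B" using xyz w by auto
  ultimately consider "y \<in> A" "z \<in> ?B" "w \<in> A" | "y \<in> A" "z \<in> ?B" "w \<in> ?B"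
    | "z \<in> A" "y \<in> ?B" "w \<in> A" | "z \<in> A" "y \<in> ?B" "w \<in> ?B" by blast
  thus False
  proof cases
    case 1
    thus False using fan_end_aux[OF part(1,2) cB le _ _ _ A(2) assms(1,3) nc[of y]] xyz w no by blast
  next
    case 2
    thus False using fan_end_aux[OF part(3,4) A(4) le' _ _ _ A(2) tri' cod' nc[of z]] xyz w no by blast
  next
    case 3
    thus False using fan_end_aux[OF part(1,2) cB le _ _ _ A(2) tri' cod' nc[of z]] xyz w no by blast
  next
    case 4
    thus False using fan_end_aux[OF part(3,4) A(4) le' _ _ _ A(2) assms(1,3) nc[of y]] xyz w no by blast
  qed
qed

lemma cofan_end:
  assumes "cotri {x, y, z}" "w \<in> E - {x, y, z}" "r {x, y, z, w} < 4" "gsep x A"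
  shows "\<exists>u v. tri {x, u, v}"
proof -
  interpret d: three_connected_tangle E "dual_rank E r" T \<theta> by (rule three_connected_tangle_dual)
  have s: "{x, y, z, w} \<subseteq> E" "card {x, y, z, w} = 4"
    using assms(1,2) unfolding triad_def card_3_distinct by auto
  have "dual_rank E r (E - {x, y, z, w}) < dual_rank E r E"
    using assms(3) s unfolding dual_rank_compl[OF s(1)] dual_rank_ground by simp
  thus ?thesis using d.fan_end[of x y z w A] assms by (simp add: dual_iffs)
qed

lemma triad_lam_insert':
  assumes "cotri {x, y, z}" "x \<in> X" "z \<in> X" "y \<notin> X" "X \<subseteq> E"
  shows "lam E r (insert y X) \<le> lam E r X"
  using assms triad_pair_rank[of x z y] by (intro triad_lam_insert) (auto simp: insert_commute)

end

section \<open>Removing one element\<close>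

text \<open>Collects what would hold if no element outside \<open>F\<close> could be removed; its
  lemmas work towards the contradiction \<open>stuck_False\<close>. \<open>closed_max\<close> makes
  \<open>F\<close> a flat of the tangle matroid without mentioning the rank function of that
  matroid.\<close>

locale stuck_tangle = three_connected_tangle E r T \<theta> + matroid_with_minor E r EN rN
  for E :: "'a set" and r T \<theta> EN rN +
  fixes F :: "'a set"
  assumes closed_tangle: "F \<in> T" "EN \<subseteq> F"
    and closed_max: "\<And>Y. Y \<in> T \<Longrightarrow> F \<subset> Y \<Longrightarrow> lam E r F < lam E r Y"
    and no_delete: "\<And>x. x \<in> E - F \<Longrightarrow> del x \<Longrightarrow> \<not> three_connected (E - {x}) r"
    and no_contract: "\<And>x. x \<in> E - F \<Longrightarrow> con x \<Longrightarrow> \<not> three_connected (E - {x}) (contract_rank r {x})"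
begin

lemma stuck_tangle_dual: "stuck_tangle E (dual_rank E r) T \<theta> EN (dual_rank EN rN) F"
proof -
  interpret d: three_connected_tangle E "dual_rank E r" T \<theta> by (rule three_connected_tangle_dual)
  interpret m: matroid_with_minor E "dual_rank E r" EN "dual_rank EN rN" by (rule matroid_with_minor_dual)
  show ?thesis
  proof
    show "F \<in> T" "EN \<subseteq> F" by (rule closed_tangle)+
    show "lam E (dual_rank E r) F < lam E (dual_rank E r) Y" if "Y \<in> T" "F \<subset> Y" for Y
      using closed_max[OF that] tangle_subset[OF that(1)] tangle_subset[OF closed_tangle(1)] by simp
    show "\<not> three_connected (E - {x}) (dual_rank E r)"
      if "x \<in> E - F" "deletable E (dual_rank E r) EN (dual_rank EN rN) x" for x
      using no_contract[OF that(1)] that three_connected_minor_dual[of "{x}" "{}"] d.contract_rank_empty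
      by (simp add: deletable_dual)
    show "\<not> three_connected (E - {x}) (contract_rank (dual_rank E r) {x})"
      if "x \<in> E - F" "contractible E (dual_rank E r) EN (dual_rank EN rN) x" for x
      using no_delete[OF that(1)] that three_connected_minor_dual[of "{}" "{x}"]
      by (simp add: contractible_dual)
  qed
qed

lemmas all_dual_iffs = dual_iffs deletable_dual contractible_dual

lemma con_gsep: "x \<in> E - F \<Longrightarrow> con x \<Longrightarrow> \<exists>A. gsep x A"
  using no_contract not_contract_three_connected by blast

lemma del_csep: "x \<in> E - F \<Longrightarrow> del x \<Longrightarrow> \<exists>A. csep x A"
  using no_delete not_delete_three_connected by blast

text \<open>A line with two elements in a flat lies in the flat. In terms of \<open>lam\<close>: the
  intersection uses up connectivity two, so \<open>F \<union> X\<close> has no more connectivity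
  than \<open>F\<close>.\<close>

lemma line_meets_closed:
  assumes "X \<in> T" "lam E r X \<le> 2" "x \<in> X - F"
  shows "card (X \<inter> F) \<le> 1"
proof (rule ccontr)
  assume "\<not> ?thesis"
  hence "2 \<le> lam E r (X \<inter> F)" by (intro lam_ge_2[OF assms(1)]) auto
  moreover have "lam E r (F \<union> X) + lam E r (X \<inter> F) \<le> lam E r F + lam E r X"
    using tangle_subset[OF assms(1)] tangle_subset[OF closed_tangle(1)] by (intro lam_submod_eq) auto
  ultimately have le: "lam E r (F \<union> X) \<le> lam E r F" using assms(2) by simp
  hence "F \<union> X \<in> T"
    using tangle_lam[OF closed_tangle(1)] by (intro tangle_union closed_tangle(1) assms(1)) simp
  hence "lam E r F < lam E r (F \<union> X)" using assms(3) by (intro closed_max) auto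
  thus False using le by simp
qed

lemma line_meets_closed_eq:
  assumes "X \<in> T" "lam E r X \<le> 2" "x \<in> X - F" "a \<in> X \<inter> F" "b \<in> X \<inter> F"
  shows "a = b"
  using line_meets_closed[OF assms(1-3)] assms(4,5) finite_sub[OF tangle_subset[OF assms(1)]]
    card_le_Suc0_iff_eq[of "X \<inter> F"] by auto

lemma sep_free_element:
  assumes "sep x A" "x \<notin> F"
  shows "card (A \<inter> EN) \<le> 1" "\<exists>y\<in>A. y \<notin> F"
proof -
  have A: "insert x A \<in> T" "lam E r (insert x A) \<le> 2" "2 \<le> card A" "finite A"
    using assms(1) finite_sub unfolding three_sep_def by auto
  have le: "card (insert x A \<inter> F) \<le> 1" using line_meets_closed[OF A(1,2)] assms(2) by blast
  have "card (A \<inter> EN) \<le> card (insert x A \<inter> F)" using closed_tangle A by (intro card_mono) auto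
  thus "card (A \<inter> EN) \<le> 1" using le by simp
  show "\<exists>y\<in>A. y \<notin> F"
  proof (rule ccontr)
    assume "\<not> ?thesis"
    hence "card A \<le> card (insert x A \<inter> F)" using A by (intro card_mono) auto
    thus False using le A by simp
  qed
qed

text \<open>In the contraction of \<open>x\<close>, the set \<open>A\<close> is minimal with
  connectivity at most one and has at most one element of \<open>N\<close>. The labels obtained
  there lift to the original matroid.\<close>

lemma minimal_gsep_del_con:
  assumes g: "gsep x A" "con x" "x \<notin> F" "3 \<le> card A" and no: "\<And>Z. Z \<subset> A \<Longrightarrow> \<not> gsep x Z"
    and y: "y \<in> A - EN"
  shows "del y \<and> con y"
proof -
  have s: "sep x A" "r (insert x A) = r A" using g unfolding guts_sep_def by auto
  have A: "A \<subseteq> E" "x \<in> E" "x \<notin> A" "insert x A \<in> T" using s(1) unfolding three_sep_def by auto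
  obtain C where C: "x \<in> E - EN" "carries E r EN rN C" "x \<in> C" using g(2) unfolding contractible_def by blast
  interpret q: matroid_with_minor "E - {x}" "contract_rank r {x}" EN rN
  proof -
    interpret c: rank_matroid "E - {x}" "contract_rank r {x}" using A by (intro rank_matroid_contract) auto
    show "matroid_with_minor (E - {x}) (contract_rank r {x}) EN rN"
    proof
      show "EN \<subseteq> E - {x}" using minor_ground C by auto
      show "\<exists>C. carries (E - {x}) (contract_rank r {x}) EN rN C" using contract_carries[OF C(3,2)] by blast
    qed (use minor_loopless minor_coloopless in auto)
  qed
  have lx: "lam (E - {x}) (contract_rank r {x}) Y = r (insert x Y) + r (E - Y) - 1 - r E" if "Y \<subseteq> E - {x}" for Y
    using lam_contract_1[OF A(2) that] singleton_rank[OF A(2)] by simp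
  have "deletable (E - {x}) (contract_rank r {x}) EN rN y \<and> contractible (E - {x}) (contract_rank r {x}) EN rN y"
  proof (rule q.minimal_two_separation_del_con[of A])
    show Ax: "A \<subseteq> E - {x}" using A by auto
    have "r A + r (E - A) - r E = 2" using sep_lam(1)[OF s(1)] unfolding lam_def .
    thus "lam (E - {x}) (contract_rank r {x}) A \<le> 1"
      using lx[OF Ax] s(2) by simp
    show "3 \<le> card A" by (rule g)
    show "card (A \<inter> EN) \<le> 1" using sep_free_element[OF s(1) g(3)] by simp
    show "y \<in> A - EN" by (rule y)
    fix Z assume Z: "Z \<subset> A" "2 \<le> card Z"
    show "2 \<le> lam (E - {x}) (contract_rank r {x}) Z"
    proof (rule ccontr)
      assume "\<not> ?thesis"
      moreover have "Z \<subseteq> E - {x}" using Z A by auto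
      ultimately have le: "r (insert x Z) + r (E - Z) \<le> r E + 2" using lx[of Z] by simp
      have "r (E - insert x Z) \<le> r (E - Z)" by (intro rank_mono) auto
      hence "lam E r (insert x Z) < \<theta>" using le order3 unfolding lam_def by simp
      hence "insert x Z \<in> T" by (intro tangle_down[OF A(4)]) (use Z in auto)
      hence "gsep x Z" using gsepI[OF A(2) _ Z(2) le] Z A by auto
      thus False using no Z by blast
    qed
  qed
  thus ?thesis
    using carries_contract[OF C(1)] C(1) A y unfolding deletable_def contractible_def by blast
qed

lemma con_triangle_del':
  assumes "con x" "tri {x, y, z}" "y \<notin> EN" shows "del y"
proof -
  have "x \<noteq> y" "x \<noteq> z" "y \<noteq> z" "x \<in> E" "y \<in> E" "z \<in> E" "r {x, y, z} = 2"
    using assms(2) unfolding triangle_def card_3_distinct by auto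
  thus ?thesis
    using con_triangle_del[of x y z] assms pair_rank(1)[of x y] pair_rank(1)[of x z] by simp
qed

lemma del_triad_con:
  assumes "del x" "cotri {x, y, z}" "y \<notin> EN" shows "con y"
proof -
  interpret d: stuck_tangle E "dual_rank E r" T \<theta> EN "dual_rank EN rN" F by (rule stuck_tangle_dual)
  show ?thesis using d.con_triangle_del'[of x y z] assms by (simp add: all_dual_iffs)
qed

section \<open>Shrinking an obstruction to a pair\<close>

definition "obstruction x A \<longleftrightarrow> x \<in> E - F \<and> (con x \<and> gsep x A \<or> del x \<and> csep x A)"

text \<open>If \<open>A\<close> is minimal for \<open>x\<close>, an element \<open>y\<close> of
  \<open>A\<close> outside \<open>F\<close> is both deletable and contractible, so it has a guts
  separation \<open>A'\<close> of its own. If neither \<open>A'\<close> nor a subset of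
  \<open>A\<close> is smaller, uncrossing leaves three elements; then \<open>A\<close> is a triad
  and its other two elements obstruct the deletion of \<open>y\<close>.\<close>

lemma obstruction_smaller:
  assumes x: "x \<in> E - F" "con x" "gsep x A" "3 \<le> card A"
  shows "\<exists>y A'. obstruction y A' \<and> card A' < card A"
proof -
  have s: "sep x A" using x unfolding guts_sep_def by simp
  have A: "A \<subseteq> E" "finite A" using s finite_sub unfolding three_sep_def by auto
  show ?thesis
  proof (cases "\<exists>Z\<subset>A. gsep x Z")
    case True
    thus ?thesis using x psubset_card_mono[OF A(2)] unfolding obstruction_def by blast
  next
    case False
    obtain y where y: "y \<in> A" "y \<notin> F" using sep_free_element[OF s] x by blast
    have dc: "del y" "con y" using minimal_gsep_del_con[OF x(3,2) _ x(4), of y] False y x closed_tangle by auto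
    have yE: "y \<in> E - F" using y A by auto
    obtain A' where A': "gsep y A'" using con_gsep[OF yE dc(2)] by blast
    show ?thesis
    proof (cases "card A' < card A \<or> (\<exists>P\<subset>A. gsep y P)")
      case True
      thus ?thesis using A' yE dc psubset_card_mono[OF A(2)] unfolding obstruction_def by blast
    next
      case n: False
      hence "card A \<le> 3" using guts_uncross_small[OF s y(1) A'] x(4) by auto
      hence c3: "card A = 3" using x by simp
      have "cotri A" using minimal_gsep_triad[OF x(3) c3] False by blast
      obtain p q where pq: "A = {y, p, q}" "y \<noteq> p" "y \<noteq> q" "p \<noteq> q" using card_3_obtain[OF c3 y(1)] by metis
      hence "csep y {p, q}" using triad_csep \<open>cotri A\<close> by simp
      thus ?thesis using yE dc c3 pq unfolding obstruction_def by (intro exI[of _ y] exI[of _ "{p, q}"]) auto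
    qed
  qed
qed

lemma obstruction_smaller_dual:
  assumes x: "x \<in> E - F" "del x" "csep x A" "3 \<le> card A"
  shows "\<exists>y A'. obstruction y A' \<and> card A' < card A"
proof -
  interpret d: stuck_tangle E "dual_rank E r" T \<theta> EN "dual_rank EN rN" F by (rule stuck_tangle_dual)
  have "d.obstruction y A' \<longleftrightarrow> obstruction y A'" for y A' unfolding d.obstruction_def obstruction_def by (auto simp: all_dual_iffs)
  thus ?thesis using d.obstruction_smaller[of x A] assms by (simp add: all_dual_iffs)
qed

lemma obstruction_pair: "\<exists>x A. obstruction x A \<and> card A = 2"
proof -
  have "2 \<le> card (E - F)" using tangle_card_compl closed_tangle by blast
  then obtain e where e: "e \<in> E - F" by (metis card.empty equals0I not_numeral_le_zero)
  hence "\<exists>A. obstruction e A"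
    using del_or_con[of e] closed_tangle con_gsep[OF e] del_csep[OF e] unfolding obstruction_def by blast
  then obtain x0 A0 where c0: "obstruction x0 A0" by blast
  have "obstruction x A \<Longrightarrow> ?thesis" for x A
  proof (induction "card A" arbitrary: x A rule: less_induct)
    case less
    have "2 \<le> card A" using less(2) unfolding obstruction_def guts_sep_def coguts_sep_def three_sep_def by blast
    show ?case
    proof (cases "card A = 2")
      case True
      thus ?thesis using less by blast
    next
      case False
      hence "3 \<le> card A" using \<open>2 \<le> card A\<close> by simp
      hence "\<exists>y A'. obstruction y A' \<and> card A' < card A"
        using less(2) obstruction_smaller[of x A] obstruction_smaller_dual[of x A] unfolding obstruction_def by blast
      thus ?thesis using less(1) by blast
    qed
  qed
  thus ?thesis using c0 by blast
qed

text \<open>A fan being extended at its end \<open>x0\<close>: only the last four elements matter, and \<open>X\<close> may be any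
  set of the tangle with connectivity 2 that contains them.\<close>

definition "fan_state X x0 x1 x2 x3 \<longleftrightarrow> {x0, x1, x2, x3} \<subseteq> X \<and> x3 \<notin> {x0, x1, x2} \<and> tri {x0, x1, x2}
  \<and> cotri {x1, x2, x3} \<and> X \<in> T \<and> lam E r X \<le> 2 \<and> lam E r (X - {x0}) \<le> 2 \<and> x0 \<notin> F \<and> del x0"

definition "cofan_state X x0 x1 x2 x3 \<longleftrightarrow> {x0, x1, x2, x3} \<subseteq> X \<and> x3 \<notin> {x0, x1, x2} \<and> cotri {x0, x1, x2}
  \<and> tri {x1, x2, x3} \<and> X \<in> T \<and> lam E r X \<le> 2 \<and> lam E r (X - {x0}) \<le> 2 \<and> x0 \<notin> F \<and> con x0"

lemma fan_state_dual:
  "stuck_tangle.fan_state E (dual_rank E r) T EN (dual_rank EN rN) F X a b c d \<longleftrightarrow> cofan_state X a b c d"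
proof -
  interpret d: stuck_tangle E "dual_rank E r" T \<theta> EN "dual_rank EN rN" F by (rule stuck_tangle_dual)
  show ?thesis
  proof (cases "X \<in> T")
    case True
    hence "X \<subseteq> E" "X - {a} \<subseteq> E" using tangle_subset by auto
    thus ?thesis unfolding d.fan_state_def cofan_state_def by (simp add: all_dual_iffs)
  next
    case False
    thus ?thesis unfolding d.fan_state_def cofan_state_def by simp
  qed
qed

lemma cofan_state_dual:
  "stuck_tangle.cofan_state E (dual_rank E r) T EN (dual_rank EN rN) F X a b c d \<longleftrightarrow> fan_state X a b c d"
proof -
  interpret d: stuck_tangle E "dual_rank E r" T \<theta> EN "dual_rank EN rN" F by (rule stuck_tangle_dual)
  show ?thesis
  proof (cases "X \<in> T")
    case True
    hence "X \<subseteq> E" "X - {a} \<subseteq> E" using tangle_subset by auto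
    thus ?thesis unfolding d.cofan_state_def fan_state_def by (simp add: all_dual_iffs)
  next
    case False
    thus ?thesis unfolding d.cofan_state_def fan_state_def by simp
  qed
qed

text \<open>The end \<open>x0\<close> is deletable, so its deletion is not 3-connected and
  \<open>fan_end\<close> supplies a triad at \<open>x0\<close>. Orthogonality makes the triad use
  one of \<open>x1\<close>, \<open>x2\<close>; its third element is the next end, with the roles of
  triangles and triads exchanged.\<close>

lemma fan_extend:
  assumes "fan_state X x0 x1 x2 x3"
  shows "\<exists>y z z'. {z, z'} = {x1, x2} \<and> y \<in> E - X \<and> cotri {x0, y, z} \<and> insert y X \<in> T \<and>
    lam E r (insert y X) \<le> 2 \<and> (y \<notin> F \<longrightarrow> cofan_state (insert y X) y x0 z z')"
proof -
  have S: "x0 \<in> X" "x1 \<in> X" "x2 \<in> X" "x3 \<in> X" "x3 \<notin> {x0, x1, x2}" "tri {x0, x1, x2}" "cotri {x1, x2, x3}"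
    "X \<in> T" "lam E r X \<le> 2" "lam E r (X - {x0}) \<le> 2" "x0 \<notin> F" "del x0"
    using assms unfolding fan_state_def by auto
  have XE: "X \<subseteq> E" using tangle_subset S by simp
  have d: "x0 \<noteq> x1" "x0 \<noteq> x2" "x1 \<noteq> x2" "r {x0, x1, x2} = 2" using S(6) unfolding triangle_def card_3_distinct by auto
  have x0E: "x0 \<in> E - F" using S XE by auto
  obtain A where "csep x0 A" using del_csep[OF x0E S(12)] by blast
  moreover have "r (E - {x0, x1, x2, x3}) < r E"
  proof -
    have "r (E - {x0, x1, x2, x3}) \<le> r (E - {x1, x2, x3})" by (intro rank_mono) auto
    thus ?thesis using S(7) unfolding triad_def by simp
  qed
  ultimately obtain u v where "cotri {x0, u, v}" using fan_end[OF S(6), of x3 A] S XE by auto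
  then obtain z z' y where zy: "{z, z'} = {x1, x2}" "cotri {x0, z, y}" "y \<noteq> x0" "y \<noteq> z" "y \<noteq> z'"
    using triangle_meets_triad[OF S(6)] by metis
  hence zX: "z \<in> X" "z' \<in> X" "z \<noteq> x0" "z' \<noteq> x0" "z \<noteq> z'" using S d by (auto simp: doubleton_eq_iff)
  have ct: "cotri {x0, y, z}" using zy(2) by (simp add: insert_commute)
  hence yE: "y \<in> E" and ry: "r (E - {x0, y, z}) = r E - 1" unfolding triad_def by auto
  \<comment> \<open>Otherwise \<open>X - {x0}\<close> spans \<open>x0\<close>, while the complement
    of \<open>X\<close> does not because the triad lies in \<open>X\<close>. Adding
    \<open>x0\<close> would then lower the connectivity from two to one.\<close>
  have "y \<notin> X"
  proof
    assume y: "y \<in> X"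
    have "r (insert x0 {x1, x2}) = r {x1, x2}" using d pair_rank(1)[of x1 x2] S XE by auto
    hence "r (insert x0 (X - {x0})) = r (X - {x0})"
      by (rule rank_insert_eq_mono) (use S XE d in auto)
    moreover have "insert x0 (X - {x0}) = X" using S by auto
    moreover have "r (insert x0 (E - {x0, y, z})) - r (E - {x0, y, z}) \<le> r (insert x0 (E - X)) - r (E - X)"
      using y zX S XE by (intro rank_insert_antimono) auto
    moreover have "insert x0 (E - {x0, y, z}) = E - {y, z}" using S XE zy zX by auto
    moreover have "r (E - {y, z}) = r E" using pair_rank(2)[of y z] yE zX XE zy by auto
    moreover have "insert x0 (E - X) = E - (X - {x0})" using S XE by auto
    ultimately have "lam E r X \<le> lam E r (X - {x0}) - 1" using ry unfolding lam_def by simp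
    hence "lam E r X \<le> 1" using S by simp
    moreover have "2 \<le> lam E r X"
    proof (rule lam_ge_2[OF S(8)])
      have "card {x0, x1} \<le> card X" using S finite_sub[OF XE] by (intro card_mono) auto
      thus "2 \<le> card X" using d by simp
    qed auto
    ultimately show False by simp
  qed
  have l: "lam E r (insert y X) \<le> 2"
    using triad_lam_insert'[OF ct, of X] S zX XE \<open>y \<notin> X\<close> by simp
  have "X \<union> {y} \<in> T" using l order3 by (intro tangle_union[OF S(8) singleton_tangle[OF yE]]) simp
  hence t: "insert y X \<in> T" by simp
  have "cofan_state (insert y X) y x0 z z'" if "y \<notin> F"
  proof -
    have "con y" using del_triad_con[OF S(12) ct] that closed_tangle by auto
    moreover have "insert y X - {y} = X" using \<open>y \<notin> X\<close> by auto
    moreover have "{x0, z, z'} = {x0, x1, x2}" using zy(1) by auto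
    moreover have "{y, x0, z} = {x0, y, z}" by auto
    ultimately show ?thesis using that t l S zX zy ct unfolding cofan_state_def by auto
  qed
  thus ?thesis using zy(1) yE \<open>y \<notin> X\<close> ct t l by blast
qed

lemma cofan_extend:
  assumes "cofan_state X x0 x1 x2 x3"
  shows "\<exists>y z z'. {z, z'} = {x1, x2} \<and> y \<in> E - X \<and> tri {x0, y, z} \<and> insert y X \<in> T \<and>
    lam E r (insert y X) \<le> 2 \<and> (y \<notin> F \<longrightarrow> fan_state (insert y X) y x0 z z')"
proof -
  interpret d: stuck_tangle E "dual_rank E r" T \<theta> EN "dual_rank EN rN" F by (rule stuck_tangle_dual)
  have "\<exists>y z z'. {z, z'} = {x1, x2} \<and> y \<in> E - X \<and> tri {x0, y, z} \<and> insert y X \<in> T \<and>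
    lam E (dual_rank E r) (insert y X) \<le> 2 \<and> (y \<notin> F \<longrightarrow> fan_state (insert y X) y x0 z z')"
    using d.fan_extend[of X x0 x1 x2 x3] assms by (simp add: all_dual_iffs fan_state_dual cofan_state_dual)
  thus ?thesis using tangle_subset by (metis lam_dual)
qed

text \<open>A set of connectivity two meets \<open>F\<close> at most once. If \<open>X\<close>
  already does, every new end avoids \<open>F\<close>, and the fan grows beyond all bounds.\<close>

lemma fan_meeting_closed_False:
  "fan_state X a b c d \<or> cofan_state X a b c d \<Longrightarrow> X \<inter> F \<noteq> {} \<Longrightarrow> False"
proof (induction "card E - card X" arbitrary: X a b c d rule: less_induct)
  case less
  have X: "X \<in> T" "a \<in> X" "a \<notin> F" using less(2) unfolding fan_state_def cofan_state_def by auto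
  obtain y z z' where y: "y \<in> E - X" "insert y X \<in> T" "lam E r (insert y X) \<le> 2"
    "y \<notin> F \<longrightarrow> cofan_state (insert y X) y a z z' \<or> fan_state (insert y X) y a z z'"
    using less(2) fan_extend[of X a b c d] cofan_extend[of X a b c d] by blast
  have "y \<notin> F"
  proof
    assume "y \<in> F"
    obtain f where "f \<in> X \<inter> F" using less(3) by auto
    hence "y = f" using line_meets_closed_eq[OF y(2,3), of a y f] X \<open>y \<in> F\<close> by auto
    thus False using y \<open>f \<in> X \<inter> F\<close> by auto
  qed
  have "finite X" using X finite_sub tangle_subset by blast
  hence "card (insert y X) = Suc (card X)" using y by simp
  moreover have "card (insert y X) \<le> card E" using finite_ground tangle_subset[OF y(2)] by (intro card_mono)
  ultimately have "card E - card (insert y X) < card E - card X" by simp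
  thus False using less(1)[of "insert y X" y a z z'] y \<open>y \<notin> F\<close> less(3) by blast
qed

text \<open>Remembers the opposite end \<open>w\<close> of the fan, with the pattern of the four
  elements there, so that the direction of growth can be reversed.\<close>

definition "fan_tail X w u y v \<longleftrightarrow> {w, u, y, v} \<subseteq> X \<and> v \<notin> {w, u, y} \<and> lam E r (X - {w}) \<le> 2 \<and> w \<notin> F
  \<and> (cotri {w, u, y} \<and> tri {u, y, v} \<and> con w \<or> tri {w, u, y} \<and> cotri {u, y, v} \<and> del w)"

lemma triangle_lam_insert':
  assumes "tri {x, y, z}" "x \<in> X" "z \<in> X" "y \<notin> X" "X \<subseteq> E"
  shows "lam E r (insert y X) \<le> lam E r X"
proof -
  interpret d: stuck_tangle E "dual_rank E r" T \<theta> EN "dual_rank EN rN" F by (rule stuck_tangle_dual)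
  have "insert y X \<subseteq> E" using assms unfolding triangle_def by auto
  thus ?thesis using d.triad_lam_insert'[of x y z X] assms by (simp add: all_dual_iffs)
qed

text \<open>As long as new ends avoid \<open>F\<close>, the fan grows at its head, which cannot go
  on. When a new end falls into \<open>F\<close>, turn round: the same set is a fan with end
  \<open>w\<close> meeting \<open>F\<close>. The condition \<open>w \<notin> {a, b, c}\<close> keeps
  \<open>w\<close> out of the triangles and triads used at the head, so that \<open>X - {w}\<close>
  keeps connectivity at most two.\<close>

lemma fan_with_tail_False:
  "fan_state X a b c d \<or> cofan_state X a b c d \<Longrightarrow> fan_tail X w u y v \<Longrightarrow> w \<notin> {a, b, c} \<Longrightarrow> False"
proof (induction "card E - card X" arbitrary: X a b c d rule: less_induct)
  case less
  have X: "X \<in> T" "a \<in> X" "b \<in> X" "c \<in> X" "a \<notin> F" using less(2) unfolding fan_state_def cofan_state_def by auto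
  have XE: "X \<subseteq> E" using X tangle_subset by blast
  obtain e z z' where e: "{z, z'} = {b, c}" "e \<in> E - X" "insert e X \<in> T" "lam E r (insert e X) \<le> 2"
    "cotri {a, e, z} \<or> tri {a, e, z}"
    "e \<notin> F \<longrightarrow> cofan_state (insert e X) e a z z' \<or> fan_state (insert e X) e a z z'"
    using less(2) fan_extend[of X a b c d] cofan_extend[of X a b c d] by metis
  have zX: "z \<in> X" "z \<noteq> w" using e(1) X less(4) by (auto simp: doubleton_eq_iff)
  have tl: "w \<in> X" "lam E r (X - {w}) \<le> 2" using less(3) unfolding fan_tail_def by auto
  have "lam E r (insert e (X - {w})) \<le> lam E r (X - {w})"
    using e(5)
  proof
    assume "cotri {a, e, z}"
    thus ?thesis by (rule triad_lam_insert') (use X XE zX less(4) e in auto)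
  next
    assume "tri {a, e, z}"
    thus ?thesis by (rule triangle_lam_insert') (use X XE zX less(4) e in auto)
  qed
  moreover have "insert e (X - {w}) = insert e X - {w}" using e tl by auto
  ultimately have lw: "lam E r (insert e X - {w}) \<le> 2" using tl by simp
  show False
  proof (cases "e \<in> F")
    case True
    have "fan_state (insert e X) w u y v \<or> cofan_state (insert e X) w u y v"
      using less(3) lw e(3,4) unfolding fan_tail_def fan_state_def cofan_state_def by auto
    thus False using fan_meeting_closed_False True by blast
  next
    case False
    have "finite X" using XE finite_sub by blast
    hence "card (insert e X) = Suc (card X)" using e by simp
    moreover have "card (insert e X) \<le> card E" using finite_ground tangle_subset[OF e(3)] by (intro card_mono)
    ultimately have "card E - card (insert e X) < card E - card X" by simp
    moreover have "fan_tail (insert e X) w u y v" using less(3) lw unfolding fan_tail_def by auto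
    moreover have "w \<notin> {e, a, z}" using less(4) zX e tl by auto
    ultimately show False using less(1)[of "insert e X" e a z z'] e(6) False by blast
  qed
qed

lemma four_fan_tangle:
  assumes "tri {v, y, u}" "cotri {y, u, w}" "v \<noteq> w"
  shows "{v, y, u, w} \<in> T" "lam E r {v, y, u, w} \<le> 2" "{v, y, u, w} - {v} = {y, u, w}" "{v, y, u, w} - {w} = {v, y, u}"
proof -
  have d: "v \<noteq> y" "v \<noteq> u" "y \<noteq> u" "y \<noteq> w" "u \<noteq> w" "w \<in> E"
    using assms unfolding triangle_def triad_def card_3_distinct by auto
  have ct: "cotri {y, w, u}" using assms(2) by (simp add: insert_commute)
  have "{v, y, u} \<subseteq> E" using assms(1) unfolding triangle_def by auto
  hence "lam E r (insert w {v, y, u}) \<le> lam E r {v, y, u}"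
    using d assms(3) by (intro triad_lam_insert'[OF ct]) auto
  moreover have i: "insert w {v, y, u} = {v, y, u, w}" by auto
  ultimately show l: "lam E r {v, y, u, w} \<le> 2" using triangle_lam(1)[OF assms(1)] by simp
  have "{v, y, u} \<union> {w} \<in> T"
    using l order3 i by (intro tangle_union[OF triangle_lam(2)[OF assms(1)] singleton_tangle[OF d(6)]]) auto
  thus "{v, y, u, w} \<in> T" using i by simp
  show "{v, y, u, w} - {v} = {y, u, w}" "{v, y, u, w} - {w} = {v, y, u}" using d assms(3) by auto
qed

lemma four_fan_head:
  assumes "tri {v, y, u}" "cotri {y, u, w}" "v \<noteq> w" "v \<notin> F" "del v"
  shows "fan_state {v, y, u, w} v y u w"
proof -
  have "y \<noteq> w" "u \<noteq> w" using assms(2) unfolding triad_def card_3_distinct by auto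
  thus ?thesis
    using four_fan_tangle[OF assms(1-3)] triad_lam(1)[OF assms(2)] assms unfolding fan_state_def by auto
qed

lemma four_fan_tail:
  assumes "tri {v, y, u}" "cotri {y, u, w}" "v \<noteq> w" "w \<notin> F" "con w"
  shows "cofan_state {v, y, u, w} w u y v" "fan_tail {v, y, u, w} w u y v"
proof -
  have "y \<noteq> v" "u \<noteq> v" using assms(1) unfolding triangle_def card_3_distinct by auto
  moreover have "cotri {w, u, y}" "tri {u, y, v}" using assms(1,2) by (simp_all add: insert_commute)
  ultimately show "cofan_state {v, y, u, w} w u y v" "fan_tail {v, y, u, w} w u y v"
    using four_fan_tangle[OF assms(1-3)] triangle_lam(1)[OF assms(1)] assms unfolding cofan_state_def fan_tail_def by auto
qed

text \<open>At most one end lies in \<open>F\<close>. If one does, the fan meets \<open>F\<close>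
  and grows from the other end; if none does, \<open>v\<close> serves as head and \<open>w\<close>
  as tail.\<close>

lemma labelled_four_fan_False:
  assumes "tri {v, y, u}" "cotri {y, u, w}" "v \<noteq> w" "y \<notin> F"
    and "v \<notin> EN \<Longrightarrow> del v" "w \<notin> EN \<Longrightarrow> con w"
  shows False
proof -
  have d: "v \<noteq> y" "v \<noteq> u" "y \<noteq> u" "y \<noteq> w" "u \<noteq> w"
    using assms unfolding triangle_def triad_def card_3_distinct by auto
  note t = four_fan_tangle[OF assms(1-3)]
  have EN: "x \<notin> EN" if "x \<notin> F" for x using that closed_tangle by auto
  consider "v \<in> F" "w \<notin> F" | "v \<notin> F" "w \<in> F" | "v \<notin> F" "w \<notin> F"
    using line_meets_closed_eq[OF t(1,2), of y v w] assms(3,4) by auto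
  thus False
  proof cases
    case 1
    thus False using four_fan_tail(1)[OF assms(1-3)] assms(6) EN fan_meeting_closed_False by blast
  next
    case 2
    thus False using four_fan_head[OF assms(1-3)] assms(5) EN fan_meeting_closed_False by blast
  next
    case 3
    hence "fan_state {v, y, u, w} v y u w" "fan_tail {v, y, u, w} w u y v"
      using four_fan_head[OF assms(1-3)] four_fan_tail(2)[OF assms(1-3)] assms(5,6) EN by auto
    thus False using fan_with_tail_False[of "{v, y, u, w}" v y u w w u y v] d assms(3) by blast
  qed
qed

section \<open>Removable labels on elements in no triangle or in no triad\<close>

definition "no_triangle_con x A \<longleftrightarrow> x \<in> E - F \<and> con x \<and> (\<forall>u v. \<not> tri {x, u, v}) \<and> gsep x A"
definition "no_triad_del x A \<longleftrightarrow> x \<in> E - F \<and> del x \<and> (\<forall>u v. \<not> cotri {x, u, v}) \<and> csep x A"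

text \<open>Take \<open>y\<close> in \<open>A\<close> outside \<open>F\<close>; it has both labels.
  If \<open>y\<close> were in no triangle or in no triad, minimality of \<open>card A\<close> and
  uncrossing would give \<open>card A = 3\<close>, so that \<open>A\<close> is a triad at
  \<open>y\<close>, and the dependent set \<open>insert x A\<close> yields a triangle at
  \<open>y\<close> through \<open>cofan_end\<close>. A triangle and a triad at \<open>y\<close> form
  a fan whose ends inherit labels.\<close>

lemma no_triangle_con_step:
  assumes np: "no_triangle_con x A" and IH: "\<And>y A'. card A' < card A \<Longrightarrow> \<not> no_triangle_con y A' \<and> \<not> no_triad_del y A'"
  shows False
proof -
  have x: "x \<in> E - F" "con x" "\<And>u v. \<not> tri {x, u, v}" "gsep x A" using np unfolding no_triangle_con_def by auto
  have s: "sep x A" using x unfolding guts_sep_def by simp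
  have A: "A \<subseteq> E" "finite A" "x \<notin> A" using s finite_sub unfolding three_sep_def by auto
  have c: "3 \<le> card A" using gsep_no_pair[OF x(4)] x(3) by blast
  have no: "\<not> gsep x Z" if "Z \<subset> A" for Z
    using IH[OF psubset_card_mono[OF A(2) that], of x] x unfolding no_triangle_con_def by blast
  obtain y where y: "y \<in> A" "y \<notin> F" using sep_free_element[OF s] x by blast
  have dc: "del y" "con y" using minimal_gsep_del_con[OF x(4,2) _ c no, of y] y x closed_tangle by auto
  have yE: "y \<in> E - F" using y A by auto
  have "\<exists>u v. tri {y, u, v}"
  proof (rule ccontr)
    assume n: "\<not> ?thesis"
    obtain A' where A': "gsep y A'" using con_gsep[OF yE dc(2)] by blast
    have c': "3 \<le> card A'" using gsep_no_pair[OF A'] n by blast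
    have "\<not> gsep y P" if "P \<subset> A" for P
      using IH[OF psubset_card_mono[OF A(2) that], of y] yE dc n unfolding no_triangle_con_def by blast
    hence c3: "card A = 3" using guts_uncross_small[OF s y(1) A' c'] c by auto
    note tr = minimal_gsep_triad[OF x(4) c3 no]
    obtain p q where pq: "A = {y, p, q}" "y \<noteq> p" "y \<noteq> q" "p \<noteq> q" using card_3_obtain[OF c3 y(1)] by metis
    have "{y, p, q, x} = insert x A" using pq by auto
    hence "r {y, p, q, x} < 4" using tr(2) x(4) unfolding guts_sep_def by simp
    thus False using cofan_end[of y p q x A'] tr(1) pq A' A x n by auto
  qed
  then obtain u v where tri_y: "tri {y, u, v}" by blast
  have "\<exists>u v. cotri {y, u, v}"
  proof (rule ccontr)
    assume n: "\<not> ?thesis"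
    interpret d: stuck_tangle E "dual_rank E r" T \<theta> EN "dual_rank EN rN" F by (rule stuck_tangle_dual)
    obtain A' where A': "csep y A'" using del_csep[OF yE dc(1)] by blast
    have c': "3 \<le> card A'" using d.gsep_no_pair[of y A'] A' n by (auto simp: all_dual_iffs)
    have "\<not> csep y P" if "P \<subset> A" for P
      using IH[OF psubset_card_mono[OF A(2) that], of y] yE dc n unfolding no_triad_del_def by blast
    hence c3: "card A = 3" using coguts_uncross_small[OF s y(1) A' c'] c by auto
    obtain p q where pq: "A = {y, p, q}" "y \<noteq> p" "y \<noteq> q" "p \<noteq> q" using card_3_obtain[OF c3 y(1)] by metis
    thus False using n minimal_gsep_triad(1)[OF x(4) c3 no] by blast
  qed
  then obtain s t where "cotri {y, s, t}" by blast
  then obtain p q w where pqw: "{p, q} = {u, v}" "cotri {y, p, w}" "w \<noteq> y" "w \<noteq> p" "w \<noteq> q"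
    using triangle_meets_triad[OF tri_y] by metis
  have "{y, u, v} = {q, y, p}" using pqw(1) by auto
  hence t1: "tri {q, y, p}" using tri_y by simp
  hence t2: "tri {y, q, p}" by (simp add: insert_commute)
  have t3: "cotri {y, w, p}" using pqw(2) by (simp add: insert_commute)
  show False
  proof (rule labelled_four_fan_False[OF t1 pqw(2)])
    show "q \<notin> EN \<Longrightarrow> del q" using con_triangle_del'[OF dc(2) t2] .
    show "w \<notin> EN \<Longrightarrow> con w" using del_triad_con[OF dc(1) t3] .
  qed (use pqw y in auto)
qed

lemma no_triangle_no_triad_False: "no_triangle_con x A \<or> no_triad_del x A \<Longrightarrow> False"
proof (induction "card A" arbitrary: x A rule: less_induct)
  case less
  interpret d: stuck_tangle E "dual_rank E r" T \<theta> EN "dual_rank EN rN" F by (rule stuck_tangle_dual)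
  have d1: "d.no_triangle_con y A' \<longleftrightarrow> no_triad_del y A'" "d.no_triad_del y A' \<longleftrightarrow> no_triangle_con y A'" for y A'
    unfolding d.no_triangle_con_def d.no_triad_del_def no_triangle_con_def no_triad_del_def by (auto simp: all_dual_iffs)
  have IH: "\<not> no_triangle_con y A' \<and> \<not> no_triad_del y A'" if "card A' < card A" for y A' using less(1)[OF that] by blast
  show ?case using less(2) no_triangle_con_step[of x A] d.no_triangle_con_step[of x A] IH unfolding d1 by blast
qed

text \<open>An element \<open>a\<close> of the triangle other than \<open>e\<close> avoids
  \<open>F\<close>. It is deletable because \<open>e\<close> is contractible, so it lies in a triad,
  and triangle and triad form a fan of four elements.\<close>

lemma con_triangle_False:
  assumes "e \<in> E - F" "con e" "tri {e, a, b}" shows False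
proof -
  have main: False if tri: "tri {e, a, b}" and aF: "a \<notin> F" for a b
  proof -
    have d: "e \<noteq> a" "e \<noteq> b" "a \<noteq> b" "a \<in> E" "b \<in> E" using tri unfolding triangle_def card_3_distinct by auto
    have EN: "x \<notin> EN" if "x \<notin> F" for x using that closed_tangle by auto
    have da: "del a" using con_triangle_del'[OF assms(2) tri EN[OF aF]] .
    have "\<exists>u v. cotri {a, u, v}"
    proof (rule ccontr)
      assume n: "\<not> ?thesis"
      obtain A where "csep a A" using del_csep da aF d by blast
      hence "no_triad_del a A" using n da aF d unfolding no_triad_del_def by blast
      thus False using no_triangle_no_triad_False by blast
    qed
    then obtain s t where "cotri {a, s, t}" by blast
    moreover have ta: "tri {a, e, b}" using tri by (simp add: insert_commute)
    ultimately obtain p q w where pqw: "{p, q} = {e, b}" "cotri {a, p, w}" "w \<noteq> a" "w \<noteq> p" "w \<noteq> q"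
      using triangle_meets_triad by metis
    have cw: "w \<notin> EN \<Longrightarrow> con w" using del_triad_con[OF da, of w p] pqw(2) by (simp add: insert_commute)
    consider "p = e" "q = b" | "p = b" "q = e" using pqw(1) by (auto simp: doubleton_eq_iff)
    thus False
    proof cases
      case 1
      have "tri {b, a, e}" "cotri {a, e, w}" "tri {e, b, a}" using pqw(2) 1 tri by (simp_all add: insert_commute)
      thus False
        using labelled_four_fan_False[of b a e w] con_triangle_del'[OF assms(2), of b a] cw pqw 1 aF by blast
    next
      case 2
      \<comment> \<open>Here \<open>e\<close> is an end and must first become deletable: the triad
        makes \<open>b\<close> contractible, and the triangle then makes \<open>e\<close> deletable.
        This fails only if \<open>b\<close> is in \<open>N\<close>, but then the fan meets
        \<open>F\<close> in \<open>b\<close> and can be grown from \<open>w\<close>.\<close>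
      have t: "tri {e, a, b}" "cotri {a, b, w}" "tri {b, e, a}" using pqw(2) 2 tri by (simp_all add: insert_commute)
      show False
      proof (cases "b \<in> EN")
        case False
        hence "con b" using del_triad_con[OF da t(2)] by blast
        hence "del e" using con_triangle_del'[OF _ t(3)] EN assms(1) by blast
        thus False using labelled_four_fan_False[OF t(1,2)] cw pqw 2 aF by blast
      next
        case True
        hence bF: "b \<in> F" using closed_tangle by auto
        have ew: "e \<noteq> w" using pqw 2 by auto
        have "w \<notin> F"
        proof
          assume "w \<in> F"
          hence "w = b" using line_meets_closed_eq[OF four_fan_tangle(1,2)[OF t(1,2) ew], of e w b] bF assms(1) by auto
          thus False using pqw 2 by auto
        qed
        hence "cofan_state {e, a, b, w} w b a e" using four_fan_tail(1)[OF t(1,2) ew] cw EN by blast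
        thus False using fan_meeting_closed_False bF by blast
      qed
    qed
  qed
  have d: "e \<noteq> a" "e \<noteq> b" "a \<noteq> b" using assms(3) unfolding triangle_def card_3_distinct by auto
  have "a \<notin> F \<or> b \<notin> F"
    using line_meets_closed_eq[OF triangle_lam(2)[OF assms(3)] triangle_lam(1)[OF assms(3)], of e a b] d assms(1) by auto
  moreover have "tri {e, b, a}" using assms(3) by (simp add: insert_commute)
  ultimately show False using main assms(3) by blast
qed

lemma stuck_False: False
proof -
  obtain x A where xA: "obstruction x A" "card A = 2" using obstruction_pair by blast
  interpret d: stuck_tangle E "dual_rank E r" T \<theta> EN "dual_rank EN rN" F by (rule stuck_tangle_dual)
  have x: "x \<in> E - F" using xA unfolding obstruction_def by simp
  from xA(1) consider "con x" "gsep x A" | "del x" "csep x A" unfolding obstruction_def by blast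
  thus False
  proof cases
    case 1
    obtain p q where "tri {x, p, q}" using gsep_pair_triangle[OF 1(2) xA(2)] by metis
    thus False using con_triangle_False[OF x 1(1)] by blast
  next
    case 2
    hence "guts_sep E (dual_rank E r) T x A" by (simp add: all_dual_iffs)
    then obtain p q where "triangle E (dual_rank E r) {x, p, q}" using d.gsep_pair_triangle[OF _ xA(2)] by metis
    thus False using d.con_triangle_False[OF x] 2 by (simp add: all_dual_iffs)
  qed
qed

end

section \<open>Removing elements of one kind\<close>

definition dependent :: "('a set \<Rightarrow> int) \<Rightarrow> 'a set \<Rightarrow> bool" where
  "dependent r Z \<longleftrightarrow> r Z < int (card Z)"

definition codependent :: "'a set \<Rightarrow> ('a set \<Rightarrow> int) \<Rightarrow> 'a set \<Rightarrow> bool" where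
  "codependent E r Z \<longleftrightarrow> r (E - Z) < r E"

definition circuit :: "'a set \<Rightarrow> ('a set \<Rightarrow> int) \<Rightarrow> 'a set \<Rightarrow> bool" where
  "circuit E r K \<longleftrightarrow> K \<subseteq> E \<and> dependent r K \<and> (\<forall>k\<in>K. \<not> dependent r (K - {k}))"

definition cocircuit :: "'a set \<Rightarrow> ('a set \<Rightarrow> int) \<Rightarrow> 'a set \<Rightarrow> bool" where
  "cocircuit E r K \<longleftrightarrow> K \<subseteq> E \<and> codependent E r K \<and> (\<forall>k\<in>K. \<not> codependent E r (K - {k}))"

text \<open>Scan \<open>D\<close> in the order of \<open>\<iota>\<close>, keeping what stays good. A
  rejected \<open>h\<close> conflicts with earlier kept elements only, and this timing is what later
  contradicts a stage of the removal sequence.\<close>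

lemma greedy_subset:
  fixes \<iota> :: "'a \<Rightarrow> nat"
  assumes "finite D" "inj_on \<iota> D" "good {}"
  obtains D' where "D' \<subseteq> D" "good D'" "\<And>h. h \<in> D - D' \<Longrightarrow> \<not> good (insert h {d \<in> D'. \<iota> d < \<iota> h})"
proof -
  have "\<exists>D'\<subseteq>{d \<in> D. \<iota> d < n}. good D' \<and>
      (\<forall>h\<in>{d \<in> D. \<iota> d < n} - D'. \<not> good (insert h {d \<in> D'. \<iota> d < \<iota> h}))" for n
  proof (induction n)
    case 0
    thus ?case using assms(3) by auto
  next
    case (Suc n)
    then obtain D' where D': "D' \<subseteq> {d \<in> D. \<iota> d < n}" "good D'"
      "\<And>h. h \<in> {d \<in> D. \<iota> d < n} - D' \<Longrightarrow> \<not> good (insert h {d \<in> D'. \<iota> d < \<iota> h})" by blast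
    show ?case
    proof (cases "\<exists>e\<in>D. \<iota> e = n")
      case False
      hence "{d \<in> D. \<iota> d < Suc n} = {d \<in> D. \<iota> d < n}" by (auto simp: less_Suc_eq)
      thus ?thesis using D' by (intro exI[of _ D']) auto
    next
      case True
      then obtain e where e: "e \<in> D" "\<iota> e = n" by blast
      have S: "{d \<in> D. \<iota> d < Suc n} = insert e {d \<in> D. \<iota> d < n}"
        using e assms(2) by (auto simp: less_Suc_eq dest: inj_onD)
      have lt: "{d \<in> D'. \<iota> d < \<iota> e} = D'" using D'(1) e by auto
      have ins: "{d \<in> insert e D'. \<iota> d < \<iota> h} = {d \<in> D'. \<iota> d < \<iota> h}" if "\<iota> h < n" for h using that e by auto
      show ?thesis
      proof (cases "good (insert e D')")
        case True
        show ?thesis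
        proof (intro exI[of _ "insert e D'"] conjI ballI)
          show "insert e D' \<subseteq> {d \<in> D. \<iota> d < Suc n}" using S D'(1) by auto
          fix h assume h: "h \<in> {d \<in> D. \<iota> d < Suc n} - insert e D'"
          hence "h \<in> {d \<in> D. \<iota> d < n} - D'" using S by auto
          thus "\<not> good (insert h {d \<in> insert e D'. \<iota> d < \<iota> h})" using D'(3)[of h] ins[of h] by simp
        qed (rule True)
      next
        case False
        show ?thesis
        proof (intro exI[of _ D'] conjI ballI)
          show "D' \<subseteq> {d \<in> D. \<iota> d < Suc n}" using S D'(1) by auto
          fix h assume "h \<in> {d \<in> D. \<iota> d < Suc n} - D'"
          hence "h = e \<or> h \<in> {d \<in> D. \<iota> d < n} - D'" using S by auto
          thus "\<not> good (insert h {d \<in> D'. \<iota> d < \<iota> h})"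
          proof
            assume h: "h = e"
            show ?thesis unfolding h lt by (rule False)
          next
            assume "h \<in> {d \<in> D. \<iota> d < n} - D'"
            thus ?thesis by (rule D'(3))
          qed
        qed (rule D'(2))
      qed
    qed
  qed
  from this[of "Suc (Max (insert 0 (\<iota> ` D)))"]
  obtain D' where "D' \<subseteq> {d \<in> D. \<iota> d < Suc (Max (insert 0 (\<iota> ` D)))}" "good D'"
      "\<And>h. h \<in> {d \<in> D. \<iota> d < Suc (Max (insert 0 (\<iota> ` D)))} - D' \<Longrightarrow> \<not> good (insert h {d \<in> D'. \<iota> d < \<iota> h})" by blast
  moreover have "{d \<in> D. \<iota> d < Suc (Max (insert 0 (\<iota> ` D)))} = D"
    using assms(1) by (auto simp: less_Suc_eq_le)
  ultimately show ?thesis using that by simp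
qed

section \<open>Circuits and cocircuits\<close>

context rank_matroid
begin

lemma codependent_dual: "Z \<subseteq> E \<Longrightarrow> codependent E (dual_rank E r) Z \<longleftrightarrow> dependent r Z"
  unfolding codependent_def dependent_def by (simp add: dual_rank_compl dual_rank_ground)

lemma cocircuit_dual: "cocircuit E (dual_rank E r) K \<longleftrightarrow> circuit E r K"
proof (cases "K \<subseteq> E")
  case True
  hence "K - {k} \<subseteq> E" for k by auto
  thus ?thesis using True unfolding cocircuit_def circuit_def by (simp add: codependent_dual)
next
  case False
  thus ?thesis unfolding cocircuit_def circuit_def by simp
qed

lemma codependent_mono: "codependent E r X \<Longrightarrow> X \<subseteq> Y \<Longrightarrow> codependent E r Y"
  using rank_mono[of "E - Y" "E - X"] unfolding codependent_def by fastforce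

lemma codependent_contains_cocircuit:
  assumes "codependent E r Z" "Z \<subseteq> E"
  obtains K where "K \<subseteq> Z" "cocircuit E r K"
proof -
  have "\<exists>K\<subseteq>Z. cocircuit E r K"
    using assms
  proof (induction "card Z" arbitrary: Z rule: less_induct)
    case less
    show ?case
    proof (cases "\<exists>k\<in>Z. codependent E r (Z - {k})")
      case True
      then obtain k where k: "k \<in> Z" "codependent E r (Z - {k})" by blast
      have "finite Z" using less finite_sub by blast
      hence "card (Z - {k}) < card Z" using k by (metis card_Diff1_less)
      moreover have "Z - {k} \<subseteq> E" using less by auto
      ultimately obtain K where "K \<subseteq> Z - {k}" "cocircuit E r K" using less(1) k by metis
      thus ?thesis by blast
    next
      case False
      thus ?thesis using less unfolding cocircuit_def by blast
    qed
  qed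
  thus ?thesis using that by blast
qed

text \<open>The intersection is a proper subset of \<open>K1\<close> and so not codependent;
  submodularity then lowers the rank of the complement of the union by two, and restoring
  \<open>c\<close> regains at most one.\<close>

lemma cocircuit_elimination:
  assumes K: "cocircuit E r K1" "cocircuit E r K2" "K1 \<noteq> K2" "c \<in> K1 \<inter> K2"
  shows "codependent E r (K1 \<union> K2 - {c})"
proof -
  have s: "K1 \<subseteq> E" "K2 \<subseteq> E" "codependent E r K1" "codependent E r K2" using K unfolding cocircuit_def by auto
  have "\<not> K1 \<subseteq> K2"
  proof
    assume "K1 \<subseteq> K2"
    then obtain k where "k \<in> K2" "K1 \<subseteq> K2 - {k}" using K(3) by auto
    thus False using K(2) codependent_mono[OF s(3)] unfolding cocircuit_def by blast
  qed
  then obtain k where k: "k \<in> K1" "K1 \<inter> K2 \<subseteq> K1 - {k}" by auto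
  hence "\<not> codependent E r (K1 \<inter> K2)" using K(1) codependent_mono unfolding cocircuit_def by blast
  hence 1: "r E \<le> r (E - (K1 \<inter> K2))" unfolding codependent_def by simp
  have "r (E - (K1 \<inter> K2)) + r (E - (K1 \<union> K2)) \<le> r (E - K1) + r (E - K2)"
    by (intro rank_submod_eq) auto
  hence "r (E - (K1 \<union> K2)) \<le> r E - 2" using s 1 unfolding codependent_def by simp
  moreover have "E - (K1 \<union> K2 - {c}) = insert c (E - (K1 \<union> K2))" using K(4) s by auto
  moreover have "r (insert c (E - (K1 \<union> K2))) \<le> r (E - (K1 \<union> K2)) + 1" using K(4) s by (intro rank_insert_le) auto
  ultimately show ?thesis unfolding codependent_def by simp
qed

lemma circuit_cocircuit_orthogonal:
  assumes "circuit E r G" "cocircuit E r K" "K \<inter> G = {c}"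
  shows False
proof -
  have G: "G \<subseteq> E" "dependent r G" "\<not> dependent r (G - {c})" "c \<in> G" using assms(1,3) unfolding circuit_def by auto
  have K: "K \<subseteq> E" "codependent E r K" "\<not> codependent E r (K - {c})" "c \<in> K" using assms(2,3) unfolding cocircuit_def by auto
  have ins: "insert c (G - {c}) = G" using G by auto
  have "card G = Suc (card (G - {c}))" using G finite_sub[OF G(1)] by (metis card_Suc_Diff1)
  hence "r G \<le> r (G - {c})" using G unfolding dependent_def by simp
  moreover have "r (G - {c}) \<le> r G" using G by (intro rank_mono) auto
  ultimately have "r (insert c (G - {c})) = r (G - {c})" using ins by simp
  hence "r (insert c (E - K)) = r (E - K)" by (rule rank_insert_eq_mono) (use assms(3) G in auto)
  moreover have "insert c (E - K) = E - (K - {c})" using K by auto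
  ultimately show False using K unfolding codependent_def by simp
qed

end

text \<open>\<open>\<rho>\<close> plays the part of the rank function of the tangle matroid. The elements of \<open>D\<close> are to be
  deleted, those of \<open>C\<close> to be contracted, one after the other in the order given by \<open>\<iota>\<close>.\<close>

locale removal_sequence = rank_matroid +
  fixes \<rho> :: "'a set \<Rightarrow> int" and D C :: "'a set" and \<iota> :: "'a \<Rightarrow> nat"
  assumes DC: "D \<subseteq> E" "C \<subseteq> E" "D \<inter> C = {}"
    and rho_nonneg: "0 \<le> \<rho> {}"
    and rho_mono: "\<And>X Y. X \<subseteq> Y \<Longrightarrow> Y \<subseteq> E \<Longrightarrow> \<rho> X \<le> \<rho> Y"
    and rho_submod: "\<And>X Y. X \<subseteq> E \<Longrightarrow> Y \<subseteq> E \<Longrightarrow> \<rho> (X \<union> Y) + \<rho> (X \<inter> Y) \<le> \<rho> X + \<rho> Y"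
    and rho_lam: "\<And>X. X \<subseteq> E \<Longrightarrow> card X \<le> card (C \<union> D) + 2 \<Longrightarrow> \<rho> X \<le> lam E r X"
    and rho_pair: "\<And>a b. a \<in> E \<Longrightarrow> b \<in> E \<Longrightarrow> a \<noteq> b \<Longrightarrow> 2 \<le> \<rho> {a, b}"
    and rho_independent: "int (card (C \<union> D)) \<le> \<rho> (C \<union> D)"
    and order_inj: "inj_on \<iota> (C \<union> D)"
    and stages: "\<And>n. three_connected (E - ({c \<in> C. \<iota> c < n} \<union> {d \<in> D. \<iota> d < n}))
        (contract_rank r {c \<in> C. \<iota> c < n})"
    and remaining: "4 \<le> card (E - (C \<union> D))"
begin

abbreviation "I \<equiv> C \<union> D"
abbreviation "Cs n \<equiv> {c \<in> C. \<iota> c < n}"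
abbreviation "Ds n \<equiv> {d \<in> D. \<iota> d < n}"

lemma removal_sequence_dual: "removal_sequence E (dual_rank E r) \<rho> C D \<iota>"
proof -
  interpret d: rank_matroid E "dual_rank E r" by (rule rank_matroid_dual)
  have u: "D \<union> C = C \<union> D" by auto
  show ?thesis
  proof
    show "three_connected (E - (Ds n \<union> Cs n)) (contract_rank (dual_rank E r) (Ds n))" for n
      using stages[of n] three_connected_minor_dual[of "Cs n" "Ds n"] DC by auto
  qed (use DC rho_nonneg rho_mono rho_submod rho_lam rho_pair rho_independent order_inj remaining u in auto)
qed

lemma finI: "finite I" "finite C" "finite D" using finite_sub[of C] finite_sub[of D] DC by auto

text \<open>Submodularity splits \<open>\<rho> I\<close> between \<open>X\<close> and
  \<open>I - X\<close>, and the second part contributes at most its size.\<close>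

lemma rho_subset: "X \<subseteq> I \<Longrightarrow> int (card X) \<le> \<rho> X"
proof -
  assume X: "X \<subseteq> I"
  have IE: "I \<subseteq> E" using DC by auto
  have "\<rho> (X \<union> (I - X)) + \<rho> (X \<inter> (I - X)) \<le> \<rho> X + \<rho> (I - X)" using X IE by (intro rho_submod) auto
  moreover have "X \<union> (I - X) = I" "X \<inter> (I - X) = {}" using X by auto
  moreover have "\<rho> (I - X) \<le> int (card (I - X))"
  proof -
    have "card (I - X) \<le> card I" using finI by (intro card_mono) auto
    hence "\<rho> (I - X) \<le> lam E r (I - X)" using IE by (intro rho_lam) auto
    moreover have "lam E r (I - X) \<le> int (card (I - X))" using IE by (intro lam_le_card) auto
    ultimately show ?thesis by simp
  qed
  moreover have "card I = card X + card (I - X)" using X finI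
    by (metis card_Diff_subset card_mono finite_subset le_add_diff_inverse)
  ultimately show ?thesis using rho_independent rho_nonneg by simp
qed

lemma removed_rank:
  assumes "X \<subseteq> I" shows "r X = int (card X)" "r (E - X) = r E"
proof -
  have XE: "X \<subseteq> E" using assms DC by auto
  have "card X \<le> card I" using assms finI by (intro card_mono) auto
  hence "int (card X) \<le> lam E r X" using rho_lam[OF XE] rho_subset[OF assms] by simp
  moreover have "r X \<le> int (card X)" using XE by (rule rank_le_card)
  moreover have "r (E - X) \<le> r E" by (intro rank_mono) auto
  ultimately show "r X = int (card X)" "r (E - X) = r E" unfolding lam_def by auto
qed

lemma pair_ranks:
  assumes "a \<in> E" "b \<in> E" "a \<noteq> b" shows "r {a, b} = 2" "r (E - {a, b}) = r E"
proof -
  have "2 \<le> lam E r {a, b}" using rho_pair[OF assms] rho_lam[of "{a, b}"] assms by simp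
  moreover have "r {a, b} \<le> 2" using rank_le_card[of "{a, b}"] assms by simp
  moreover have "r (E - {a, b}) \<le> r E" by (intro rank_mono) auto
  ultimately show "r {a, b} = 2" "r (E - {a, b}) = r E" unfolding lam_def by auto
qed

lemma single_rank: "a \<in> E \<Longrightarrow> r {a} = 1"
proof -
  assume a: "a \<in> E"
  have "\<exists>b\<in>E. b \<noteq> a"
  proof (rule ccontr)
    assume "\<not> ?thesis"
    hence "E - I \<subseteq> {a}" by auto
    hence "card (E - I) \<le> card {a}" by (intro card_mono) auto
    thus False using remaining by simp
  qed
  then obtain b where "b \<in> E" "b \<noteq> a" by blast
  thus ?thesis using pair_ranks(1)[of b a] rank_insert_le[of "{a}" b] rank_le_card[of "{a}"] a by simp
qed

text \<open>Deleting \<open>Ds n\<close> does not lower the rank, so codependence passes to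
  \<open>{u, v}\<close> in the minor of stage \<open>n\<close>, against its 3-connectivity. The case
  \<open>u = v\<close> is used for a single element.\<close>

lemma stage_codependent_False:
  assumes Z: "codependent E r Z" "Z \<subseteq> Ds n \<union> {u, v}" and uv: "u \<in> E - (Cs n \<union> Ds n)" "v \<in> E - (Cs n \<union> Ds n)"
  shows False
proof -
  let ?Y = "{u, v}"
  have sub: "Cs n \<subseteq> E" "Ds n \<subseteq> E" "Cs n \<inter> Ds n = {}" "?Y \<subseteq> E - (Cs n \<union> Ds n)" using DC uv by auto
  have "r (E - Ds n - ?Y) \<le> r (E - Z)" using Z(2) by (intro rank_mono) auto
  moreover have "r (E - Ds n) = r E" by (rule removed_rank) auto
  moreover have "r (?Y \<union> Cs n) \<le> r ?Y + r (Cs n)" using sub by (intro rank_union_le) auto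
  moreover have "r ?Y \<le> int (card ?Y)" using sub by (intro rank_le_card) auto
  ultimately have le: "lam (E - (Cs n \<union> Ds n)) (contract_rank r (Cs n)) ?Y \<le> int (card ?Y) - 1"
    using lam_minor[OF sub] Z(1) unfolding codependent_def by simp
  have "card (E - I) - card ?Y \<le> card (E - I - ?Y)" by (rule diff_card_le_card_Diff) auto
  moreover have "card ?Y \<le> 2" "1 \<le> card ?Y" by (auto simp: card_insert_if)
  moreover have "card (E - I - ?Y) \<le> card (E - (Cs n \<union> Ds n) - ?Y)" using finite_ground by (intro card_mono) auto
  ultimately have c: "2 \<le> card (E - (Cs n \<union> Ds n) - ?Y)" using remaining by linarith
  have "min 2 (min (int (card ?Y)) (int (card (E - (Cs n \<union> Ds n) - ?Y))))
      \<le> lam (E - (Cs n \<union> Ds n)) (contract_rank r (Cs n)) ?Y"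
    using stages[of n] sub(4) unfolding three_connected_def by blast
  thus False using c le \<open>card ?Y \<le> 2\<close> by linarith
qed

lemma final_stage: "\<exists>n. Cs n = C \<and> Ds n = D"
proof -
  let ?n = "Suc (Max (insert 0 (\<iota> ` I)))"
  have "\<iota> x < ?n" if "x \<in> I" for x using that finI by (auto simp: less_Suc_eq_le)
  thus ?thesis by (intro exI[of _ ?n]) auto
qed

lemma final_codependent_False:
  assumes "codependent E r Z" "Z \<subseteq> D \<union> {u, v}" "u \<in> E - I" "v \<in> E - I"
  shows False
proof -
  obtain n where n: "Cs n = C" "Ds n = D" using final_stage by blast
  show False by (rule stage_codependent_False[OF assms(1), of n u v]) (use n assms in auto)
qed

lemma removed_not_codependent: "codependent E r Z \<Longrightarrow> \<not> Z \<subseteq> I"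
  using removed_rank(2) unfolding codependent_def by force

text \<open>Eliminating \<open>c\<close> leaves a codependent set within
  \<open>D \<union> {a1, a2}\<close>, which the final minor excludes. So each \<open>c\<close> is
  responsible for only one cocircuit, and this is the source of injectivity later.\<close>

lemma cocircuit_unique:
  assumes "cocircuit E r K1" "cocircuit E r K2" "c \<in> K1 \<inter> K2"
    "K1 \<subseteq> D \<union> {a1, c}" "K2 \<subseteq> D \<union> {a2, c}" "a1 \<in> E - I" "a2 \<in> E - I"
  shows "K1 = K2"
proof (rule ccontr)
  assume "K1 \<noteq> K2"
  hence "codependent E r (K1 \<union> K2 - {c})" using cocircuit_elimination assms by blast
  thus False using final_codependent_False[of "K1 \<union> K2 - {c}" a1 a2] assms by blast
qed

text \<open>For \<open>X\<close> in \<open>D\<close>, the pair \<open>{a, c}\<close> becomes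
  codependent once \<open>X\<close> is deleted. This is the only obstacle to 3-connectivity of that
  deletion, by \<open>not_bad_delete_three_connected\<close>.\<close>

definition "bad X \<longleftrightarrow> (\<exists>c\<in>C. \<exists>a\<in>E - I. codependent E r (insert a (insert c X)))"

lemma bad_mono: "bad X \<Longrightarrow> X \<subseteq> Y \<Longrightarrow> bad Y"
  unfolding bad_def using codependent_mono by (meson insert_mono)

lemma not_bad_empty: "\<not> bad {}"
  using pair_ranks(2) DC unfolding bad_def codependent_def by fastforce

lemma bad_extension:
  assumes "bad (insert h X)" "\<not> bad X" "insert h X \<subseteq> D"
  shows "\<exists>a c K. c \<in> C \<and> a \<in> E - I \<and> cocircuit E r K \<and> K \<subseteq> insert a (insert c (insert h X)) \<and> a \<in> K \<and> c \<in> K \<and> h \<in> K"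
proof -
  obtain c a where ca: "c \<in> C" "a \<in> E - I" "codependent E r (insert a (insert c (insert h X)))"
    using assms(1) unfolding bad_def by blast
  moreover have "insert a (insert c (insert h X)) \<subseteq> E" using ca assms(3) DC by auto
  ultimately obtain K where K: "K \<subseteq> insert a (insert c (insert h X))" "cocircuit E r K"
    using codependent_contains_cocircuit by blast
  have co: "codependent E r K" using K unfolding cocircuit_def by blast
  have "a \<in> K"
  proof (rule ccontr)
    assume "a \<notin> K"
    hence "K \<subseteq> I" using K(1) ca assms(3) by auto
    thus False using removed_not_codependent co by blast
  qed
  moreover have "c \<in> K"
  proof (rule ccontr)
    assume "c \<notin> K"
    hence "K \<subseteq> D \<union> {a, a}" using K(1) assms(3) by auto
    thus False using final_codependent_False[OF co _ ca(2) ca(2)] by blast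
  qed
  moreover have "h \<in> K"
  proof (rule ccontr)
    assume "h \<notin> K"
    hence "K \<subseteq> insert a (insert c X)" using K(1) by auto
    hence "bad X" using codependent_mono[OF co] ca unfolding bad_def by blast
    thus False using assms by blast
  qed
  ultimately show ?thesis using ca K by blast
qed

text \<open>A separation of the deletion of \<open>X\<close> induces one of the final minor, so a
  side \<open>A\<close> has at most one element outside \<open>I\<close>. Independence of
  \<open>I\<close> under \<open>\<rho>\<close> bounds its part inside \<open>I\<close> by its
  connectivity. What is left is a single element or a pair, and the pair is bad or already excluded
  by the final minor.\<close>

lemma not_bad_delete_three_connected:
  assumes X: "X \<subseteq> D" "\<not> bad X"
  shows "three_connected (E - X) r"
proof (rule ccontr)
  assume n: "\<not> three_connected (E - X) r"
  have XE: "X \<subseteq> E" using X DC by auto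
  interpret m: rank_matroid "E - X" r using XE by (rule rank_matroid_delete)
  have rX: "r (E - X) = r E" using X by (intro removed_rank) auto
  have small: False
    if A: "A \<subseteq> E - X" "card (A - I) \<le> 1" "1 \<le> card A"
      and l: "lam (E - X) r A \<le> 1" "card A = 1 \<Longrightarrow> lam (E - X) r A \<le> 0" for A
  proof -
    have fA: "finite A" using A finite_ground by (meson finite_Diff finite_subset)
    have "card (A \<union> X) \<le> card (I \<union> (A - I))" using A X finI fA by (intro card_mono) auto
    also have "\<dots> \<le> card I + card (A - I)" by (rule card_Un_le)
    finally have c: "card (A \<union> X) \<le> card I + 2" using A by simp
    have "lam E r (A \<union> ({} \<union> X)) \<le> lam (E - ({} \<union> X)) (contract_rank r {}) A + int (card ({} \<union> X))"
      using A XE by (intro lam_le_minor) auto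
    hence 1: "lam E r (A \<union> X) \<le> lam (E - X) r A + int (card X)" by simp
    have "\<rho> (A \<union> X) \<le> lam E r (A \<union> X)" using c A XE by (intro rho_lam) auto
    moreover have "\<rho> ((A \<inter> I) \<union> X) \<le> \<rho> (A \<union> X)" using A XE by (intro rho_mono) auto
    moreover have "int (card ((A \<inter> I) \<union> X)) \<le> \<rho> ((A \<inter> I) \<union> X)" using X by (intro rho_subset) auto
    moreover have "card ((A \<inter> I) \<union> X) = card (A \<inter> I) + card X"
      using A fA finite_sub[OF XE] by (subst card_Un_disjoint) auto
    \<comment> \<open>\<open>A \<union> X\<close> has connectivity at least
      \<open>card (A \<inter> I) + card X\<close>, and deleting \<open>X\<close> loses at most
      \<open>card X\<close> of it.\<close>
    ultimately have i: "int (card (A \<inter> I)) \<le> lam (E - X) r A" using 1 by simp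
    have cA: "card A = card (A \<inter> I) + card (A - I)" using fA by (metis card_Int_Diff)
    have co: "r (E - X - A) \<le> lam (E - X) r A + r E - r A" using rX unfolding lam_def by simp
    show False
    proof (cases "card A = 1")
      case True
      hence "card (A \<inter> I) = 0" "card (A - I) = 1" using i l cA by auto
      then obtain a where a: "A - I = {a}" "A \<inter> I = {}" using card_1_singletonE fA by auto
      hence Aa: "A = {a}" "a \<in> E - I" using A by auto
      have "r {a} = 1" using Aa by (intro single_rank) auto
      moreover have "E - X - A = E - insert a X" using Aa by auto
      ultimately have "codependent E r (insert a X)" using co l True Aa unfolding codependent_def by simp
      thus False using final_codependent_False[of "insert a X" a a] X Aa by auto
    next
      case False
      hence "card (A \<inter> I) = 1" "card (A - I) = 1" using i l cA A by auto
      then obtain a z where az: "A - I = {a}" "A \<inter> I = {z}" using card_1_singletonE by metis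
      hence Aaz: "A = {a, z}" "a \<in> E - I" "z \<in> I" "a \<noteq> z" using A by auto
      have "r A = 2" using Aaz DC pair_ranks(1)[of a z] by auto
      moreover have "E - X - A = E - insert a (insert z X)" using Aaz by auto
      ultimately have cd: "codependent E r (insert a (insert z X))" using co l unfolding codependent_def by simp
      show False
      proof (cases "z \<in> C")
        case True
        thus False using X Aaz cd unfolding bad_def by blast
      next
        case False
        hence "z \<in> D" using Aaz by auto
        thus False using final_codependent_False[OF cd, of a a] X Aaz by auto
      qed
    qed
  qed
  have side: "card (A - I) \<le> 1 \<or> card (E - X - A - I) \<le> 1"
    if A: "A \<subseteq> E - X" "lam (E - X) r A \<le> 1" for A
  proof (rule ccontr)
    assume "\<not> ?thesis"
    hence c: "2 \<le> card (A - I)" "2 \<le> card (E - X - A - I)" by auto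
    have e: "E - X - (C \<union> (D - X)) = E - I" using X by auto
    have "lam (E - X - (C \<union> (D - X))) (contract_rank r C) (A - I) \<le> lam (E - X) r ((A - I) \<union> (A \<inter> I))"
      using A X DC by (intro m.lam_minor_le) auto
    moreover have "(A - I) \<union> (A \<inter> I) = A" by auto
    ultimately have "lam (E - I) (contract_rank r C) (A - I) \<le> 1" using A e by simp
    moreover have "three_connected (E - I) (contract_rank r C)"
    proof -
      obtain n where "Cs n = C" "Ds n = D" using final_stage by blast
      thus ?thesis using stages[of n] by simp
    qed
    moreover have "E - I - (A - I) = E - X - A - I" using X by auto
    ultimately show False
      using three_connectedD2[of "E - I" "contract_rank r C" "A - I"] c A by auto
  qed
  have contra: False if A: "A \<subseteq> E - X" "1 \<le> card A" "1 \<le> card (E - X - A)" "lam (E - X) r A \<le> 1"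
    "card A = 1 \<Longrightarrow> lam (E - X) r A \<le> 0" "card (E - X - A) = 1 \<Longrightarrow> lam (E - X) r A \<le> 0" for A
  proof -
    have "lam (E - X) r (E - X - A) = lam (E - X) r A" using A by (intro m.lam_compl)
    thus False
      using side[OF A(1,4)] small[of A] small[of "E - X - A"] A by auto
  qed
  show False
  proof (rule not_three_connectedE[OF n m.lam_nonneg])
    fix A assume "A \<subseteq> E - X" "1 \<le> card A" "1 \<le> card (E - X - A)" "lam (E - X) r A \<le> 0"
    thus False using contra[of A] by auto
  next
    fix A assume "A \<subseteq> E - X" "2 \<le> card A" "2 \<le> card (E - X - A)" "lam (E - X) r A \<le> 1"
    thus False using contra[of A] by auto
  qed
qed

text \<open>Orthogonality allows two common elements, so \<open>\<rho>\<close> has to exclude them.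
  Both \<open>K\<close> and \<open>G\<close> fall short of their size by one under
  \<open>\<rho>\<close> while their intersection has full rank two, so submodularity makes the union
  fall short by two; but without \<open>a\<close> the union is independent.\<close>

lemma circuit_cocircuit_two_common:
  assumes "circuit E r G" "cocircuit E r K" "K \<inter> G = {a, c}" "a \<in> E - I" "c \<in> I"
    "K \<subseteq> insert a I" "G \<subseteq> insert a I"
  shows False
proof -
  have s: "G \<subseteq> E" "K \<subseteq> E" "r G < int (card G)" "r (E - K) < r E"
    using assms unfolding circuit_def cocircuit_def dependent_def codependent_def by auto
  have fin: "finite G" "finite K" using s finite_sub by auto
  have ac: "a \<noteq> c" "c \<in> E" using assms(4,5) DC by auto
  have ia: "card (insert a I) \<le> card I + 1" using finI by (simp add: card_insert_if)
  have cK: "card K \<le> card I + 2" "card G \<le> card I + 2"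
    using card_mono[OF _ assms(6)] card_mono[OF _ assms(7)] finI ia by auto
  have "\<rho> K \<le> lam E r K" "\<rho> G \<le> lam E r G" using cK s by (auto intro: rho_lam)
  moreover have "lam E r K \<le> int (card K) - 1" using rank_le_card[OF s(2)] s unfolding lam_def by simp
  moreover have "lam E r G \<le> int (card G) - 1" using lam_le_rank[OF s(1)] s by simp
  moreover have "\<rho> (K \<union> G) + \<rho> (K \<inter> G) \<le> \<rho> K + \<rho> G" using s by (intro rho_submod) auto
  moreover have "2 \<le> \<rho> (K \<inter> G)" using assms(3,4) ac rho_pair[of a c] by simp
  moreover have "\<rho> (K \<union> G - {a}) \<le> \<rho> (K \<union> G)" using s by (intro rho_mono) auto
  moreover have "int (card (K \<union> G - {a})) \<le> \<rho> (K \<union> G - {a})" using assms by (intro rho_subset) auto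
  moreover have "card K + card G = card (K \<union> G) + card (K \<inter> G)" using fin card_Un_Int by blast
  moreover have "card (K \<inter> G) = 2" using assms(3) ac by simp
  moreover have "card (K \<union> G) = Suc (card (K \<union> G - {a}))"
  proof -
    have "a \<in> K \<union> G" using assms(3) by auto
    thus ?thesis using fin by (metis card_Suc_Diff1 finite_UnI)
  qed
  ultimately show False by linarith
qed

text \<open>A rejected deletion comes with a cocircuit and an element of \<open>C\<close>. A second
  greedy choice, for contractions and among these elements of \<open>C\<close> only, has its
  rejections mapped injectively into the kept deletions \<open>D'\<close>.\<close>

lemma many_deletions:
  assumes k: "1 \<le> k" "3 * k \<le> card D + 2"
  shows "(\<exists>X\<subseteq>D. card X = k \<and> three_connected (E - X) r) \<or>
    (\<exists>X\<subseteq>C. card X = k \<and> three_connected (E - X) (contract_rank r X))"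
proof -
  interpret d: removal_sequence E "dual_rank E r" \<rho> C D \<iota> by (rule removal_sequence_dual)
  have injD: "inj_on \<iota> D" "inj_on \<iota> C" using order_inj by (auto simp: inj_on_Un)
  obtain D' where D': "D' \<subseteq> D" "\<not> bad D'" "\<And>h. h \<in> D - D' \<Longrightarrow> \<not> \<not> bad (insert h {d \<in> D'. \<iota> d < \<iota> h})"
    using greedy_subset[of D \<iota> "\<lambda>X. \<not> bad X"] finI injD not_bad_empty by blast
  show ?thesis
  proof (cases "k \<le> card D'")
    case True
    then obtain X where X: "X \<subseteq> D'" "card X = k" by (metis obtain_subset_with_card_n)
    hence "\<not> bad X" "X \<subseteq> D" using bad_mono D' by blast+
    thus ?thesis using not_bad_delete_three_connected X by blast
  next
    case False
    define H where "H = D - D'"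
    have fD': "finite D'" "finite H" using D' finI finite_subset unfolding H_def by auto
    have cH: "card H + card D' = card D"
      unfolding H_def using D' finI by (metis add.commute card_Diff_subset card_mono fD'(1) le_add_diff_inverse)
    define P where "P h a c K \<longleftrightarrow> c \<in> C \<and> a \<in> E - I \<and> cocircuit E r K
        \<and> K \<subseteq> insert a (insert c (insert h {d \<in> D'. \<iota> d < \<iota> h})) \<and> a \<in> K \<and> c \<in> K \<and> h \<in> K" for h a c K
    have "\<exists>a c K. P h a c K" if "h \<in> H" for h
      unfolding P_def
    proof (rule bad_extension)
      show "bad (insert h {d \<in> D'. \<iota> d < \<iota> h})" using D'(3) that unfolding H_def by blast
      show "\<not> bad {d \<in> D'. \<iota> d < \<iota> h}" using bad_mono D'(2) by (metis (no_types, lifting) mem_Collect_eq subsetI)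
      show "insert h {d \<in> D'. \<iota> d < \<iota> h} \<subseteq> D" using that D' unfolding H_def by auto
    qed
    then obtain af cf Kf where "\<And>h. h \<in> H \<Longrightarrow> P h (af h) (cf h) (Kf h)" by metis
    hence f: "\<And>h. h \<in> H \<Longrightarrow> cf h \<in> C" "\<And>h. h \<in> H \<Longrightarrow> af h \<in> E - I"
      "\<And>h. h \<in> H \<Longrightarrow> cocircuit E r (Kf h)"
      "\<And>h. h \<in> H \<Longrightarrow> Kf h \<subseteq> insert (af h) (insert (cf h) (insert h {d \<in> D'. \<iota> d < \<iota> h}))"
      "\<And>h. h \<in> H \<Longrightarrow> af h \<in> Kf h" "\<And>h. h \<in> H \<Longrightarrow> cf h \<in> Kf h" "\<And>h. h \<in> H \<Longrightarrow> h \<in> Kf h"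
      unfolding P_def by blast+
    have HD: "h \<in> D" "h \<notin> D'" if "h \<in> H" for h using that unfolding H_def by auto
    have KH: "h' = h" if "h \<in> H" "h' \<in> H" "h' \<in> Kf h" for h h'
      using f(1,2,4)[OF that(1)] that HD[OF that(2)] DC by auto
    have inj_cf: "inj_on cf H"
    proof (rule inj_onI)
      fix h h' assume h: "h \<in> H" "h' \<in> H" "cf h = cf h'"
      have "Kf h = Kf h'"
      proof (rule cocircuit_unique)
        show "cf h \<in> Kf h \<inter> Kf h'" using f(6)[OF h(1)] f(6)[OF h(2)] h(3) by simp
        show "Kf h \<subseteq> D \<union> {af h, cf h}" using f(4)[OF h(1)] HD[OF h(1)] D' by auto
        show "Kf h' \<subseteq> D \<union> {af h', cf h}" using f(4)[OF h(2)] HD[OF h(2)] D' h(3) by auto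
      qed (use f h in auto)
      thus "h = h'" using KH f(7) h by metis
    qed
    \<comment> \<open>Otherwise the part of \<open>Kf h\<close> in \<open>D\<close> is deleted
      before \<open>cf h\<close> is contracted, and \<open>{af h, cf h}\<close> is codependent at
      that stage.\<close>
    have order: "\<iota> (cf h) < \<iota> h" if h: "h \<in> H" for h
    proof (rule ccontr)
      assume "\<not> ?thesis"
      moreover have "\<iota> (cf h) \<noteq> \<iota> h"
        using f(1)[OF h] HD[OF h] DC order_inj by (metis UnI1 UnI2 disjoint_iff inj_onD)
      ultimately have lt: "\<iota> h < \<iota> (cf h)" by simp
      have "codependent E r (Kf h)" using f(3)[OF h] unfolding cocircuit_def by blast
      thus False
      proof (rule stage_codependent_False)
        show "Kf h \<subseteq> Ds (\<iota> (cf h)) \<union> {af h, cf h}" using f(4)[OF h] HD[OF h] D' lt by auto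
        show "af h \<in> E - (Cs (\<iota> (cf h)) \<union> Ds (\<iota> (cf h)))" using f(2)[OF h] by auto
        show "cf h \<in> E - (Cs (\<iota> (cf h)) \<union> Ds (\<iota> (cf h)))" using f(1)[OF h] DC by auto
      qed
    qed
    let ?S = "cf ` H"
    have SC: "?S \<subseteq> C" using f(1) by auto
    have fS: "finite ?S" using fD' by simp
    have "inj_on \<iota> ?S" using injD SC inj_on_subset by blast
    then obtain C' where C': "C' \<subseteq> ?S" "\<not> d.bad C'" "\<And>x. x \<in> ?S - C' \<Longrightarrow> \<not> \<not> d.bad (insert x {c \<in> C'. \<iota> c < \<iota> x})"
      using greedy_subset[of ?S \<iota> "\<lambda>X. \<not> d.bad X"] fS d.not_bad_empty by blast
    define Q where "Q x b e G \<longleftrightarrow> e \<in> D \<and> b \<in> E - (D \<union> C) \<and> cocircuit E (dual_rank E r) G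
        \<and> G \<subseteq> insert b (insert e (insert x C')) \<and> b \<in> G \<and> e \<in> G \<and> x \<in> G" for x b e G
    have "\<exists>b e G. Q x b e G" if "x \<in> ?S - C'" for x
      unfolding Q_def
    proof (rule d.bad_extension)
      show "d.bad (insert x C')"
        using C'(3)[OF that] d.bad_mono[of "insert x {c \<in> C'. \<iota> c < \<iota> x}" "insert x C'"] by auto
      show "\<not> d.bad C'" by (rule C'(2))
      show "insert x C' \<subseteq> C" using that C' SC by auto
    qed
    then obtain bf ef Gf where "\<And>x. x \<in> ?S - C' \<Longrightarrow> Q x (bf x) (ef x) (Gf x)" by metis
    hence g: "\<And>x. x \<in> ?S - C' \<Longrightarrow> ef x \<in> D" "\<And>x. x \<in> ?S - C' \<Longrightarrow> bf x \<in> E - I"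
      "\<And>x. x \<in> ?S - C' \<Longrightarrow> circuit E r (Gf x)"
      "\<And>x. x \<in> ?S - C' \<Longrightarrow> Gf x \<subseteq> insert (bf x) (insert (ef x) (insert x C'))"
      "\<And>x. x \<in> ?S - C' \<Longrightarrow> bf x \<in> Gf x" "\<And>x. x \<in> ?S - C' \<Longrightarrow> ef x \<in> Gf x" "\<And>x. x \<in> ?S - C' \<Longrightarrow> x \<in> Gf x"
      unfolding Q_def cocircuit_dual Un_commute[of D C] by blast+
    have GC: "Gf x \<subseteq> insert (bf x) (insert (ef x) C)" if "x \<in> ?S - C'" for x
      using g(4)[OF that] that C'(1) SC by blast
    \<comment> \<open>Suppose \<open>ef x\<close> was rejected. An element \<open>c\<close> of the
      circuit in \<open>C\<close> other than \<open>cf (ef x)\<close> has a cocircuit that avoids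
      \<open>ef x\<close>, hence meets the circuit in \<open>c\<close> and possibly
      \<open>af h\<close> only; both are impossible. So the circuit meets \<open>C\<close> at most
      in \<open>cf (ef x)\<close>, contracted before \<open>ef x\<close> is deleted, and it is a
      dependence at that stage.\<close>
    have ef_D': "ef x \<in> D'" if x: "x \<in> ?S - C'" for x
    proof (rule ccontr)
      assume "ef x \<notin> D'"
      hence eH: "ef x \<in> H" using g(1)[OF x] unfolding H_def by auto
      have only: "c = cf (ef x)" if c: "c \<in> Gf x \<inter> C" for c
      proof (rule ccontr)
        assume neq: "c \<noteq> cf (ef x)"
        have "c \<in> insert x C'" using c g(4)[OF x] g(1,2)[OF x] DC by auto
        hence "c \<in> ?S" using x C' by auto
        then obtain h where h: "h \<in> H" "c = cf h" by auto
        have ne: "ef x \<notin> Kf h" using KH[OF h(1) eH] neq h by auto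
        have sub: "Kf h \<inter> Gf x \<subseteq> {c, af h}"
        proof
          fix z assume z: "z \<in> Kf h \<inter> Gf x"
          have "z \<in> insert (af h) (insert c D)" using z f(4)[OF h(1)] h HD[OF h(1)] D' by auto
          moreover have "z \<in> D \<Longrightarrow> z = ef x" using z GC[OF x] g(2)[OF x] DC by auto
          ultimately show "z \<in> {c, af h}" using ne z by auto
        qed
        have cin: "c \<in> Kf h \<inter> Gf x" using c h f(6) by auto
        show False
        proof (cases "af h \<in> Gf x")
          case False
          hence "Kf h \<inter> Gf x = {c}" using sub cin by auto
          thus False using circuit_cocircuit_orthogonal[OF g(3)[OF x] f(3)[OF h(1)]] by blast
        next
          case True
          hence eq: "Kf h \<inter> Gf x = {af h, c}" using sub cin f(5)[OF h(1)] by auto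
          have "af h = bf x" using True GC[OF x] f(2)[OF h(1)] g(1)[OF x] by auto
          show False
          proof (rule circuit_cocircuit_two_common[OF g(3)[OF x] f(3)[OF h(1)] eq f(2)[OF h(1)]])
            show "c \<in> I" using c by auto
            show "Kf h \<subseteq> insert (af h) I" using f(4)[OF h(1)] f(1)[OF h(1)] HD[OF h(1)] D' by auto
            show "Gf x \<subseteq> insert (af h) I" using GC[OF x] g(1)[OF x] \<open>af h = bf x\<close> by auto
          qed
        qed
      qed
      have "Gf x \<subseteq> Cs (\<iota> (ef x)) \<union> {bf x, ef x}"
      proof
        fix z assume z: "z \<in> Gf x"
        hence "z \<in> C \<or> z \<in> {bf x, ef x}" using GC[OF x] by auto
        thus "z \<in> Cs (\<iota> (ef x)) \<union> {bf x, ef x}" using only z order[OF eH] by auto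
      qed
      moreover have "codependent E (dual_rank E r) (Gf x)"
        using g(3)[OF x] unfolding circuit_def by (simp add: codependent_dual)
      moreover have "bf x \<in> E - (Ds (\<iota> (ef x)) \<union> Cs (\<iota> (ef x)))" "ef x \<in> E - (Ds (\<iota> (ef x)) \<union> Cs (\<iota> (ef x)))"
        using g(1,2)[OF x] DC by auto
      ultimately show False using d.stage_codependent_False by blast
    qed
    have "inj_on ef (?S - C')"
    proof (rule inj_onI)
      fix x x' assume x: "x \<in> ?S - C'" "x' \<in> ?S - C'" "ef x = ef x'"
      have "Gf x = Gf x'"
      proof (rule d.cocircuit_unique)
        show "ef x \<in> Gf x \<inter> Gf x'" using g(6)[OF x(1)] g(6)[OF x(2)] x(3) by simp
        show "Gf x \<subseteq> C \<union> {bf x, ef x}" using GC[OF x(1)] by auto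
        show "Gf x' \<subseteq> C \<union> {bf x', ef x}" using GC[OF x(2)] x(3) by auto
      qed (use g x in \<open>auto simp: cocircuit_dual\<close>)
      hence "x \<in> Gf x'" using g(7) x by auto
      hence "x \<in> insert (bf x') (insert (ef x') (insert x' C'))" using g(4)[OF x(2)] by blast
      moreover have "x \<in> C" "x \<notin> C'" using x(1) SC by blast+
      ultimately show "x = x'" using g(1,2)[OF x(2)] DC(3) by blast
    qed
    hence "card (?S - C') \<le> card D'"
      using ef_D' fD' by (metis card_image card_mono image_subsetI)
    moreover have "card (?S - C') = card ?S - card C'"
      using C' fS by (metis card_Diff_subset finite_subset)
    moreover have "card ?S = card H" using inj_cf by (rule card_image)
    \<comment> \<open>At least \<open>2k - 1\<close> candidates, of which at most
      \<open>k - 1\<close> are rejected.\<close>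
    ultimately have "k \<le> card C'" using False k cH by linarith
    then obtain X where X: "X \<subseteq> C'" "card X = k" by (metis obtain_subset_with_card_n)
    have XC: "X \<subseteq> C" "\<not> d.bad X" using X C' SC d.bad_mono by blast+
    hence "three_connected (E - X) (dual_rank E r)" using d.not_bad_delete_three_connected by blast
    hence "three_connected (E - X) (contract_rank r X)"
      using three_connected_minor_dual[of X "{}"] XC DC by auto
    thus ?thesis using X XC by blast
  qed
qed

lemma many_removals:
  assumes k: "1 \<le> k" "6 * k \<le> card (C \<union> D) + 5"
  shows "(\<exists>X\<subseteq>D. card X = k \<and> three_connected (E - X) r) \<or>
    (\<exists>X\<subseteq>C. card X = k \<and> three_connected (E - X) (contract_rank r X))"
proof -
  interpret d: removal_sequence E "dual_rank E r" \<rho> C D \<iota> by (rule removal_sequence_dual)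
  have "card (C \<union> D) = card C + card D" using finI DC by (subst card_Un_disjoint) auto
  then consider "3 * k \<le> card D + 2" | "3 * k \<le> card C + 2" using k by linarith
  thus ?thesis
  proof cases
    case 1
    thus ?thesis using many_deletions k by blast
  next
    case 2
    have "three_connected (E - X) (dual_rank E r) \<longleftrightarrow> three_connected (E - X) (contract_rank r X)" if "X \<subseteq> C" for X
      using three_connected_minor_dual[of X "{}"] that DC by auto
    moreover have "three_connected (E - X) (contract_rank (dual_rank E r) X) \<longleftrightarrow> three_connected (E - X) r" if "X \<subseteq> D" for X
      using three_connected_minor_dual[of "{}" X] that DC by auto
    ultimately show ?thesis using d.many_deletions[OF k(1) 2] by blast
  qed
qed

end

section \<open>Removal sequences\<close>

lemma carries_minorD:
  assumes "C \<subseteq> E - EN" "carries (E - (C \<union> D)) (contract_rank r C) EN rN C1"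
  shows "carries E r EN rN (C \<union> C1)"
proof -
  have "X \<union> C1 \<union> C = X \<union> (C \<union> C1)" "C1 \<union> C = C \<union> C1" for X by auto
  thus ?thesis using assms unfolding carries_def contract_rank_def by auto
qed

lemma carries_minorI:
  assumes "carries E r EN rN C0" "C \<subseteq> C0" "D \<inter> C0 = {}"
  shows "carries (E - (C \<union> D)) (contract_rank r C) EN rN (C0 - C)"
proof -
  have "X \<union> (C0 - C) \<union> C = X \<union> C0" "C0 - C \<union> C = C0" for X using assms by auto
  thus ?thesis using assms unfolding carries_def contract_rank_def by auto
qed

section \<open>Rank in the tangle matroid and tangles of minors\<close>

context tangle_matroid
begin

definition tangle_rho :: "'a set \<Rightarrow> int" where
  "tangle_rho X = (if \<exists>Y\<in>T. X \<subseteq> Y then Min (lam E r ` {Y \<in> T. X \<subseteq> Y}) else \<theta>)"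

lemma finite_tangle: "finite T"
  using tangle_subset finite_ground by (intro finite_subset[of T "Pow E"]) auto

lemma rho_cases: "tangle_rho X = \<theta> \<or> (\<exists>Y\<in>T. X \<subseteq> Y \<and> lam E r Y = tangle_rho X)"
proof (cases "\<exists>Y\<in>T. X \<subseteq> Y")
  case True
  hence "lam E r ` {Y \<in> T. X \<subseteq> Y} \<noteq> {}" by auto
  hence "Min (lam E r ` {Y \<in> T. X \<subseteq> Y}) \<in> lam E r ` {Y \<in> T. X \<subseteq> Y}" using finite_tangle by (intro Min_in) auto
  thus ?thesis using True unfolding tangle_rho_def by auto
next
  case False
  thus ?thesis unfolding tangle_rho_def by simp
qed

lemma rho_le_lam:
  assumes "Y \<in> T" "X \<subseteq> Y" shows "tangle_rho X \<le> lam E r Y"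
proof -
  have "Min (lam E r ` {Y \<in> T. X \<subseteq> Y}) \<le> lam E r Y" using assms finite_tangle by (intro Min_le) auto
  thus ?thesis using assms unfolding tangle_rho_def by auto
qed

lemma rho_le_order: "tangle_rho X \<le> \<theta>"
  using rho_cases[of X] tangle_lam by fastforce

lemma rho_le_lam':
  assumes "X \<subseteq> Y" "Y \<in> T \<or> \<theta> \<le> lam E r Y" shows "tangle_rho X \<le> lam E r Y"
  using assms rho_le_lam rho_le_order order_trans by blast

lemma tangle_rho_mono:
  assumes "X \<subseteq> Y" shows "tangle_rho X \<le> tangle_rho Y"
  using rho_cases[of Y] rho_le_order[of X] rho_le_lam[of _ X] assms by (metis order_trans)

text \<open>Uncross the sets attaining the two minima. Their union and intersection stay in the
  tangle unless their connectivity reaches \<open>\<theta>\<close>, and then the general bound by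
  \<open>\<theta>\<close> suffices.\<close>

lemma tangle_rho_submod: "tangle_rho (X \<union> Y) + tangle_rho (X \<inter> Y) \<le> tangle_rho X + tangle_rho Y"
proof -
  have le: "tangle_rho (X \<inter> Y) \<le> tangle_rho X" "tangle_rho (X \<inter> Y) \<le> tangle_rho Y" by (auto intro: tangle_rho_mono)
  show ?thesis
  proof (cases "tangle_rho X = \<theta> \<or> tangle_rho Y = \<theta>")
    case True
    thus ?thesis using le rho_le_order[of "X \<union> Y"] by auto
  next
    case False
    then obtain A B where A: "A \<in> T" "X \<subseteq> A" "lam E r A = tangle_rho X" and B: "B \<in> T" "Y \<subseteq> B" "lam E r B = tangle_rho Y"
      using rho_cases[of X] rho_cases[of Y] by blast
    have "lam E r (A \<union> B) + lam E r (A \<inter> B) \<le> lam E r A + lam E r B"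
      using tangle_subset A B by (intro lam_submod_eq) auto
    moreover have "tangle_rho (X \<union> Y) \<le> lam E r (A \<union> B)"
    proof (rule rho_le_lam')
      show "A \<union> B \<in> T \<or> \<theta> \<le> lam E r (A \<union> B)" using tangle_union[OF A(1) B(1)] by force
    qed (use A B in auto)
    moreover have "tangle_rho (X \<inter> Y) \<le> lam E r (A \<inter> B)"
    proof (rule rho_le_lam')
      show "A \<inter> B \<in> T \<or> \<theta> \<le> lam E r (A \<inter> B)" using tangle_down[OF A(1), of "A \<inter> B"] by force
    qed (use A B in auto)
    ultimately show ?thesis using A B by simp
  qed
qed

lemma tangle_rho_nonneg: "0 \<le> \<theta> \<Longrightarrow> 0 \<le> tangle_rho X"
  using rho_cases[of X] lam_nonneg tangle_subset by metis

lemma rho_small: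
  assumes "X \<subseteq> E" "int (card X) < \<theta>" shows "tangle_rho X \<le> lam E r X"
  using rho_le_lam[OF tangle_small[OF assms]] by simp

lemma rho_union_le:
  assumes "0 \<le> \<theta>" shows "tangle_rho (X \<union> Y) \<le> tangle_rho X + tangle_rho Y"
  using tangle_rho_submod[of X Y] tangle_rho_nonneg[OF assms, of "X \<inter> Y"] by simp

lemma closed_superset:
  assumes "X \<in> T"
  obtains F where "F \<in> T" "X \<subseteq> F" "lam E r F \<le> lam E r X" "\<And>Y. Y \<in> T \<Longrightarrow> F \<subset> Y \<Longrightarrow> lam E r F < lam E r Y"
proof -
  have "\<exists>F\<in>T. X \<subseteq> F \<and> lam E r F \<le> lam E r X \<and> (\<forall>Y\<in>T. F \<subset> Y \<longrightarrow> lam E r F < lam E r Y)"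
    using assms
  proof (induction "card E - card X" arbitrary: X rule: less_induct)
    case less
    show ?case
    proof (cases "\<exists>Y\<in>T. X \<subset> Y \<and> lam E r Y \<le> lam E r X")
      case True
      then obtain Y where Y: "Y \<in> T" "X \<subset> Y" "lam E r Y \<le> lam E r X" by blast
      have "card X < card Y" using Y finite_sub tangle_subset by (intro psubset_card_mono) auto
      moreover have "card Y \<le> card E" using Y tangle_subset finite_ground by (intro card_mono) auto
      ultimately have "card E - card Y < card E - card X" by simp
      then obtain F where "F \<in> T" "Y \<subseteq> F" "lam E r F \<le> lam E r Y" "\<forall>Y\<in>T. F \<subset> Y \<longrightarrow> lam E r F < lam E r Y"
        using less(1)[OF _ Y(1)] by blast
      thus ?thesis using Y by (intro bexI[of _ F]) auto
    next
      case False
      thus ?thesis using less(2) by (intro bexI[of _ X]) (auto simp: not_le)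
    qed
  qed
  thus ?thesis using that by blast
qed

text \<open>Members are the sets that lie in \<open>T\<close> after the removed elements are put
  back, so the covering axioms are inherited. Putting them back raises connectivity by at most their
  number, which is the loss of order.\<close>

lemma tangle_minor:
  assumes "C \<subseteq> E" "D \<subseteq> E" "C \<inter> D = {}" "int (card (C \<union> D)) < \<theta>"
  shows "tangle_matroid (E - (C \<union> D)) (contract_rank r C)
    {Y. Y \<subseteq> E - (C \<union> D) \<and> lam (E - (C \<union> D)) (contract_rank r C) Y < \<theta> - int (card (C \<union> D)) \<and> Y \<union> (C \<union> D) \<in> T}
    (\<theta> - int (card (C \<union> D)))"
proof -
  let ?I = "C \<union> D" let ?E = "E - (C \<union> D)" let ?r = "contract_rank r C"
  interpret m: rank_matroid ?E ?r using assms by (intro rank_matroid_minor)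
  have IT: "?I \<in> T" using assms by (intro tangle_small) auto
  show ?thesis
  proof
    fix X assume X: "X \<subseteq> ?E" "lam ?E ?r X < \<theta> - int (card ?I)"
    let ?X = "?E - X"
    have Xc: "?X \<subseteq> ?E" "lam ?E ?r ?X < \<theta> - int (card ?I)" using X m.lam_compl by auto
    have 1: "lam E r (X \<union> ?I) < \<theta>" using lam_le_minor(1)[OF assms(1-3) X(1)] X(2) by simp
    have 2: "lam E r (?X \<union> ?I) < \<theta>" using lam_le_minor(1)[OF assms(1-3) Xc(1)] Xc(2) by simp
    \<comment> \<open>If \<open>X \<union> ?I\<close> is not in \<open>T\<close>, its complement
      \<open>?X\<close> is, and the small set \<open>?I\<close> can be joined to it.\<close>
    have "X \<union> ?I \<in> T \<or> ?X \<union> ?I \<in> T"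
    proof (rule ccontr)
      assume n: "\<not> ?thesis"
      have s: "X \<union> ?I \<subseteq> E" using X assms by auto
      have "E - (X \<union> ?I) \<in> T" using tangle_cover[OF s 1] n by blast
      moreover have "E - (X \<union> ?I) = ?X" using X assms by auto
      ultimately have "?X \<in> T" by simp
      thus False using n tangle_union[OF _ IT 2] by blast
    qed
    thus "X \<in> {Y. Y \<subseteq> ?E \<and> lam ?E ?r Y < \<theta> - int (card ?I) \<and> Y \<union> ?I \<in> T} \<or>
        ?E - X \<in> {Y. Y \<subseteq> ?E \<and> lam ?E ?r Y < \<theta> - int (card ?I) \<and> Y \<union> ?I \<in> T}"
      using X Xc by blast
  next
    fix X Y Z
    assume "X \<in> {Y. Y \<subseteq> ?E \<and> lam ?E ?r Y < \<theta> - int (card ?I) \<and> Y \<union> ?I \<in> T}"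
      "Y \<in> {Y. Y \<subseteq> ?E \<and> lam ?E ?r Y < \<theta> - int (card ?I) \<and> Y \<union> ?I \<in> T}"
      "Z \<in> {Y. Y \<subseteq> ?E \<and> lam ?E ?r Y < \<theta> - int (card ?I) \<and> Y \<union> ?I \<in> T}"
    hence t: "X \<union> ?I \<in> T" "Y \<union> ?I \<in> T" "Z \<union> ?I \<in> T" by auto
    show "X \<union> Y \<union> Z \<noteq> ?E"
    proof
      assume "X \<union> Y \<union> Z = ?E"
      hence "(X \<union> ?I) \<union> (Y \<union> ?I) \<union> (Z \<union> ?I) = E" using assms by auto
      thus False using tangle_three[OF t] by simp
    qed
  next
    fix e assume e: "e \<in> ?E"
    hence "(?E - {e}) \<union> ?I = E - {e}" using assms by auto
    thus "?E - {e} \<notin> {Y. Y \<subseteq> ?E \<and> lam ?E ?r Y < \<theta> - int (card ?I) \<and> Y \<union> ?I \<in> T}"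
      using tangle_co_single[of e] e by auto
  qed auto
qed

end

locale tangle_with_minor = three_connected_tangle E r T \<theta> + matroid_with_minor E r EN rN
  for E :: "'a set" and r T \<theta> EN rN
begin

text \<open>The rank condition is independence of \<open>C \<union> D\<close> in the tangle matroid
  with \<open>EN\<close> contracted, an invariant that subsets inherit. The last clause keeps
  \<open>N\<close> a minor of the minor reached.\<close>

definition "removable D C \<longleftrightarrow> D \<subseteq> E - EN \<and> C \<subseteq> E - EN \<and> D \<inter> C = {}
  \<and> tangle_rho (EN \<union> (C \<union> D)) = tangle_rho EN + int (card (C \<union> D))
  \<and> three_connected (E - (C \<union> D)) (contract_rank r C)
  \<and> (\<exists>C0. carries E r EN rN C0 \<and> C \<subseteq> C0 \<and> D \<inter> C0 = {})"

text \<open>Two closures are needed. Avoiding \<open>F0\<close>, closed in the original tangle,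
  keeps the removed set independent there; avoiding \<open>F\<close>, closed in the tangle of the
  minor and containing the rest of \<open>F0\<close>, is what \<open>stuck_tangle\<close>
  handles.\<close>

lemma removable_extend:
  assumes rem: "removable D C" and order: "tangle_rho EN + 2 * int (card (C \<union> D)) < \<theta>" "int (card (C \<union> D)) + 3 \<le> \<theta>"
  obtains e where "e \<in> E - (EN \<union> (C \<union> D))" "removable (insert e D) C \<or> removable D (insert e C)"
proof -
  let ?I = "C \<union> D" let ?E = "E - (C \<union> D)" let ?r = "contract_rank r C"
  let ?s = "int (card ?I)" let ?t = "tangle_rho EN"
  have DC: "D \<subseteq> E - EN" "C \<subseteq> E - EN" "D \<inter> C = {}" and rho: "tangle_rho (EN \<union> ?I) = ?t + ?s"
    and tc: "three_connected ?E ?r" using rem unfolding removable_def by auto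
  obtain C0 where C0: "carries E r EN rN C0" "C \<subseteq> C0" "D \<inter> C0 = {}" using rem unfolding removable_def by blast
  have DC': "C \<subseteq> E" "D \<subseteq> E" "C \<inter> D = {}" using DC by auto
  have fI: "finite ?I" using DC' finite_sub by auto
  have t0: "0 \<le> ?t" using tangle_rho_nonneg order3 by simp
  have "tangle_rho (EN \<union> ?I) \<noteq> \<theta>" using rho order(1) by simp
  then obtain Y0 where Y0: "Y0 \<in> T" "EN \<union> ?I \<subseteq> Y0" "lam E r Y0 = ?t + ?s" using rho_cases[of "EN \<union> ?I"] rho by auto
  obtain F0 where F0: "F0 \<in> T" "Y0 \<subseteq> F0" "lam E r F0 \<le> lam E r Y0" "\<And>Y. Y \<in> T \<Longrightarrow> F0 \<subset> Y \<Longrightarrow> lam E r F0 < lam E r Y"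
    using closed_superset[OF Y0(1)] by metis
  have sub0: "EN \<union> ?I \<subseteq> F0" using Y0 F0 by auto
  have lF0: "lam E r F0 = ?t + ?s" using rho_le_lam[OF F0(1) sub0] F0(3) Y0(3) rho by simp
  \<comment> \<open>A tangle set containing \<open>EN\<close>, the removed elements and
    \<open>e\<close>, with connectivity at most \<open>?t + ?s\<close>, would uncross with
    \<open>F0\<close> to a larger set of no more connectivity than \<open>F0\<close>.\<close>
  have grow: "tangle_rho (EN \<union> insert e ?I) = ?t + ?s + 1" if e: "e \<in> E - F0" for e
  proof -
    have "tangle_rho (EN \<union> ?I \<union> {e}) \<le> tangle_rho (EN \<union> ?I) + tangle_rho {e}" using order3 by (intro rho_union_le) simp
    moreover have "tangle_rho {e} \<le> 1"
      using rho_small[of "{e}"] lam_le_card[of "{e}"] order3 e by simp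
    moreover have eq: "EN \<union> ?I \<union> {e} = EN \<union> insert e ?I" by auto
    ultimately have le: "tangle_rho (EN \<union> insert e ?I) \<le> ?t + ?s + 1" using rho by simp
    have "\<not> tangle_rho (EN \<union> insert e ?I) \<le> ?t + ?s"
    proof
      assume a: "tangle_rho (EN \<union> insert e ?I) \<le> ?t + ?s"
      hence "tangle_rho (EN \<union> insert e ?I) \<noteq> \<theta>" using order(1) by simp
      then obtain Y where Y: "Y \<in> T" "EN \<union> insert e ?I \<subseteq> Y" "lam E r Y \<le> ?t + ?s"
        using rho_cases[of "EN \<union> insert e ?I"] a by auto
      have "?t + ?s \<le> lam E r (Y \<inter> F0)"
      proof -
        have "Y \<inter> F0 \<in> T \<or> \<theta> \<le> lam E r (Y \<inter> F0)" using tangle_down[OF Y(1), of "Y \<inter> F0"] by force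
        moreover have "EN \<union> ?I \<subseteq> Y \<inter> F0" using Y sub0 by auto
        ultimately show ?thesis using rho_le_lam'[of "EN \<union> ?I" "Y \<inter> F0"] rho by simp
      qed
      moreover have "lam E r (Y \<union> F0) + lam E r (Y \<inter> F0) \<le> lam E r Y + lam E r F0"
        using tangle_subset Y F0 by (intro lam_submod_eq) auto
      ultimately have l: "lam E r (Y \<union> F0) \<le> lam E r F0" using Y(3) lF0 by simp
      hence "Y \<union> F0 \<in> T" using tangle_lam[OF F0(1)] by (intro tangle_union Y(1) F0(1)) simp
      moreover have "F0 \<subset> Y \<union> F0" using e Y by auto
      ultimately show False using F0(4) l by fastforce
    qed
    thus ?thesis using le by simp
  qed
  let ?T = "{Y. Y \<subseteq> ?E \<and> lam ?E ?r Y < \<theta> - ?s \<and> Y \<union> ?I \<in> T}"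
  interpret m: tangle_matroid ?E ?r ?T "\<theta> - ?s" using order(2) by (intro tangle_minor DC') simp
  have "lam ?E ?r (F0 - ?I) \<le> lam E r ((F0 - ?I) \<union> ?I)"
    using tangle_subset[OF F0(1)] by (intro lam_minor_le DC') auto
  moreover have Fu: "(F0 - ?I) \<union> ?I = F0" using sub0 by auto
  ultimately have "lam ?E ?r (F0 - ?I) < \<theta> - ?s" using lF0 order(1) by simp
  hence FT: "F0 - ?I \<in> ?T" using tangle_subset[OF F0(1)] F0(1) Fu by auto
  obtain F where F: "F \<in> ?T" "F0 - ?I \<subseteq> F" "\<And>Y. Y \<in> ?T \<Longrightarrow> F \<subset> Y \<Longrightarrow> lam ?E ?r F < lam ?E ?r Y"
    by (rule m.closed_superset[OF FT]) blast
  have ENF: "EN \<subseteq> F" using sub0 F(2) DC by auto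
  interpret n: matroid_with_minor ?E ?r EN rN
  proof
    show "EN \<subseteq> ?E" using minor_ground DC by auto
    show "\<exists>C. carries ?E ?r EN rN C" using carries_minorI[OF C0] by blast
  qed (use minor_loopless minor_coloopless in auto)
  have "\<exists>x. x \<in> ?E - F \<and> (n.del x \<and> three_connected (?E - {x}) ?r \<or> n.con x \<and> three_connected (?E - {x}) (contract_rank ?r {x}))"
  proof (rule ccontr)
    assume no: "\<not> ?thesis"
    interpret s: stuck_tangle ?E ?r ?T "\<theta> - ?s" EN rN F
    proof
      show "three_connected ?E ?r" by (rule tc)
      show "3 \<le> \<theta> - ?s" using order(2) by simp
      show "F \<in> ?T" by (rule F(1))
      show "EN \<subseteq> F" by (rule ENF)
      show "lam ?E ?r F < lam ?E ?r Y" if "Y \<in> ?T" "F \<subset> Y" for Y using F(3) that .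
    qed (use no in blast)+
    show False by (rule s.stuck_False)
  qed
  then obtain x where x: "x \<in> ?E - F"
    "n.del x \<and> three_connected (?E - {x}) ?r \<or> n.con x \<and> three_connected (?E - {x}) (contract_rank ?r {x})" by blast
  have xE: "x \<in> E - F0" "x \<in> E - (EN \<union> ?I)" using x F(2) ENF by auto
  have card: "int (card (insert x ?I)) = ?s + 1" using xE fI by simp
  have "removable (insert x D) C \<or> removable D (insert x C)"
    using x(2)
  proof
    assume a: "n.del x \<and> three_connected (?E - {x}) ?r"
    then obtain C1 where C1: "carries ?E ?r EN rN C1" "x \<notin> C1" unfolding deletable_def by blast
    have "carries E r EN rN (C \<union> C1)" using carries_minorD[OF DC(2) C1(1)] .
    moreover have "insert x D \<inter> (C \<union> C1) = {}" using C1 xE DC unfolding carries_def by auto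
    moreover have "?E - {x} = E - (C \<union> insert x D)" "C \<union> insert x D = insert x ?I" by auto
    ultimately have "removable (insert x D) C"
      using a grow[OF xE(1)] card DC xE unfolding removable_def by auto
    thus ?thesis by simp
  next
    assume a: "n.con x \<and> three_connected (?E - {x}) (contract_rank ?r {x})"
    then obtain C1 where C1: "carries ?E ?r EN rN C1" "x \<in> C1" unfolding contractible_def by blast
    have "carries E r EN rN (C \<union> C1)" using carries_minorD[OF DC(2) C1(1)] .
    moreover have "D \<inter> (C \<union> C1) = {}" using C1 xE DC unfolding carries_def by auto
    moreover have "?E - {x} = E - (insert x C \<union> D)" "insert x C \<union> D = insert x ?I" by auto
    moreover have "contract_rank ?r {x} = contract_rank r (insert x C)"
      unfolding contract_rank_def by (rule ext) simp
    ultimately have "removable D (insert x C)"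
      using a grow[OF xE(1)] card DC xE C1(2) unfolding removable_def by auto
    thus ?thesis by simp
  qed
  thus ?thesis using that xE by blast
qed

text \<open>The bounds are those of \<open>removable_extend\<close> at the last step, where
  \<open>m - 1\<close> elements are gone. \<open>\<iota>\<close> is the time of removal, so its
  initial segments give the minors passed on the way.\<close>

lemma removal_sequence_exists:
  assumes "s \<le> m" "tangle_rho EN + 2 * int m < \<theta> + 2" "int m + 2 \<le> \<theta>"
  shows "\<exists>D C (\<iota>::'a \<Rightarrow> nat). removable D C \<and> card (C \<union> D) = s \<and> inj_on \<iota> (C \<union> D) \<and> (\<forall>x\<in>C \<union> D. \<iota> x < s) \<and>
    (\<forall>n. three_connected (E - ({c \<in> C. \<iota> c < n} \<union> {d \<in> D. \<iota> d < n})) (contract_rank r {c \<in> C. \<iota> c < n}))"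
  using assms(1)
proof (induction s)
  case 0
  have "removable {} {}" using conn3 minor_carried unfolding removable_def by auto
  thus ?case using conn3 by (intro exI[of _ "{}"]) auto
next
  case (Suc s)
  then obtain D C and \<iota> :: "'a \<Rightarrow> nat" where IH: "removable D C" "card (C \<union> D) = s" "inj_on \<iota> (C \<union> D)"
    "\<And>x. x \<in> C \<union> D \<Longrightarrow> \<iota> x < s"
    "\<And>n. three_connected (E - ({c \<in> C. \<iota> c < n} \<union> {d \<in> D. \<iota> d < n})) (contract_rank r {c \<in> C. \<iota> c < n})"
    using Suc by fastforce
  obtain e where e: "e \<in> E - (EN \<union> (C \<union> D))" "removable (insert e D) C \<or> removable D (insert e C)"
    using removable_extend[OF IH(1)] IH(2) Suc.prems assms(2,3) by auto
  let ?\<iota> = "\<iota>(e := s)"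
  have fin: "finite (C \<union> D)"
    using IH(1) finite_sub[of C] finite_sub[of D] unfolding removable_def by auto
  have inj: "inj_on ?\<iota> (insert e (C \<union> D))"
  proof -
    have "s \<notin> \<iota> ` (C \<union> D)" using IH(4) by auto
    thus ?thesis using IH(3) e(1) by (auto simp: inj_on_def)
  qed
  have lt: "?\<iota> x < Suc s" if "x \<in> insert e (C \<union> D)" for x using that IH(4)[of x] by (auto simp: less_Suc_eq)
  have card: "card (insert e (C \<union> D)) = Suc s" using e(1) fin IH(2) by simp
  have same: "{c \<in> X. ?\<iota> c < n} = {c \<in> X. \<iota> c < n}" if "e \<notin> X" for X n using that by auto
  have old: "{c \<in> insert e X. ?\<iota> c < n} = {c \<in> X. \<iota> c < n}" if "e \<notin> X" "n \<le> s" for X n using that by auto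
  have new: "{c \<in> X. ?\<iota> c < n} = X" if "X \<subseteq> insert e (C \<union> D)" "s < n" for X n using that lt by fastforce
  have eCD: "e \<notin> C" "e \<notin> D" using e by auto
  from e(2) show ?case
  proof
    assume rem: "removable (insert e D) C"
    have tcn: "three_connected (E - ({c \<in> C. ?\<iota> c < n} \<union> {d \<in> insert e D. ?\<iota> d < n})) (contract_rank r {c \<in> C. ?\<iota> c < n})" for n
    proof (cases "n \<le> s")
      case True
      show ?thesis unfolding same[OF eCD(1)] old[OF eCD(2) True] by (rule IH(5))
    next
      case False
      have "{c \<in> C. ?\<iota> c < n} = C" "{d \<in> insert e D. ?\<iota> d < n} = insert e D" using False by (intro new; auto)+
      thus ?thesis using rem unfolding removable_def by simp
    qed
    have un: "C \<union> insert e D = insert e (C \<union> D)" by auto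
    show ?thesis
    proof (rule exI[of _ "insert e D"], rule exI[of _ C], rule exI[of _ ?\<iota>], intro conjI ballI allI)
      show "card (C \<union> insert e D) = Suc s" unfolding un by (rule card)
      show "inj_on ?\<iota> (C \<union> insert e D)" unfolding un by (rule inj)
      show "?\<iota> x < Suc s" if "x \<in> C \<union> insert e D" for x using lt that unfolding un .
    qed (rule rem, rule tcn)
  next
    assume rem: "removable D (insert e C)"
    have tcn: "three_connected (E - ({c \<in> insert e C. ?\<iota> c < n} \<union> {d \<in> D. ?\<iota> d < n})) (contract_rank r {c \<in> insert e C. ?\<iota> c < n})" for n
    proof (cases "n \<le> s")
      case True
      show ?thesis unfolding same[OF eCD(2)] old[OF eCD(1) True] by (rule IH(5))
    next
      case False
      have "{c \<in> insert e C. ?\<iota> c < n} = insert e C" "{d \<in> D. ?\<iota> d < n} = D" using False by (intro new; auto)+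
      thus ?thesis using rem unfolding removable_def by simp
    qed
    have un: "insert e C \<union> D = insert e (C \<union> D)" by auto
    show ?thesis
    proof (rule exI[of _ D], rule exI[of _ "insert e C"], rule exI[of _ ?\<iota>], intro conjI ballI allI)
      show "card (insert e C \<union> D) = Suc s" unfolding un by (rule card)
      show "inj_on ?\<iota> (insert e C \<union> D)" unfolding un by (rule inj)
      show "?\<iota> x < Suc s" if "x \<in> insert e C \<union> D" for x using lt that unfolding un .
    qed (rule rem, rule tcn)
  qed
qed

lemma removable_set_exists:
  assumes k: "1 \<le> k" "20 * int k + tangle_rho EN - 13 \<le> \<theta>"
  shows "\<exists>X\<subseteq>E - EN. card X = k \<and> tangle_rho (EN \<union> X) = tangle_rho EN + int k \<and>
    (three_connected (E - X) r \<and> (\<exists>C0. carries E r EN rN C0 \<and> X \<inter> C0 = {}) \<or>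
     three_connected (E - X) (contract_rank r X) \<and> (\<exists>C0. carries E r EN rN C0 \<and> X \<subseteq> C0))"
proof -
  define m where "m = 6 * k - 5"
  have m: "int m = 6 * int k - 5" using k unfolding m_def by simp
  have t0: "0 \<le> tangle_rho EN" using tangle_rho_nonneg order3 by simp
  \<comment> \<open>The first bound permits \<open>m\<close> removals. The second makes every set of
    at most \<open>m + 2\<close> elements small, as \<open>rho_lam\<close> requires.\<close>
  have "tangle_rho EN + 2 * int m < \<theta> + 2" "int m + 2 < \<theta>" using m k t0 by linarith+
  then obtain D C and \<iota> :: "'a \<Rightarrow> nat" where S: "removable D C" "card (C \<union> D) = m" "inj_on \<iota> (C \<union> D)"
    "\<And>n. three_connected (E - ({c \<in> C. \<iota> c < n} \<union> {d \<in> D. \<iota> d < n})) (contract_rank r {c \<in> C. \<iota> c < n})"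
    using removal_sequence_exists[of m m] by fastforce
  let ?I = "C \<union> D"
  have DC: "D \<subseteq> E - EN" "C \<subseteq> E - EN" "D \<inter> C = {}" and rho: "tangle_rho (EN \<union> ?I) = tangle_rho EN + int (card ?I)"
    using S(1) unfolding removable_def by auto
  obtain C0 where C0: "carries E r EN rN C0" "C \<subseteq> C0" "D \<inter> C0 = {}" using S(1) unfolding removable_def by blast
  have IE: "?I \<subseteq> E" using DC by auto
  have fI: "finite ?I" using IE finite_sub by blast
  have small: "tangle_rho X \<le> lam E r X" if "X \<subseteq> E" "card X \<le> card ?I + 2" for X
    using that S(2) \<open>int m + 2 < \<theta>\<close> by (intro rho_small) auto
  interpret rs: removal_sequence E r tangle_rho D C \<iota>
  proof
    show "D \<subseteq> E" "C \<subseteq> E" "D \<inter> C = {}" using DC by auto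
    show "0 \<le> tangle_rho {}" using tangle_rho_nonneg order3 by simp
    show "tangle_rho X \<le> tangle_rho Y" if "X \<subseteq> Y" "Y \<subseteq> E" for X Y using that tangle_rho_mono by blast
    show "tangle_rho (X \<union> Y) + tangle_rho (X \<inter> Y) \<le> tangle_rho X + tangle_rho Y" for X Y by (rule tangle_rho_submod)
    show "tangle_rho X \<le> lam E r X" if "X \<subseteq> E" "card X \<le> card ?I + 2" for X using small that .
    show "2 \<le> tangle_rho {a, b}" if "a \<in> E" "b \<in> E" "a \<noteq> b" for a b
    proof -
      have "2 \<le> lam E r Y" if Y: "Y \<in> T" "{a, b} \<subseteq> Y" for Y
      proof (rule lam_ge_2[OF Y(1)])
        have "card {a, b} \<le> card Y" using Y finite_sub tangle_subset by (intro card_mono) auto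
        thus "2 \<le> card Y" using \<open>a \<noteq> b\<close> by simp
      qed auto
      thus ?thesis using rho_cases[of "{a, b}"] order3 by fastforce
    qed
    have "tangle_rho (EN \<union> ?I) \<le> tangle_rho EN + tangle_rho ?I" using order3 by (intro rho_union_le) simp
    thus "int (card ?I) \<le> tangle_rho ?I" using rho by simp
    show "inj_on \<iota> ?I" by (rule S(3))
    show "three_connected (E - ({c \<in> C. \<iota> c < n} \<union> {d \<in> D. \<iota> d < n})) (contract_rank r {c \<in> C. \<iota> c < n})" for n
      by (rule S(4))
    show "4 \<le> card (E - ?I)"
    proof -
      \<comment> \<open>\<open>?I\<close> is small, so two elements lie outside; with them added it
        is still small, so two more do.\<close>
      have "?I \<in> T" using S(2) \<open>int m + 2 < \<theta>\<close> IE by (intro tangle_small) auto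
      then obtain a b where ab: "a \<in> E - ?I" "b \<in> E - ?I" "a \<noteq> b"
        using tangle_card_compl finite_ground by (metis two_elements finite_Diff)
      let ?J = "?I \<union> {a, b}"
      have cJ: "card ?J \<le> m + 2" using card_Un_le[of ?I "{a, b}"] S(2) ab by simp
      hence "?J \<in> T" using \<open>int m + 2 < \<theta>\<close> IE ab by (intro tangle_small) auto
      hence "2 \<le> card (E - ?J)" by (rule tangle_card_compl)
      moreover have "card (E - ?I) = card (E - ?J) + card {a, b}"
      proof -
        have e: "E - ?I = (E - ?J) \<union> {a, b}" using ab by auto
        show ?thesis by (subst e, rule card_Un_disjoint) (use finite_ground in auto)
      qed
      moreover have "card {a, b} = 2" using ab(3) by simp
      ultimately show ?thesis by linarith
    qed
  qed
  \<comment> \<open>Going on from \<open>EN \<union> X\<close> to \<open>EN \<union> ?I\<close> adds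
    at most one per element, so the full rank of the latter forces full rank already at
    \<open>EN \<union> X\<close>.\<close>
  have rhoX: "tangle_rho (EN \<union> X) = tangle_rho EN + int (card X)" if X: "X \<subseteq> ?I" for X
  proof -
    have small': "tangle_rho Y \<le> int (card Y)" if "Y \<subseteq> ?I" for Y
    proof -
      have "card Y \<le> card ?I" using that fI by (intro card_mono)
      hence "tangle_rho Y \<le> lam E r Y" using that IE by (intro small) auto
      moreover have "lam E r Y \<le> int (card Y)" using that IE by (intro lam_le_card) auto
      ultimately show ?thesis by simp
    qed
    have "tangle_rho (EN \<union> X) \<le> tangle_rho EN + tangle_rho X" using order3 by (intro rho_union_le) simp
    moreover have "tangle_rho (EN \<union> X \<union> (?I - X)) \<le> tangle_rho (EN \<union> X) + tangle_rho (?I - X)"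
      using order3 by (intro rho_union_le) simp
    moreover have "EN \<union> X \<union> (?I - X) = EN \<union> ?I" using X by auto
    moreover have "int (card (?I - X)) = int (card ?I) - int (card X)"
      using X fI by (simp add: card_Diff_subset card_mono finite_subset of_nat_diff)
    ultimately show ?thesis using small'[OF X] small'[of "?I - X"] rho by auto
  qed
  have "6 * k \<le> card ?I + 5" using S(2) m by linarith
  from rs.many_removals[OF k(1) this] show ?thesis
  proof
    assume "\<exists>X\<subseteq>D. card X = k \<and> three_connected (E - X) r"
    then obtain X where X: "X \<subseteq> D" "card X = k" "three_connected (E - X) r" by blast
    hence "X \<inter> C0 = {}" "X \<subseteq> E - EN" using C0 DC by auto
    thus ?thesis using X rhoX[of X] C0 by (intro exI[of _ X]) auto
  next
    assume "\<exists>X\<subseteq>C. card X = k \<and> three_connected (E - X) (contract_rank r X)"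
    then obtain X where X: "X \<subseteq> C" "card X = k" "three_connected (E - X) (contract_rank r X)" by blast
    hence "X \<subseteq> C0" "X \<subseteq> E - EN" using C0 DC by auto
    thus ?thesis using X rhoX[of X] C0 by (intro exI[of _ X]) auto
  qed
qed

end

section \<open>Translation from natural-number ranks\<close>

lemma matroid_rank_matroid: "matroid M \<Longrightarrow> rank_matroid (gset M) (\<lambda>X. int (rk M X))"
  unfolding matroid_def by unfold_locales (auto simp flip: of_nat_add)

text \<open>Truncated subtraction in \<open>conn\<close> is harmless because \<open>lam\<close> is
  nonnegative. The separate \<open>r\<close> lets the lemma apply to contractions, with
  \<open>contract_rank\<close>.\<close>

lemma conn_eq_lam:
  assumes "rank_matroid (gset Q) r" "\<And>X. X \<subseteq> gset Q \<Longrightarrow> int (rk Q X) = r X" "X \<subseteq> gset Q"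
  shows "int (conn Q X) = lam (gset Q) r X"
proof -
  interpret rank_matroid "gset Q" r by (rule assms(1))
  have "r (gset Q) \<le> r X + r (gset Q - X)" using lam_nonneg[OF assms(3)] unfolding lam_def by simp
  moreover have "int (rk Q X) = r X" "int (rk Q (gset Q - X)) = r (gset Q - X)" "int (rk Q (gset Q)) = r (gset Q)"
    using assms by auto
  ultimately show ?thesis unfolding conn_def lam_def by linarith
qed

lemma n_connected_3_iff:
  assumes "rank_matroid (gset Q) r" "\<And>X. X \<subseteq> gset Q \<Longrightarrow> int (rk Q X) = r X"
  shows "n_connected 3 Q \<longleftrightarrow> three_connected (gset Q) r"
proof
  assume n: "n_connected 3 Q"
  show "three_connected (gset Q) r" unfolding three_connected_def
  proof (intro allI impI)
    fix X assume X: "X \<subseteq> gset Q"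
    have "\<not> k_separation Q 1 X" "\<not> k_separation Q 2 X" using n unfolding n_connected_def by auto
    thus "min 2 (min (int (card X)) (int (card (gset Q - X)))) \<le> lam (gset Q) r X"
      using conn_eq_lam[OF assms X] X unfolding k_separation_def by auto
  qed
next
  assume t: "three_connected (gset Q) r"
  show "n_connected 3 Q" unfolding n_connected_def
  proof (intro allI impI notI)
    fix k X assume k: "1 \<le> k \<and> k < 3" and s: "k_separation Q k X"
    have X: "X \<subseteq> gset Q" using s unfolding k_separation_def by simp
    have "min 2 (min (int (card X)) (int (card (gset Q - X)))) \<le> lam (gset Q) r X"
      using t X unfolding three_connected_def by blast
    thus False using k s conn_eq_lam[OF assms X] unfolding k_separation_def by linarith
  qed
qed

lemma is_tangle_tangle_matroid:
  assumes "matroid M" "is_tangle M \<theta> T"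
  shows "tangle_matroid (gset M) (\<lambda>X. int (rk M X)) T (int \<theta>)"
proof -
  interpret rank_matroid "gset M" "\<lambda>X. int (rk M X)" using matroid_rank_matroid assms by blast
  have c: "int (conn M X) = lam (gset M) (\<lambda>X. int (rk M X)) X" if "X \<subseteq> gset M" for X
    using conn_eq_lam[of M "\<lambda>X. int (rk M X)" X] rank_matroid_axioms that by simp
  note tt = assms(2)[unfolded is_tangle_def]
  note t = tt[THEN conjunct1] tt[THEN conjunct2, THEN conjunct1] tt[THEN conjunct2, THEN conjunct2, THEN conjunct1]
    tt[THEN conjunct2, THEN conjunct2, THEN conjunct2, THEN conjunct1]
    tt[THEN conjunct2, THEN conjunct2, THEN conjunct2, THEN conjunct2]
  show ?thesis
  proof
    show sub: "X \<subseteq> gset M" if "X \<in> T" for X using t(1) that by auto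
    show "lam (gset M) (\<lambda>X. int (rk M X)) X < int \<theta>" if "X \<in> T" for X
      using t(2) that c[OF sub[OF that]] by auto
    show "X \<in> T \<or> gset M - X \<in> T" if "X \<subseteq> gset M" "lam (gset M) (\<lambda>X. int (rk M X)) X < int \<theta>" for X
      using t(3) that c[OF that(1)] by auto
    show "X \<union> Y \<union> Z \<noteq> gset M" if "X \<in> T" "Y \<in> T" "Z \<in> T" for X Y Z
      using t(4) that by auto
    show "gset M - {e} \<notin> T" if "e \<in> gset M" for e using t(5) that by auto
  qed
qed

lemma tangle_rank_eq:
  assumes "matroid M" "is_tangle M \<theta> T"
  shows "int (tangle_rank M \<theta> T X) = tangle_matroid.tangle_rho (gset M) (\<lambda>X. int (rk M X)) T (int \<theta>) X"
proof -
  interpret tangle_matroid "gset M" "\<lambda>X. int (rk M X)" T "int \<theta>" using is_tangle_tangle_matroid[OF assms] .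
  have c: "int (conn M X) = lam (gset M) (\<lambda>X. int (rk M X)) X" if "X \<in> T" for X
    using conn_eq_lam[of M "\<lambda>X. int (rk M X)" X] rank_matroid_axioms tangle_subset[OF that] by simp
  show ?thesis
  proof (cases "\<exists>Y\<in>T. X \<subseteq> Y")
    case True
    let ?S = "{Y \<in> T. X \<subseteq> Y}"
    have "int (Min (conn M ` ?S)) = Min (int ` conn M ` ?S)"
      using True finite_tangle by (intro mono_Min_commute) (auto simp: mono_def)
    also have "int ` conn M ` ?S = lam (gset M) (\<lambda>X. int (rk M X)) ` ?S"
      unfolding image_image by (rule image_cong) (use c in auto)
    finally show ?thesis using True unfolding tangle_rank_def tangle_rho_def by simp
  next
    case False
    thus ?thesis unfolding tangle_rank_def tangle_rho_def by simp
  qed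
qed

lemma is_minor_carries:
  assumes "matroid M" "is_minor N M"
  shows "gset N \<subseteq> gset M" "\<exists>C. carries (gset M) (\<lambda>X. int (rk M X)) (gset N) (\<lambda>X. int (rk N X)) C"
proof -
  interpret rank_matroid "gset M" "\<lambda>X. int (rk M X)" using matroid_rank_matroid assms by blast
  obtain C D where CD: "C \<subseteq> gset M" "D \<subseteq> gset M" "gset N = gset M - C - D"
    "\<And>X. X \<subseteq> gset N \<Longrightarrow> rk N X = rk M (X \<union> C) - rk M C"
    using assms(2) unfolding is_minor_def deletion_def contraction_def gset_def rk_def by auto
  show "gset N \<subseteq> gset M" using CD by auto
  have "int (rk N X) = int (rk M (X \<union> C)) - int (rk M C)" if "X \<subseteq> gset N" for X
  proof -
    have "int (rk M C) \<le> int (rk M (X \<union> C))" using that CD by (intro rank_mono) auto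
    thus ?thesis using CD(4)[OF that] by simp
  qed
  hence "carries (gset M) (\<lambda>X. int (rk M X)) (gset N) (\<lambda>X. int (rk N X)) C"
    using CD unfolding carries_def by auto
  thus "\<exists>C. carries (gset M) (\<lambda>X. int (rk M X)) (gset N) (\<lambda>X. int (rk N X)) C" by blast
qed

lemma carries_is_minor_deletion:
  assumes "carries (gset M) (\<lambda>X. int (rk M X)) (gset N) (\<lambda>X. int (rk N X)) C" "X \<inter> C = {}" "X \<inter> gset N = {}"
    "gset N \<subseteq> gset M"
  shows "is_minor N (deletion M X)"
proof -
  have C: "C \<subseteq> gset M - gset N" and N: "\<And>Y. Y \<subseteq> gset N \<Longrightarrow> int (rk N Y) = int (rk M (Y \<union> C)) - int (rk M C)"
    using assms(1) unfolding carries_def by auto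
  have N': "rk N Y = rk M (Y \<union> C) - rk M C" if "Y \<subseteq> gset N" for Y using N[OF that] by linarith
  let ?D = "gset M - X - gset N - C"
  have g: "gset N = gset M - X - C - ?D" using C assms by auto
  show ?thesis
    unfolding is_minor_def
  proof (rule exI[of _ C], rule exI[of _ ?D], intro conjI allI impI)
    show "C \<subseteq> gset (deletion M X)" "?D \<subseteq> gset (deletion M X)" "C \<inter> ?D = {}"
      using C assms unfolding deletion_def gset_def by auto
    show "gset N = gset (deletion (contraction (deletion M X) C) ?D)"
      using g unfolding deletion_def contraction_def gset_def by simp
    fix Y assume "Y \<subseteq> gset N"
    thus "rk N Y = rk (deletion (contraction (deletion M X) C) ?D) Y"
      using N' unfolding deletion_def contraction_def gset_def rk_def by simp
  qed
qed

lemma carries_is_minor_contraction: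
  assumes "matroid M" "carries (gset M) (\<lambda>X. int (rk M X)) (gset N) (\<lambda>X. int (rk N X)) C" "X \<subseteq> C"
    "gset N \<subseteq> gset M"
  shows "is_minor N (contraction M X)"
proof -
  interpret rank_matroid "gset M" "\<lambda>X. int (rk M X)" using matroid_rank_matroid assms by blast
  have C: "C \<subseteq> gset M - gset N" and N: "\<And>Y. Y \<subseteq> gset N \<Longrightarrow> int (rk N Y) = int (rk M (Y \<union> C)) - int (rk M C)"
    using assms(2) unfolding carries_def by auto
  have N': "rk N Y = rk M (Y \<union> (C - X) \<union> X) - rk M X - (rk M (C - X \<union> X) - rk M X)" if "Y \<subseteq> gset N" for Y
  proof -
    have e: "Y \<union> (C - X) \<union> X = Y \<union> C" "C - X \<union> X = C" using assms(3) by auto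
    have "int (rk M X) \<le> int (rk M C)" using C assms by (intro rank_mono) auto
    moreover have "int (rk M C) \<le> int (rk M (Y \<union> C))" using C assms that by (intro rank_mono) auto
    ultimately show ?thesis using N[OF that] unfolding e by linarith
  qed
  let ?D = "gset M - gset N - C"
  have g: "gset N = gset M - X - (C - X) - ?D" using C assms by auto
  show ?thesis
    unfolding is_minor_def
  proof (rule exI[of _ "C - X"], rule exI[of _ ?D], intro conjI allI impI)
    show "C - X \<subseteq> gset (contraction M X)" "?D \<subseteq> gset (contraction M X)" "(C - X) \<inter> ?D = {}"
      using C assms unfolding contraction_def gset_def by auto
    show "gset N = gset (deletion (contraction (contraction M X) (C - X)) ?D)"
      using g unfolding deletion_def contraction_def gset_def by simp
    fix Y assume "Y \<subseteq> gset N"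
    thus "rk N Y = rk (deletion (contraction (contraction M X) (C - X)) ?D) Y"
      using N' unfolding deletion_def contraction_def gset_def rk_def by simp
  qed
qed

theorem theorem5p3:
  fixes M N :: "'a matroid" and \<theta> k :: nat and T :: "'a set set"
  assumes "matroid M"
    and "n_connected 3 M"
    and "is_tangle M \<theta> T"
    and "is_minor N M"
    and "\<forall>e. \<not> loop N e" and "\<forall>e. \<not> coloop N e"
    and "int \<theta> \<ge> 20 * int k + int (tangle_rank M \<theta> T (gset N)) - 13"
  shows "\<exists>X. X \<subseteq> gset M \<and> card X = k
      \<and> tangle_rank M \<theta> T (gset N \<union> X) = tangle_rank M \<theta> T (gset N) + k
      \<and> ((n_connected 3 (deletion M X) \<and> is_minor N (deletion M X))
         \<or> (n_connected 3 (contraction M X) \<and> is_minor N (contraction M X)))"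
proof (cases "k = 0")
  case True
  \<comment> \<open>For \<open>k = 0\<close> the order may be below three, outside the reach of the
    locale, and the empty set answers the claim.\<close>
  have "deletion M {} = M" unfolding deletion_def gset_def rk_def by simp
  thus ?thesis using True assms(2,4) by (intro exI[of _ "{}"]) simp
next
  case False
  let ?r = "\<lambda>X. int (rk M X)" and ?rN = "\<lambda>X. int (rk N X)"
  interpret t: tangle_matroid "gset M" ?r T "int \<theta>" using is_tangle_tangle_matroid assms by blast
  note rho = tangle_rank_eq[OF assms(1,3)]
  note mc = is_minor_carries[OF assms(1,4)]
  interpret tangle_with_minor "gset M" ?r T "int \<theta>" "gset N" ?rN
  proof
    show "three_connected (gset M) ?r"
      using n_connected_3_iff[of M ?r] t.rank_matroid_axioms assms(2) by simp
    show "3 \<le> int \<theta>" using assms(7) False by simp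
    show "gset N \<subseteq> gset M" by (rule mc)
    show "\<exists>C. carries (gset M) ?r (gset N) ?rN C" by (rule mc)
    show "?rN {g} \<noteq> 0" if "g \<in> gset N" for g using assms(5) that unfolding loop_def by auto
    show "?rN (gset N - {g}) = ?rN (gset N)" if g: "g \<in> gset N" for g
    proof -
      obtain C where C: "C \<subseteq> gset M - gset N" "\<And>X. X \<subseteq> gset N \<Longrightarrow> ?rN X = ?r (X \<union> C) - ?r C"
        using mc(2) unfolding carries_def by auto
      have "?r (gset N - {g} \<union> C) \<le> ?r (gset N \<union> C)" using C(1) mc(1) by (intro t.rank_mono) auto
      hence "?rN (gset N - {g}) \<le> ?rN (gset N)" using C(2)[of "gset N"] C(2)[of "gset N - {g}"] by auto
      moreover have "\<not> rk N (gset N - {g}) < rk N (gset N)" using assms(6) g unfolding coloop_def by blast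
      ultimately show ?thesis by simp
    qed
  qed
  obtain X where X: "X \<subseteq> gset M - gset N" "card X = k" "t.tangle_rho (gset N \<union> X) = t.tangle_rho (gset N) + int k"
    and c: "three_connected (gset M - X) ?r \<and> (\<exists>C0. carries (gset M) ?r (gset N) ?rN C0 \<and> X \<inter> C0 = {}) \<or>
     three_connected (gset M - X) (contract_rank ?r X) \<and> (\<exists>C0. carries (gset M) ?r (gset N) ?rN C0 \<and> X \<subseteq> C0)"
  proof -
    have "1 \<le> k" "20 * int k + t.tangle_rho (gset N) - 13 \<le> int \<theta>"
      using assms(7) False rho[of "gset N"] by auto
    from removable_set_exists[OF this] show ?thesis using that by blast
  qed
  have "int (tangle_rank M \<theta> T (gset N \<union> X)) = int (tangle_rank M \<theta> T (gset N)) + int k"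
    using X(3) rho by simp
  hence tr: "tangle_rank M \<theta> T (gset N \<union> X) = tangle_rank M \<theta> T (gset N) + k" by linarith
  have XE: "X \<subseteq> gset M" "X \<inter> gset N = {}" using X by auto
  have "(n_connected 3 (deletion M X) \<and> is_minor N (deletion M X))
         \<or> (n_connected 3 (contraction M X) \<and> is_minor N (contraction M X))"
    using c
  proof (elim disjE conjE exE)
    fix C0 assume a: "three_connected (gset M - X) ?r" "carries (gset M) ?r (gset N) ?rN C0" "X \<inter> C0 = {}"
    have "gset (deletion M X) = gset M - X" "rk (deletion M X) = rk M" unfolding deletion_def gset_def rk_def by auto
    hence "n_connected 3 (deletion M X)"
      using n_connected_3_iff[of "deletion M X" ?r] t.rank_matroid_delete[OF XE(1)] a(1) by simp
    moreover have "is_minor N (deletion M X)" using carries_is_minor_deletion[OF a(2,3) XE(2) mc(1)] .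
    ultimately show ?thesis by blast
  next
    fix C0 assume a: "three_connected (gset M - X) (contract_rank ?r X)" "carries (gset M) ?r (gset N) ?rN C0" "X \<subseteq> C0"
    have g: "gset (contraction M X) = gset M - X" unfolding contraction_def gset_def by simp
    have "int (rk (contraction M X) Y) = contract_rank ?r X Y" if "Y \<subseteq> gset M - X" for Y
    proof -
      have "?r X \<le> ?r (Y \<union> X)" using that XE by (intro t.rank_mono) auto
      thus ?thesis unfolding contraction_def contract_rank_def rk_def by simp
    qed
    hence "n_connected 3 (contraction M X)"
      using n_connected_3_iff[of "contraction M X" "contract_rank ?r X"] t.rank_matroid_contract[OF XE(1)] a(1) g by simp
    moreover have "is_minor N (contraction M X)" using carries_is_minor_contraction[OF assms(1) a(2,3) mc(1)] .
    ultimately show ?thesis by blast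
  qed
  thus ?thesis using XE X(2) tr by blast
qed

end
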